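(* Let $p\geq 2$ be an integer and let $v=(v_k)_{k\geq 1}$ be a real sequence with only finitely many, and at least one, non-zero terms. Put $k_v:=\min\{k:v_k\neq 0\}$ and $K_v:=\max\{k:v_k\neq 0\}$. Let $f$ be an angular function that is $K_v$ times differentiable at zero. Let $(\kappa_n)$ be a positive real sequence with $\kappa_n=o(1)$. Fix $\tau>0$ and put, for each positive integer $k\le K_v$, $$ \xi_{p,k}(\tau):=\frac{m_{k,k}^2\,(f^{(k)}(0))^2\,\tau^{2k}}{(k!)^2\,t_{p,k}^2}=\frac{d_{p,k}\,(f^{(k)}(0))^2\,\tau^{2k}}{\prod_{\ell=0}^{k-1}(p+2\ell)^2}. $$ Then, as $n\to\infty$: (i) under $\mathrm{P}^{(n)}_{\kappa_n,f}$ with $\kappa_n=o(n^{-1/(2k_v)})$, $S_v^{(n)}$ converges in distribution to $\sum_{k=1}^{K_v}v_k^2\chi^2_{d_{p,k}}$; (ii) under $\mathrm{P}^{(n)}_{\kappa_n,f}$ with $\kappa_n=n^{-1/(2k_v)}\tau$, $S_v^{(n)}$ converges in distribution to $\sum_{k=1}^{K_v}v_k^2\chi^2_{d_{p,k}}(\delta_{k,k_v}\xi_{p,k_v}(\tau))$; (iii) if $n^{1/(2k_v)}\kappa_n\to\infty$ and $f^{(k_v)}(0)\neq 0$, then $\mathrm{P}^{(n)}_{\kappa_n,f}[S_v^{(n)}>c]\to 1$ for every $c>0$ (so that the test rejecting for $S_v^{(n)}$ larger than the upper $\alpha$-quantile of $\sum_{k=1}^{K_v}v_k^2\chi^2_{d_{p,k}}$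 is consistent under this sequence of alternatives).
   Context: $\mathcal{S}^{p-1}$ is the unit sphere of $\mathbb{R}^p$ and $\theta_0:=(0,\ldots,0,1)'\in\mathbb{R}^p$. An angular function is a (Borel measurable) function $f:\mathbb{R}\to[0,\infty)$ with $f(0)=1$; $f^{(k)}$ denotes its $k$th derivative. For $\kappa_n>0$, $\mathrm{P}^{(n)}_{\kappa_n,f}$ is the hypothesis under which $U_1,\ldots,U_n$ are i.i.d. on $\mathcal{S}^{p-1}$ with density, with respect to the surface area measure, proportional to $u\mapsto f(\kappa_n u'\theta_0)$. (This is well defined as soon as the integral of this function is finite and positive, hence for all large $n$ when $\kappa_n\to0$ and $f$ is continuous at zero.) Equivalently $U_1'\theta_0$ has density $c_{p,\kappa_n,f}(1-s^2)^{(p-3)/2}f(\kappa_n s)$ on $[-1,1]$, with $c_{p,\kappa,f}:=1/\int_{-1}^1(1-s^2)^{(p-3)/2}f(\kappa s)\,ds$, and the distribution of $U_1$ is invariant under rotations fixing $\theta_0$. Polynomials: $C_q^{0}$ is the Chebyshev polynomial of the first kind, $C_q^0(\cos\theta)=\cos(q\theta)$; for $\lambda>0$, $C_q^\lambda(t)=\sum_{j=0}^{\lfloor q/2\rfloor}(-1)^j\frac{2^{q-2j}\Gamma(q-j+\lambda)}{\Gamma(\lambda)j!(q-2j)!}t^{q-2j}$ is the Gegenbauer polynomial. The real numbers $m_{k,i}$, $0\le k\le i$, are defined, for each positive integer $i$, by $t^i=\sum_{k=0}^i m_{k,i}C_k^{(p-2)/2}(t)$. Constants: $d_{p,k}=\binom{p+k-3}{p-2}+\binom{p+k-2}{p-2}$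 for $k\ge1$ (so $d_{2,k}=2$); $t_{p,k}:=\sqrt2$ if $p=2$ and $t_{p,k}:=(1+2k/(p-2))/\sqrt{d_{p,k}}$ if $p\ge3$; $\delta_{k,\ell}$ is the Kronecker delta. Sobolev statistic: $S_v^{(n)}:=\frac1n\sum_{i,j=1}^n\sum_{k=1}^\infty v_k^2h_{p,k}(U_i'U_j)$, where $h_{p,k}(s):=2C_k^0(s)$ if $p=2$ and $h_{p,k}(s):=(1+\frac{2k}{p-2})C_k^{(p-2)/2}(s)$ if $p\geq3$. $\chi^2_d(\xi)$ is the non-central chi-square distribution with $d$ degrees of freedom and non-centrality parameter $\xi$ (law of $\|Z\|^2$ with $Z\sim N(\mu,I_d)$, $\|\mu\|^2=\xi$), $\chi^2_d:=\chi^2_d(0)$; $\sum_k w_k\chi^2_{d_k}(\xi_k)$ denotes the law of the weighted sum of mutually independent random variables with these distributions. *)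

theory Defs
  imports
    "HOL-Probability.Probability"
    "HOL-Computational_Algebra.Polynomial"
begin

section \<open>Chebyshev and Gegenbauer polynomials\<close>

fun chebyshev :: "nat \<Rightarrow> real poly" where
  "chebyshev 0 = 1"
| "chebyshev (Suc 0) = [:0, 1:]"
| "chebyshev (Suc (Suc q)) = [:0, 2:] * chebyshev (Suc q) - chebyshev q"

lemma chebyshev_cos: "poly (chebyshev q) (cos \<theta>) = cos (real q * \<theta>)"
proof (induction q rule: chebyshev.induct)
  case (3 q)
  have "cos (real (Suc (Suc q)) * \<theta>) + cos (real q * \<theta>)
      = cos (real (Suc q) * \<theta> + \<theta>) + cos (real (Suc q) * \<theta> - \<theta>)"
    by (simp add: algebra_simps)
  also have "\<dots> = 2 * cos \<theta> * cos (real (Suc q) * \<theta>)"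
    unfolding cos_add cos_diff by (simp add: algebra_simps)
  finally show ?case
    using 3 by simp
qed auto

text \<open>The relation \<open>C\<^sub>q\<^sup>0(cos \<theta>) = cos (q \<theta>)\<close> determines the polynomial.\<close>

lemma chebyshev_unique:
  "(\<forall>\<theta>. poly P (cos \<theta>) = cos (real q * \<theta>)) \<longleftrightarrow> P = chebyshev q"
proof
  assume *: "\<forall>\<theta>. poly P (cos \<theta>) = cos (real q * \<theta>)"
  have "{-1..1} \<subseteq> {x. poly (P - chebyshev q) x = 0}"
  proof
    fix x :: real assume "x \<in> {-1..1}"
    then have "x = cos (arccos x)" by simp
    then show "x \<in> {x. poly (P - chebyshev q) x = 0}"
      using * chebyshev_cos by (metis (mono_tags, lifting) diff_self mem_Collect_eq poly_diff)
  qed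
  moreover have "infinite {-1..(1::real)}"
    by simp
  ultimately have "P - chebyshev q = 0"
    using poly_roots_finite[of "P - chebyshev q"] finite_subset by blast
  then show "P = chebyshev q" by simp
qed (simp add: chebyshev_cos)

definition gegenbauer :: "real \<Rightarrow> nat \<Rightarrow> real poly" where
  "gegenbauer \<nu> q =
    (if \<nu> = 0 then chebyshev q
     else \<Sum>j=0..q div 2.
       monom ((-1) ^ j * (2 ^ (q - 2 * j) * Gamma (real q - real j + \<nu>))
              / (Gamma \<nu> * fact j * fact (q - 2 * j))) (q - 2 * j))"

text \<open>
  \<open>monomial_coeff p k i\<close> is the coefficient \<open>m\<^sub>k\<^sub>,\<^sub>i\<close> in
  \<open>t\<^sup>i = (\<Sum>k=0..i. m\<^sub>k\<^sub>,\<^sub>i * C\<^sub>k(t))\<close> with \<open>C\<^sub>k\<close> the polynomials of index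
  \<open>(p - 2) / 2\<close>; it is set to \<open>0\<close> for \<open>k > i\<close>.
\<close>

definition monomial_coeff :: "nat \<Rightarrow> nat \<Rightarrow> nat \<Rightarrow> real" where
  "monomial_coeff p k i =
    (THE m. (\<forall>k>i. m k = 0) \<and>
       (\<forall>t. t ^ i = (\<Sum>k=0..i. m k * poly (gegenbauer ((real p - 2) / 2) k) t))) k"

lemma coeff_gegenbauer_top:
  assumes "\<nu> \<ge> 0" shows "coeff (gegenbauer \<nu> q) q \<noteq> 0"
    and "degree (gegenbauer \<nu> q) \<le> q"
proof -
  have cheb: "degree (chebyshev q) \<le> q \<and> coeff (chebyshev q) q \<noteq> 0" for q
  proof (induction q rule: chebyshev.induct)
    case (3 q)
    have "degree ([:0, 2:] * chebyshev (Suc q)) \<le> Suc (Suc q)"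
      using 3 by (intro order.trans[OF degree_mult_le]) auto
    moreover have "coeff (chebyshev q) (Suc (Suc q)) = 0"
      using 3 by (intro coeff_eq_0) auto
    ultimately show ?case
      using 3 by (auto intro!: degree_diff_le)
  qed auto
  have geg: "degree (gegenbauer \<nu> q) \<le> q \<and> coeff (gegenbauer \<nu> q) q \<noteq> 0" if "\<nu> > 0"
  proof -
    have "degree (gegenbauer \<nu> q) \<le> q"
      using that unfolding gegenbauer_def
      by (auto intro!: degree_sum_le order.trans[OF degree_monom_le])
    moreover have "coeff (gegenbauer \<nu> q) q = 2 ^ q * Gamma (real q + \<nu>) / (Gamma \<nu> * fact q)"
    proof -
      have *: "{0..q div 2} \<inter> {x. q - 2 * x = q} = {0}"
        by auto
      show ?thesis
        using that unfolding gegenbauer_def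
        by (simp add: coeff_sum sum.If_cases * cong: if_cong)
    qed
    moreover have "Gamma \<nu> > 0" "Gamma (real q + \<nu>) > 0"
      using that by auto
    ultimately show ?thesis by simp
  qed
  show "coeff (gegenbauer \<nu> q) q \<noteq> 0" "degree (gegenbauer \<nu> q) \<le> q"
    using cheb geg assms by (cases "\<nu> = 0"; force simp: gegenbauer_def)+
qed

lemma gegenbauer_expansion:
  assumes "\<nu> \<ge> 0" "degree P \<le> i"
  shows "\<exists>!m. (\<forall>k>i. m k = 0) \<and> P = (\<Sum>k=0..i. smult (m k) (gegenbauer \<nu> k))"
  using assms(2)
proof (induction i arbitrary: P)
  case 0
  have *: "gegenbauer \<nu> 0 = [:coeff (gegenbauer \<nu> 0) 0:]"
    using coeff_gegenbauer_top(2)[OF assms(1), of 0] by (metis degree_0_id le_zero_eq)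
  let ?c = "coeff (gegenbauer \<nu> 0) 0"
  have c: "?c \<noteq> 0" by (rule coeff_gegenbauer_top(1)[OF assms(1)])
  obtain a where a: "P = [:a:]" using 0 by (metis degree_0_id le_zero_eq)
  have eq: "P = (\<Sum>k=0..0. smult (m k) (gegenbauer \<nu> k)) \<longleftrightarrow> m 0 = a / ?c" for m
  proof -
    have "smult (m 0) (gegenbauer \<nu> 0) = [:m 0 * ?c:]"
      using arg_cong[OF *, of "smult (m 0)"] unfolding smult_pCons smult_0_right .
    then show ?thesis using c by (auto simp: a field_simps)
  qed
  show ?case
    unfolding eq
    by (rule ex1I[of _ "\<lambda>k. if k = 0 then a / ?c else 0"]) (auto simp: fun_eq_iff)
next
  case (Suc i)
  let ?G = "gegenbauer \<nu>"
  let ?b = "coeff P (Suc i) / coeff (?G (Suc i)) (Suc i)"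
  have c: "coeff (?G (Suc i)) (Suc i) \<noteq> 0" by (rule coeff_gegenbauer_top(1)[OF assms(1)])
  let ?Q = "P - smult ?b (?G (Suc i))"
  have "degree ?Q \<le> i"
  proof (rule degree_le, intro allI impI)
    fix j assume "i < j"
    show "coeff ?Q j = 0"
    proof (cases "j = Suc i")
      case False
      then show ?thesis
        using \<open>i < j\<close> Suc.prems coeff_gegenbauer_top(2)[OF assms(1), of "Suc i"]
        by (simp add: coeff_eq_0)
    qed (use c in simp)
  qed
  note ex1 = Suc.IH[OF this]
  obtain m where m': "(\<forall>k>i. m k = 0) \<and> ?Q = (\<Sum>k=0..i. smult (m k) (?G k))"
    using ex1 by (rule ex1E)
  note m = conjunct1[OF m'] conjunct2[OF m']
  have uniq: "m' = m" if "\<forall>k>i. m' k = 0" "?Q = (\<Sum>k=0..i. smult (m' k) (?G k))" for m'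
    by (rule ex1E[OF ex1]) (use that m in metis)
  show ?case
  proof (rule ex1I[of _ "m(Suc i := ?b)"])
    have "(\<Sum>k=0..i. smult ((m(Suc i := ?b)) k) (?G k)) = ?Q"
      unfolding m(2) by (rule sum.cong) auto
    then show "(\<forall>k>Suc i. (m(Suc i := ?b)) k = 0) \<and>
        P = (\<Sum>k=0..Suc i. smult ((m(Suc i := ?b)) k) (?G k))"
      using m(1) by simp
  next
    fix m' assume m': "(\<forall>k>Suc i. m' k = 0) \<and> P = (\<Sum>k=0..Suc i. smult (m' k) (?G k))"
    have "coeff (\<Sum>k=0..i. smult (m' k) (?G k)) (Suc i) = 0"
      unfolding coeff_sum coeff_smult
    proof (intro sum.neutral ballI)
      fix k assume "k \<in> {0..i}"
      then have "degree (?G k) < Suc i"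
        using coeff_gegenbauer_top(2)[OF assms(1), of k] by simp
      then show "m' k * coeff (?G k) (Suc i) = 0"
        by (simp add: coeff_eq_0)
    qed
    then have "coeff P (Suc i) = m' (Suc i) * coeff (?G (Suc i)) (Suc i)"
      using m' by simp
    then have b: "m' (Suc i) = ?b" using c by simp
    have "P = (\<Sum>k=0..Suc i. smult (m' k) (?G k))"
      using m' by blast
    also have "\<dots> = (\<Sum>k=0..i. smult (m' k) (?G k)) + smult (m' (Suc i)) (?G (Suc i))"
      by simp
    also note b
    finally have "?Q = (\<Sum>k=0..i. smult (m' k) (?G k))"
      by (metis add_diff_cancel_right')
    also have "\<dots> = (\<Sum>k=0..i. smult ((m'(Suc i := 0)) k) (?G k))"
      by (rule sum.cong) auto
    finally have Q: "?Q = (\<Sum>k=0..i. smult ((m'(Suc i := 0)) k) (?G k))" .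
    have "\<forall>k>i. (m'(Suc i := 0)) k = 0"
      using conjunct1[OF m'] by (metis Suc_lessI fun_upd_apply)
    from uniq[OF this Q] have "m'(Suc i := 0) = m" .
    then show "m' = m(Suc i := ?b)"
      using b by (metis fun_upd_triv fun_upd_upd)
  qed
qed

lemma monomial_coeff:
  assumes "p \<ge> 2"
  shows "t ^ i = (\<Sum>k=0..i. monomial_coeff p k i * poly (gegenbauer ((real p - 2) / 2) k) t)"
proof -
  let ?G = "gegenbauer ((real p - 2) / 2)"
  have eq: "(\<forall>t. t ^ i = (\<Sum>k=0..i. m k * poly (?G k) t)) \<longleftrightarrow>
      monom 1 i = (\<Sum>k=0..i. smult (m k) (?G k))" for m :: "nat \<Rightarrow> real"
    by (auto simp: poly_eq_poly_eq_iff[symmetric] fun_eq_iff poly_sum poly_monom)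
  have "\<exists>!m. (\<forall>k>i. m k = 0) \<and> (\<forall>t. t ^ i = (\<Sum>k=0..i. m k * poly (?G k) t))"
    unfolding eq using assms by (intro gegenbauer_expansion) (auto simp: degree_monom_le)
  from theI'[OF this] show ?thesis
    unfolding monomial_coeff_def by blast
qed


section \<open>Constants\<close>

definition d_const :: "nat \<Rightarrow> nat \<Rightarrow> nat" where
  "d_const p k = ((p + k - 3) choose (p - 2)) + ((p + k - 2) choose (p - 2))"

definition t_const :: "nat \<Rightarrow> nat \<Rightarrow> real" where
  "t_const p k =
    (if p = 2 then sqrt 2 else (1 + 2 * real k / (real p - 2)) / sqrt (real (d_const p k)))"

definition xi :: "nat \<Rightarrow> (real \<Rightarrow> real) \<Rightarrow> nat \<Rightarrow> real \<Rightarrow> real" where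
  "xi p f k \<tau> =
    (monomial_coeff p k k)\<^sup>2 * ((deriv ^^ k) f 0)\<^sup>2 * \<tau> ^ (2 * k) / ((fact k)\<^sup>2 * (t_const p k)\<^sup>2)"


section \<open>Angular functions and rotationally symmetric laws on the sphere\<close>

definition angular_function :: "(real \<Rightarrow> real) \<Rightarrow> bool" where
  "angular_function f \<longleftrightarrow> f \<in> borel_measurable borel \<and> (\<forall>x. f x \<ge> 0) \<and> f 0 = 1"

text \<open>
  \<open>K\<close>-fold differentiability at a point: the derivatives of order less than \<open>K - 1\<close> are
  differentiable near \<open>a\<close>, that of order \<open>K - 1\<close> only has to be differentiable at \<open>a\<close>.
\<close>

definition times_differentiable_at :: "nat \<Rightarrow> (real \<Rightarrow> real) \<Rightarrow> real \<Rightarrow> bool" where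
  "times_differentiable_at K f a \<longleftrightarrow>
    (\<forall>j. Suc j < K \<longrightarrow> (\<forall>\<^sub>F x in nhds a. (deriv ^^ j) f differentiable (at x))) \<and>
    (\<forall>j<K. (deriv ^^ j) f differentiable (at a))"

text \<open>
  The vector \<open>(0, \<dots>, 0, 1)\<close>; a finite well-ordered index type is \<open>{1, \<dots>, p}\<close> up to naming.
\<close>

definition theta0 :: "real ^ 'p::{finite,wellorder}" where
  "theta0 = axis (Max UNIV) 1"

text \<open>
  Surface area measure of the unit sphere, as \<open>p\<close> times the Lebesgue measure of the
  cone over a set (see the lemma below).
\<close>

definition surface_measure :: "(real ^ 'p::{finite,wellorder}) measure" where
  "surface_measure = scale_measure (of_nat CARD('p))
     (distr (restrict_space lborel (ball 0 1 - {0})) (restrict_space borel (sphere 0 1))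
        (\<lambda>x. x /\<^sub>R norm x))"

lemma emeasure_surface_measure:
  fixes A :: "(real ^ 'p::{finite,wellorder}) set"
  assumes "A \<in> sets borel" "A \<subseteq> sphere 0 1"
  shows "emeasure surface_measure A =
    of_nat CARD('p) * emeasure lborel {r *\<^sub>R u | r u. 0 < r \<and> r < 1 \<and> u \<in> A}"
proof -
  let ?B = "ball 0 1 - {0 :: real ^ 'p::_}"
  have meas: "(\<lambda>x::real^'p::_. x /\<^sub>R norm x) \<in>
      restrict_space lborel ?B \<rightarrow>\<^sub>M restrict_space borel (sphere 0 1)"
    by (rule measurable_restrict_space2)
       (auto simp: space_restrict_space intro!: measurable_restrict_space1)
  have A: "A \<in> sets (restrict_space borel (sphere 0 1))"
    using assms by (auto simp: sets_restrict_space)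
  have cone: "(\<lambda>x. x /\<^sub>R norm x) -` A \<inter> ?B = {r *\<^sub>R u | r u. 0 < r \<and> r < 1 \<and> u \<in> A}"
  proof (intro equalityI subsetI)
    fix x :: "real ^ 'p::_" assume "x \<in> (\<lambda>x. x /\<^sub>R norm x) -` A \<inter> ?B"
    then have "x = norm x *\<^sub>R (x /\<^sub>R norm x)" "0 < norm x" "norm x < 1" "x /\<^sub>R norm x \<in> A"
      by auto
    then show "x \<in> {r *\<^sub>R u | r u. 0 < r \<and> r < 1 \<and> u \<in> A}" by blast
  next
    fix x :: "real ^ 'p::_" assume "x \<in> {r *\<^sub>R u | r u. 0 < r \<and> r < 1 \<and> u \<in> A}"
    then obtain r u where *: "x = r *\<^sub>R u" "0 < r" "r < 1" "u \<in> A" by blast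
    moreover have "norm u = 1" using * assms(2) by auto
    ultimately show "x \<in> (\<lambda>x. x /\<^sub>R norm x) -` A \<inter> ?B" by auto
  qed
  have "emeasure (restrict_space lborel ?B) ((\<lambda>x. x /\<^sub>R norm x) -` A \<inter> ?B)
      = emeasure lborel ((\<lambda>x. x /\<^sub>R norm x) -` A \<inter> ?B)"
    by (rule emeasure_restrict_space) auto
  with cone show ?thesis
    unfolding surface_measure_def emeasure_scale_measure emeasure_distr[OF meas A]
    by (simp add: space_restrict_space)
qed

text \<open>
  The law of one observation, with density proportional to \<open>u \<mapsto> f (\<kappa> * (u \<bullet> \<theta>\<^sub>0))\<close>, and that of
  \<open>(U\<^sub>1, \<dots>, U\<^sub>n)\<close>. Both are probability measures only if the normalising integral is positive and
  finite.
\<close>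

definition angular_law :: "real \<Rightarrow> (real \<Rightarrow> real) \<Rightarrow> (real ^ 'p::{finite,wellorder}) measure" where
  "angular_law \<kappa> f = density surface_measure
     (\<lambda>u. ennreal (f (\<kappa> * (u \<bullet> theta0)))
           / (\<integral>\<^sup>+ w. ennreal (f (\<kappa> * (w \<bullet> theta0))) \<partial>(surface_measure :: (real ^ 'p::_) measure)))"

definition sample_law ::
    "nat \<Rightarrow> real \<Rightarrow> (real \<Rightarrow> real) \<Rightarrow> (nat \<Rightarrow> real ^ 'p::{finite,wellorder}) measure" where
  "sample_law n \<kappa> f = (\<Pi>\<^sub>M i\<in>{1..n}. angular_law \<kappa> f)"


section \<open>Sobolev statistics\<close>

text \<open>The coefficient sequence is indexed by \<open>k \<ge> 1\<close>; the value at \<open>0\<close> is never used.\<close>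

definition coeff_support :: "(nat \<Rightarrow> real) \<Rightarrow> nat set" where
  "coeff_support v = {k. 1 \<le> k \<and> v k \<noteq> 0}"

definition h_fun :: "nat \<Rightarrow> nat \<Rightarrow> real \<Rightarrow> real" where
  "h_fun p k s =
    (if p = 2 then 2 * poly (gegenbauer 0 k) s
     else (1 + 2 * real k / (real p - 2)) * poly (gegenbauer ((real p - 2) / 2) k) s)"

definition sobolev_stat ::
    "(nat \<Rightarrow> real) \<Rightarrow> nat \<Rightarrow> (nat \<Rightarrow> real ^ 'p::{finite,wellorder}) \<Rightarrow> real" where
  "sobolev_stat v n U =
    1 / real n * (\<Sum>i=1..n. \<Sum>j=1..n. \<Sum>k. (v (Suc k))\<^sup>2 * h_fun CARD('p) (Suc k) (U i \<bullet> U j))"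


section \<open>Weighted sums of chi-square variables\<close>

text \<open>
  The law of \<open>\<parallel>Z\<parallel>\<^sup>2\<close> for \<open>Z \<sim> N(\<mu>, I\<^sub>d)\<close> depends on \<open>\<mu>\<close> only through \<open>\<xi> = \<parallel>\<mu>\<parallel>\<^sup>2\<close>; here
  \<open>\<mu> = (sqrt \<xi>, 0, \<dots>, 0)\<close>.
\<close>

definition chi_square :: "nat \<Rightarrow> real \<Rightarrow> real measure" where
  "chi_square d \<xi> = distr
     (\<Pi>\<^sub>M i\<in>{..<d}. density lborel (normal_density (if i = 0 then sqrt \<xi> else 0) 1))
     borel (\<lambda>z. \<Sum>i<d. (z i)\<^sup>2)"

definition weighted_chi_square ::
    "nat \<Rightarrow> (nat \<Rightarrow> real) \<Rightarrow> (nat \<Rightarrow> nat) \<Rightarrow> (nat \<Rightarrow> real) \<Rightarrow> real measure" where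
  "weighted_chi_square K w d \<xi> = distr
     (\<Pi>\<^sub>M k\<in>{1..K}. chi_square (d k) (\<xi> k)) borel (\<lambda>x. \<Sum>k=1..K. w k * x k)"

definition upper_quantile :: "real measure \<Rightarrow> real \<Rightarrow> real" where
  "upper_quantile M \<alpha> = Inf {x. 1 - \<alpha> \<le> cdf M x}"

end

theory Submission
  imports Defs
begin

text \<open>
  The kernel \<open>(x, y) \<mapsto> h\<^sub>k(x \<bullet> y)\<close> is the kernel of an orthogonal projection of rank \<open>d\<^sub>k\<close> in
  \<open>L\<^sup>2\<close> of the uniform law on the sphere, so \<open>h\<^sub>k(x \<bullet> y) = (\<Sum>r<d\<^sub>k. g\<^sub>k\<^sub>r x * g\<^sub>k\<^sub>r y)\<close> with orthonormal
  \<open>g\<^sub>k\<^sub>r\<close>, and the statistic is \<open>\<Sum>k r. v\<^sub>k\<^sup>2 * X\<^sub>k\<^sub>r\<^sup>2\<close> where \<open>X\<^sub>k\<^sub>r\<close> is \<open>n\<^sup>-\<^sup>1\<^sup>/\<^sup>2\<close> times the sum of the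
  \<open>g\<^sub>k\<^sub>r(U\<^sub>i)\<close>. Since \<open>g\<^sub>k\<^sub>r\<close> is orthogonal to the polynomials of degree less than \<open>k\<close>, a Taylor expansion of
  \<open>f\<close> at \<open>0\<close> shows that its mean under the alternative is \<open>\<kappa>\<^sub>n\<^sup>k\<close> times a constant proportional to
  \<open>f\<^sup>(\<^sup>k\<^sup>)(0) * g\<^sub>k\<^sub>r(\<theta>\<^sub>0)\<close>, up to \<open>o(\<kappa>\<^sub>n\<^sup>k)\<close>. The Laplace transform of the statistic is an average of
  characteristic functions of the linear forms in \<open>X\<close> over independent Gaussian coefficients, so the central
  limit theorem for one-dimensional triangular arrays gives its limit. Because the statistic is nonnegative,
  Laplace transforms at the natural numbers determine weak convergence. Under the faster rate a single linear form
  in \<open>X\<close> drifts to infinity with bounded variance, and Chebyshev's inequality applies.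

  The projection property only needs the invariance of the uniform law under reflections: convolution with a zonal
  polynomial is symmetric and does not raise degrees, hence it is diagonal in the orthogonal polynomials of
  the axial coordinate, which are the Gegenbauer polynomials.
\<close>

section \<open>Laplace transforms and weak convergence\<close>

text \<open>Laplace transforms need only scalar characteristic functions: for fixed Gaussian
  coefficients the whole vector of the X enters through one linear form, so joint convergence never
  has to be formulated. The weights \<open>v k\<close> multiply these coefficients, so a degree with
  \<open>v k = 0\<close> drops out even if its drift diverges, as can happen below the smallest
  active degree. At the rates of the two weak limits, an active degree above the smallest one has
  the bounded drift of the latter times a vanishing power of \<kappa>; hence a single non-central
  component. Its non-centrality is a sum of squared drifts over one basis, which the addition
  theorem evaluates: the squares of the g_r(\<theta>0) sum to h_k(1) = d_k. No integrability of f
  away from 0 is assumed, so an observation has a genuine law only for large n, and many statements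
  concern eventually all n. The derivative of top order may exist only at 0, which forces the Peano
  form of the Taylor remainder. Under the faster rate the drifting linear form has the coefficients
  g_r(\<theta>0): it is the normalised sum of the h_k at the inner products of \<theta>0 and U_i,
  and the mean of a summand is of exact order \<kappa>^k.\<close>

lemma weak_conv_m_Laplace:
  fixes \<mu> :: "nat \<Rightarrow> real measure" and M :: "real measure"
  assumes \<mu>: "\<And>n. real_distribution (\<mu> n)" "\<And>n. AE x in \<mu> n. 0 \<le> x"
    and M: "real_distribution M" "AE x in M. 0 \<le> x"
    and L: "\<And>m::nat. (\<lambda>n. \<integral>x. exp (- (real m * x)) \<partial>\<mu> n) \<longlonglongrightarrow> (\<integral>x. exp (- (real m * x)) \<partial>M)"
  shows "weak_conv_m \<mu> M"
proof (rule integral_cts_step_conv_imp_weak_conv[OF \<mu>(1) M(1)])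
  fix a b :: real assume "a < b"
  \<comment> \<open>The substitution \<open>y = exp (- x)\<close> maps the half line
    \<open>x \<ge> 0\<close> into \<open>{0..1}\<close>, and polynomials in \<open>y\<close>
    integrate to Laplace transforms at natural numbers. The truncation at \<open>exp (- b)\<close>
    keeps \<open>ln\<close> away from 0 without changing values, since \<open>cts_step a b\<close>
    vanishes from \<open>b\<close> on.\<close>
  define \<phi> where "\<phi> y = cts_step a b (- ln (max y (exp (- b))))" for y
  have "continuous_on UNIV (cts_step a b)"
    using cts_step_uniformly_continuous[OF \<open>a < b\<close>] by (rule uniformly_continuous_imp_continuous)
  moreover have "continuous_on {0..1} (\<lambda>y. - ln (max y (exp (- b))))"
    by (intro continuous_intros ballI) (auto simp: max_def)
  ultimately have cont: "continuous_on {0..1} \<phi>"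
    unfolding \<phi>_def by (rule continuous_on_compose2) auto
  have \<phi>_exp: "\<phi> (exp (- x)) = cts_step a b x" for x
    using \<open>a < b\<close> by (auto simp: \<phi>_def max_def cts_step_def)
  show "(\<lambda>n. integral\<^sup>L (\<mu> n) (cts_step a b)) \<longlonglongrightarrow> integral\<^sup>L M (cts_step a b)"
  proof (rule LIMSEQ_I)
    fix e :: real assume "0 < e"
    then have "0 < e / 3" by simp
    from Stone_Weierstrass_real_polynomial_function[OF compact_Icc cont this]
    obtain g where g: "real_polynomial_function g" "\<And>y. y \<in> {0..1} \<Longrightarrow> \<bar>\<phi> y - g y\<bar> < e / 3"
      by blast
    from g(1) obtain c N where c: "g = (\<lambda>y. \<Sum>i\<le>N. c i * y ^ i)"
      unfolding real_polynomial_function_iff_sum by blast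
    have approx: "\<bar>integral\<^sup>L D (cts_step a b) - (\<Sum>i\<le>N. c i * (\<integral>x. exp (- (real i * x)) \<partial>D))\<bar> \<le> e / 3"
      if "real_distribution D" and nonneg: "AE x in D. 0 \<le> x" for D
    proof -
      interpret real_distribution D by fact
      have int: "integrable D (\<lambda>x. exp (- (real i * x)))" for i
        by (rule integrable_const_bound[where B = 1]) (use nonneg in \<open>auto\<close>)
      have "integral\<^sup>L D (cts_step a b) - (\<Sum>i\<le>N. c i * (\<integral>x. exp (- (real i * x)) \<partial>D))
          = (\<integral>x. cts_step a b x - (\<Sum>i\<le>N. c i * exp (- (real i * x))) \<partial>D)"
        using int integrable_cts_step[OF \<open>a < b\<close>] by (simp add: Bochner_Integration.integral_sum)
      also have "\<bar>\<dots>\<bar> \<le> (\<integral>x. e / 3 \<partial>D)"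
      proof (rule order_trans[OF integral_abs_bound], rule integral_mono_AE)
        \<comment> \<open>The polynomial approximates only for \<open>y\<close> in
          \<open>{0..1}\<close>, that is for \<open>x \<ge> 0\<close>; here the support of the laws
          on the half line enters.\<close>
        show "integrable D (\<lambda>x. \<bar>cts_step a b x - (\<Sum>i\<le>N. c i * exp (- (real i * x)))\<bar>)"
          using int integrable_cts_step[OF \<open>a < b\<close>] by auto
        show "AE x in D. \<bar>cts_step a b x - (\<Sum>i\<le>N. c i * exp (- (real i * x)))\<bar> \<le> e / 3"
          using nonneg
        proof eventually_elim
          case (elim x)
          then show ?case
            using g(2)[of "exp (- x)"] by (simp add: \<phi>_exp c exp_of_nat_mult[symmetric])
        qed
      qed simp
      finally show ?thesis by (simp add: prob_space del: space_eq_univ)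
    qed
    have "(\<lambda>n. \<Sum>i\<le>N. c i * (\<integral>x. exp (- (real i * x)) \<partial>\<mu> n))
        \<longlonglongrightarrow> (\<Sum>i\<le>N. c i * (\<integral>x. exp (- (real i * x)) \<partial>M))"
      by (intro tendsto_intros L)
    from LIMSEQ_D[OF this \<open>0 < e / 3\<close>]
    obtain n0 where n0: "\<And>n. n \<ge> n0 \<Longrightarrow> \<bar>(\<Sum>i\<le>N. c i * (\<integral>x. exp (- (real i * x)) \<partial>\<mu> n))
        - (\<Sum>i\<le>N. c i * (\<integral>x. exp (- (real i * x)) \<partial>M))\<bar> < e / 3"
      by auto
    show "\<exists>no. \<forall>n\<ge>no. norm (integral\<^sup>L (\<mu> n) (cts_step a b) - integral\<^sup>L M (cts_step a b)) < e"
    proof (intro exI allI impI)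
      fix n assume "n \<ge> n0"
      from n0[OF this] approx[OF \<mu>(1)[of n] \<mu>(2)[of n]] approx[OF M]
      show "norm (integral\<^sup>L (\<mu> n) (cts_step a b) - integral\<^sup>L M (cts_step a b)) < e"
        by (simp only: real_norm_def)
    qed
  qed
qed

text \<open>For bounded summands a second-order expansion of one factor has error of order n to the
  power -3/2. The factor is then compared with \<open>exp (z / n)\<close> by the inequality |a^n -
  b^n| \<le> n |a - b| in the closed unit disc, so no complex logarithm occurs. Uncentred second
  moments suffice, because the means are of order 1 / sqrt n.\<close>

lemma char_power_tendsto:
  fixes P :: "nat \<Rightarrow> 'a measure" and Y :: "'a \<Rightarrow> real"
  assumes P: "\<forall>\<^sub>F n in sequentially. prob_space (P n) \<and> Y \<in> borel_measurable (P n)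
      \<and> (\<forall>x\<in>space (P n). \<bar>Y x\<bar> \<le> B)"
    and mean: "(\<lambda>n. sqrt (real n) * (\<integral>x. Y x \<partial>P n)) \<longlonglongrightarrow> m"
    and var: "(\<lambda>n. \<integral>x. (Y x)\<^sup>2 \<partial>P n) \<longlonglongrightarrow> s"
  shows "(\<lambda>n. (\<integral>x. iexp (Y x / sqrt (real n)) \<partial>P n) ^ n) \<longlonglongrightarrow> exp (\<i> * of_real m - of_real s / 2)"
proof -
  define \<phi> where "\<phi> n = (\<integral>x. iexp (Y x / sqrt (real n)) \<partial>P n)" for n
  define z where "z = \<i> * of_real m - (of_real s / 2 :: complex)"
  define q where "q n = 1 + (\<i> * of_real (sqrt (real n) * (\<integral>x. Y x \<partial>P n)) - of_real (\<integral>x. (Y x)\<^sup>2 \<partial>P n) / 2) / of_nat n"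
    for n :: nat
  \<comment> \<open>Needed to keep \<open>exp (z / n)\<close> inside the closed unit disc.\<close>
  have "0 \<le> s"
    by (rule tendsto_lowerbound[OF var]) auto
  have Taylor: "\<forall>\<^sub>F n in sequentially. norm (\<phi> n - q n) \<le> B ^ 3 / 6 / (real n * sqrt (real n)) \<and> norm (\<phi> n) \<le> 1"
    using P eventually_gt_at_top[of 0]
  proof eventually_elim
    case (elim n)
    then interpret prob_space "P n" by simp
    have [measurable]: "Y \<in> borel_measurable (P n)" and B: "\<And>x. x \<in> space (P n) \<Longrightarrow> \<bar>Y x\<bar> \<le> B"
      using elim by auto
    have n: "0 < sqrt (real n)" "(sqrt (real n))\<^sup>2 = real n"
      using elim by auto
    have int: "integrable (P n) (\<lambda>x. Y x)"
      using B by (intro integrable_const_bound[where B = B]) auto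
    have "integrable (P n) (\<lambda>x. (Y x)\<^sup>2)"
      using B by (intro integrable_const_bound[where B = "B\<^sup>2"])
        (auto simp: abs_le_square_iff[symmetric] order_trans[OF _ abs_ge_self])
    note int = int this
    have int': "integrable (P n) (\<lambda>x. complex_of_real (Y x))" "integrable (P n) (\<lambda>x. complex_of_real ((Y x)\<^sup>2))"
      using int by (auto simp del: of_real_power)
    have inte: "integrable (P n) (\<lambda>x. iexp (Y x / sqrt (real n)))"
      by (rule integrable_const_bound[where B = 1]) auto
    let ?t = "\<lambda>x. 1 + \<i> * of_real (Y x) / of_real (sqrt (real n)) - of_real ((Y x)\<^sup>2) / (2 * of_nat n)"
    have "(\<integral>x. ?t x \<partial>P n) = 1 + \<i> * of_real (\<integral>x. Y x \<partial>P n) / of_real (sqrt (real n))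
        - of_real (\<integral>x. (Y x)\<^sup>2 \<partial>P n) / (2 * of_nat n)"
      using int' by (simp add: prob_space del: of_real_power)
    also have "\<dots> = q n"
    proof -
      have "\<i> * of_real (sqrt (real n) * (\<integral>x. Y x \<partial>P n)) / of_nat n
          = \<i> * of_real ((sqrt (real n) * (\<integral>x. Y x \<partial>P n)) / real n)"
        by simp
      also have "(sqrt (real n) * (\<integral>x. Y x \<partial>P n)) / real n = (\<integral>x. Y x \<partial>P n) / sqrt (real n)"
        using n by (simp add: field_simps power2_eq_square)
      finally show ?thesis
        unfolding q_def by (simp add: diff_divide_distrib)
    qed
    finally have q: "(\<integral>x. ?t x \<partial>P n) = q n" .
    have int_t: "integrable (P n) ?t"
      using int' by (auto simp del: of_real_power)
    have pointwise: "norm (iexp (Y x / sqrt (real n)) - ?t x) \<le> B ^ 3 / 6 / (real n * sqrt (real n))"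
      if "x \<in> space (P n)" for x
    proof -
      let ?y = "Y x / sqrt (real n)"
      have "(\<i> * complex_of_real ?y)\<^sup>2 = of_real (- ((Y x)\<^sup>2 / real n))"
        using n by (simp add: power_mult_distrib power_divide del: of_real_power flip: of_real_power)
      then have "(\<Sum>k\<le>2. (\<i> * ?y)^k / fact k) = ?t x"
        by (simp add: numeral_2_eq_2)
      then have "norm (iexp ?y - ?t x) \<le> \<bar>?y\<bar> ^ 3 / 6"
        using iexp_approx1[of ?y 2] by (simp add: numeral_eq_Suc)
      also have "\<bar>?y\<bar> ^ 3 = \<bar>Y x\<bar> ^ 3 / (real n * sqrt (real n))"
        using n by (simp add: power_divide power3_eq_cube)
      also have "\<dots> \<le> B ^ 3 / (real n * sqrt (real n))"
        using B[OF that] n by (intro divide_right_mono power_mono) auto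
      finally show ?thesis by (simp add: field_simps)
    qed
    have "norm (\<phi> n - q n) = norm (\<integral>x. iexp (Y x / sqrt (real n)) - ?t x \<partial>P n)"
      unfolding \<phi>_def q[symmetric] using inte int_t by simp
    also have "\<dots> \<le> (\<integral>x. norm (iexp (Y x / sqrt (real n)) - ?t x) \<partial>P n)"
      by (rule integral_norm_bound)
    also have "\<dots> \<le> (\<integral>x. B ^ 3 / 6 / (real n * sqrt (real n)) \<partial>P n)"
      using inte int_t pointwise by (intro integral_mono) auto
    finally have 1: "norm (\<phi> n - q n) \<le> B ^ 3 / 6 / (real n * sqrt (real n))"
      by (simp add: prob_space)
    have "norm (\<phi> n) \<le> (\<integral>x. norm (iexp (Y x / sqrt (real n))) \<partial>P n)"
      unfolding \<phi>_def by (rule integral_norm_bound)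
    with 1 show ?case by (simp add: prob_space)
  qed
  have lim1: "(\<lambda>n. of_nat n * (exp (z / of_nat n) - 1)) \<longlonglongrightarrow> z"
  proof -
    have "((\<lambda>h. (exp (z * h) - 1) / h) \<longlongrightarrow> z) (at 0)"
    proof -
      have "((\<lambda>h. exp (z * h)) has_field_derivative z) (at 0)"
        by (auto intro!: derivative_eq_intros)
      then show ?thesis by (simp add: has_field_derivative_iff)
    qed
    moreover have "filterlim (\<lambda>n. 1 / of_nat n :: complex) (at 0) sequentially"
      by (rule filterlim_atI) (auto intro!: lim_1_over_n eventually_mono[OF eventually_gt_at_top[of 0]])
    ultimately have "(\<lambda>n. (exp (z * (1 / of_nat n)) - 1) / (1 / of_nat n)) \<longlonglongrightarrow> z"
      by (rule filterlim_compose)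
    then show ?thesis by (simp add: mult.commute)
  qed
  have lim2: "(\<lambda>n. of_nat n * (q n - 1)) \<longlonglongrightarrow> z"
  proof -
    have "(\<lambda>n. \<i> * of_real (sqrt (real n) * (\<integral>x. Y x \<partial>P n)) - of_real (\<integral>x. (Y x)\<^sup>2 \<partial>P n) / 2) \<longlonglongrightarrow> z"
      unfolding z_def by (intro tendsto_intros mean var) auto
    then show ?thesis
      by (rule Lim_transform_eventually)
        (use eventually_gt_at_top[of 0] in \<open>eventually_elim, simp add: q_def\<close>)
  qed
  \<comment> \<open>Both \<open>q n\<close> and \<open>exp (z / n)\<close> equal 1 + z / n up to o(1
    / n), by \<open>lim2\<close> and \<open>lim1\<close>.\<close>
  have "(\<lambda>n. real n * norm (\<phi> n - exp (z / of_nat n))) \<longlonglongrightarrow> 0"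
  proof (rule Lim_null_comparison)
    have "(\<lambda>n. B ^ 3 / 6 * inverse (sqrt (real n))
        + norm (of_nat n * (q n - 1) - of_nat n * (exp (z / of_nat n) - 1))) \<longlonglongrightarrow> B ^ 3 / 6 * 0 + norm (z - z)"
      by (intro tendsto_intros lim1 lim2 tendsto_inverse_0_at_top
          filterlim_compose[OF sqrt_at_top filterlim_real_sequentially])
    then show "(\<lambda>n. B ^ 3 / 6 * inverse (sqrt (real n))
        + norm (of_nat n * (q n - 1) - of_nat n * (exp (z / of_nat n) - 1))) \<longlonglongrightarrow> 0"
      by simp
    show "\<forall>\<^sub>F n in sequentially. norm (real n * norm (\<phi> n - exp (z / of_nat n)))
        \<le> B ^ 3 / 6 * inverse (sqrt (real n)) + norm (of_nat n * (q n - 1) - of_nat n * (exp (z / of_nat n) - 1))"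
      using Taylor eventually_gt_at_top[of 0]
    proof eventually_elim
      case (elim n)
      have "norm (\<phi> n - exp (z / of_nat n)) \<le> norm (\<phi> n - q n) + norm (q n - exp (z / of_nat n))"
        by (metis norm_triangle_ineq diff_add_cancel add_diff_eq)
      then have "real n * norm (\<phi> n - exp (z / of_nat n))
          \<le> real n * norm (\<phi> n - q n) + real n * norm (q n - exp (z / of_nat n))"
        using elim(2) by (simp flip: distrib_left)
      moreover have "real n * norm (\<phi> n - q n) \<le> real n * (B ^ 3 / 6 / (real n * sqrt (real n)))"
        using elim by (intro mult_left_mono) auto
      moreover have "real n * (B ^ 3 / 6 / (real n * sqrt (real n))) = B ^ 3 / 6 * inverse (sqrt (real n))"
        using elim by (simp add: field_simps)
      moreover have "real n * norm (q n - exp (z / of_nat n))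
          = norm (of_nat n * (q n - 1) - of_nat n * (exp (z / of_nat n) - 1))"
      proof -
        have "of_nat n * (q n - 1) - of_nat n * (exp (z / of_nat n) - 1) = of_nat n * (q n - exp (z / of_nat n))"
          by (simp add: algebra_simps)
        then show ?thesis by (simp add: norm_mult)
      qed
      ultimately show ?case by simp
    qed
  qed
  then have "(\<lambda>n. \<phi> n ^ n - exp (z / of_nat n) ^ n) \<longlonglongrightarrow> 0"
  proof (rule Lim_null_comparison[rotated])
    show "\<forall>\<^sub>F n in sequentially. norm (\<phi> n ^ n - exp (z / of_nat n) ^ n) \<le> real n * norm (\<phi> n - exp (z / of_nat n))"
      using Taylor
    proof eventually_elim
      case (elim n)
      have "norm (exp (z / of_nat n)) \<le> 1"
        using \<open>0 \<le> s\<close> by (simp add: z_def divide_nonneg_nonneg)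
      with elim show ?case by (intro norm_power_diff) auto
    qed
  qed
  moreover have "\<forall>\<^sub>F n in sequentially. \<phi> n ^ n - exp (z / of_nat n) ^ n = \<phi> n ^ n - exp z"
    using eventually_gt_at_top[of 0] by eventually_elim (simp flip: exp_of_nat_mult)
  ultimately have "(\<lambda>n. \<phi> n ^ n - exp z) \<longlonglongrightarrow> 0"
    by (rule Lim_transform_eventually)
  then show ?thesis
    unfolding \<phi>_def z_def by (rule LIM_zero_cancel)
qed

section \<open>Quadratic statistics of triangular arrays\<close>

text \<open>Scaling \<open>z\<close> by 1 / sqrt (1 + \<beta>) absorbs the damping factor into the
  Gaussian density and leaves the standard normal characteristic function at the scaled
  argument.\<close>

lemma integral_iexp_exp_square:
  fixes \<alpha> \<beta> :: real
  assumes "0 \<le> \<beta>"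
  shows "(\<integral>z. iexp (\<alpha> * z) * of_real (exp (- (\<beta> * z\<^sup>2) / 2)) \<partial>std_normal_distribution)
    = of_real (exp (- (\<alpha>\<^sup>2 / (2 * (1 + \<beta>)))) / sqrt (1 + \<beta>))"
proof -
  let ?s = "1 / sqrt (1 + \<beta>)"
  have s: "?s \<noteq> 0" "?s\<^sup>2 = 1 / (1 + \<beta>)" "0 < 1 + \<beta>" "\<bar>?s\<bar> = ?s"
    using assms by (auto simp: power_divide add_nonneg_eq_0_iff)
  have dens: "std_normal_density (?s * x) * exp (- (\<beta> * (?s * x)\<^sup>2) / 2) = std_normal_density x" for x
  proof -
    have "- (t * x)\<^sup>2 / 2 + - (\<beta> * (t * x)\<^sup>2) / 2 = - (1 + \<beta>) * t\<^sup>2 * x\<^sup>2 / 2" for t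
      by (simp add: power_mult_distrib field_simps)
    from this[of ?s]
    have "- (?s * x)\<^sup>2 / 2 + - (\<beta> * (?s * x)\<^sup>2) / 2 = - (1 + \<beta>) * ?s\<^sup>2 * x\<^sup>2 / 2" .
    also have "\<dots> = - x\<^sup>2 / 2"
      unfolding s(2) using s(3) by (simp add: field_simps)
    finally show ?thesis
      by (simp add: std_normal_density_def mult.assoc flip: exp_add)
  qed
  have "(\<integral>z. iexp (\<alpha> * z) * of_real (exp (- (\<beta> * z\<^sup>2) / 2)) \<partial>std_normal_distribution)
      = (\<integral>z. std_normal_density z *\<^sub>R (iexp (\<alpha> * z) * of_real (exp (- (\<beta> * z\<^sup>2) / 2))) \<partial>lborel)"
    by (subst integral_density) auto
  also have "\<dots> = ?s *\<^sub>R (\<integral>x. std_normal_density (?s * x) *\<^sub>R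
      (iexp (\<alpha> * (?s * x)) * of_real (exp (- (\<beta> * (?s * x)\<^sup>2) / 2))) \<partial>lborel)"
    by (subst lborel_integral_real_affine[OF s(1), of _ 0], unfold s(4)) (simp only: add_0)
  also have "(\<lambda>x. std_normal_density (?s * x) *\<^sub>R
      (iexp (\<alpha> * (?s * x)) * of_real (exp (- (\<beta> * (?s * x)\<^sup>2) / 2))))
      = (\<lambda>x. std_normal_density x *\<^sub>R iexp (\<alpha> * ?s * x))"
  proof
    fix x
    have "std_normal_density (?s * x) *\<^sub>R (iexp (\<alpha> * (?s * x)) * of_real (exp (- (\<beta> * (?s * x)\<^sup>2) / 2)))
        = (std_normal_density (?s * x) * exp (- (\<beta> * (?s * x)\<^sup>2) / 2)) *\<^sub>R iexp (\<alpha> * (?s * x))"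
      by (simp only: scaleR_conv_of_real of_real_mult mult_ac)
    then show "std_normal_density (?s * x) *\<^sub>R (iexp (\<alpha> * (?s * x)) * of_real (exp (- (\<beta> * (?s * x)\<^sup>2) / 2)))
        = std_normal_density x *\<^sub>R iexp (\<alpha> * ?s * x)"
      unfolding dens by (simp only: mult.assoc)
  qed
  also have "(\<integral>x. std_normal_density x *\<^sub>R iexp (\<alpha> * ?s * x) \<partial>lborel) = char std_normal_distribution (\<alpha> * ?s)"
    unfolding char_def by (subst integral_density) auto
  also have "\<dots> = of_real (exp (- (\<alpha>\<^sup>2 / (2 * (1 + \<beta>)))))"
  proof -
    have "(\<alpha> * ?s)\<^sup>2 / 2 = \<alpha>\<^sup>2 / (2 * (1 + \<beta>))"
      unfolding power_mult_distrib s(2) by simp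
    then show ?thesis unfolding char_std_normal_distribution by (simp only: minus_divide_left[symmetric])
  qed
  finally show ?thesis by (simp add: scaleR_conv_of_real)
qed

text \<open>Completing the square: density times exponential is a multiple of the normal density
  with mean \<mu> / (1 + 2 l) and variance 1 / (1 + 2 l).\<close>

lemma integral_exp_square_normal:
  fixes \<mu> l :: real
  assumes "0 \<le> l"
  shows "(\<integral>z. exp (- (l * z\<^sup>2)) \<partial>density lborel (normal_density \<mu> 1))
    = exp (- (l * \<mu>\<^sup>2 / (1 + 2 * l))) / sqrt (1 + 2 * l)"
proof -
  let ?s = "1 / sqrt (1 + 2 * l)" and ?m = "\<mu> / (1 + 2 * l)"
  have s: "?s > 0" "?s\<^sup>2 = 1 / (1 + 2 * l)" "0 < 1 + 2 * l"
    using assms by (auto simp: power_divide)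
  have dens: "normal_density \<mu> 1 z * exp (- (l * z\<^sup>2))
      = exp (- (l * \<mu>\<^sup>2 / (1 + 2 * l))) / sqrt (1 + 2 * l) * normal_density ?m ?s z" for z
  proof -
    define q where "q = 1 + 2 * l"
    have q: "q > 0" "?m = \<mu> / q" "l = (q - 1) / 2" "1 + 2 * l = q"
      using s by (auto simp: q_def)
    have "- (z - \<mu>)\<^sup>2 / 2 + - (l * z\<^sup>2) = - (l * \<mu>\<^sup>2 / (1 + 2 * l)) + - (z - ?m)\<^sup>2 / (2 * ?s\<^sup>2)"
      unfolding s(2) unfolding q(4) unfolding q(3) using q(1) by (simp add: field_simps power2_eq_square)
    then have "exp (- (z - \<mu>)\<^sup>2 / 2) * exp (- (l * z\<^sup>2))
        = exp (- (l * \<mu>\<^sup>2 / (1 + 2 * l))) * exp (- (z - ?m)\<^sup>2 / (2 * ?s\<^sup>2))"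
      by (simp only: exp_add[symmetric])
    moreover have "1 / sqrt (2 * pi * ?s\<^sup>2) / sqrt (1 + 2 * l) = 1 / sqrt (2 * pi)"
      using s by (simp add: real_sqrt_divide real_sqrt_mult)
    ultimately show ?thesis
      unfolding normal_density_def by (simp add: mult_ac field_simps)
  qed
  have "(\<integral>z. exp (- (l * z\<^sup>2)) \<partial>density lborel (normal_density \<mu> 1))
      = (\<integral>z. normal_density \<mu> 1 z * exp (- (l * z\<^sup>2)) \<partial>lborel)"
    by (subst integral_density) auto
  also have "\<dots> = exp (- (l * \<mu>\<^sup>2 / (1 + 2 * l))) / sqrt (1 + 2 * l) * (\<integral>z. normal_density ?m ?s z \<partial>lborel)"
    unfolding dens by simp
  also have "(\<integral>z. normal_density ?m ?s z \<partial>lborel) = 1"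
    using s(1) by (rule integral_normal_density)
  finally show ?thesis by simp
qed

lemma integral_PiM_iexp_sum:
  fixes f :: "'a \<Rightarrow> 'b \<Rightarrow> real"
  assumes "finite A" and M: "\<And>a. prob_space (M a)" and [measurable]: "\<And>a. a \<in> A \<Longrightarrow> f a \<in> borel_measurable (M a)"
  shows "(\<integral>x. iexp (\<Sum>a\<in>A. f a (x a)) \<partial>Pi\<^sub>M A M) = (\<Prod>a\<in>A. \<integral>y. iexp (f a y) \<partial>M a)"
proof -
  have int: "integrable (M a) (\<lambda>y. iexp (f a y))" if [simp]: "a \<in> A" for a
  proof -
    interpret prob_space "M a" by (rule M)
    show ?thesis
      by (rule integrable_const_bound[where B = 1]) auto
  qed
  interpret product_prob_space M by (simp add: product_prob_space_def product_sigma_finite_def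
        product_prob_space_axioms_def M prob_space_imp_sigma_finite)
  have "(\<integral>x. iexp (\<Sum>a\<in>A. f a (x a)) \<partial>Pi\<^sub>M A M) = (\<integral>x. (\<Prod>a\<in>A. iexp (f a (x a))) \<partial>Pi\<^sub>M A M)"
    by (simp add: sum_distrib_left exp_sum assms(1))
  also have "\<dots> = (\<Prod>a\<in>A. \<integral>y. iexp (f a y) \<partial>M a)"
    by (rule product_integral_prod[OF assms(1) int])
  finally show ?thesis .
qed

text \<open>Gaussian linearisation of a sum of squares; it turns Laplace transforms of quadratic statistics into
  characteristic functions of linear ones.\<close>

lemma exp_sum_squares_Gaussian:
  fixes x :: "'a \<Rightarrow> real"
  assumes "finite A"
  shows "of_real (exp (- (\<Sum>a\<in>A. (x a)\<^sup>2) / 2))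
    = (\<integral>G. iexp (\<Sum>a\<in>A. x a * G a) \<partial>Pi\<^sub>M A (\<lambda>_. std_normal_distribution))"
proof -
  have "(\<integral>G. iexp (\<Sum>a\<in>A. x a * G a) \<partial>Pi\<^sub>M A (\<lambda>_. std_normal_distribution))
      = (\<Prod>a\<in>A. char std_normal_distribution (x a))"
    unfolding char_def using assms
    by (intro integral_PiM_iexp_sum) (auto intro!: prob_space_normal_density)
  also have "\<dots> = of_real (exp (\<Sum>a\<in>A. - (x a)\<^sup>2 / 2))"
    by (simp add: char_std_normal_distribution exp_sum assms)
  finally show ?thesis by (simp add: sum_negf sum_divide_distrib)
qed

text \<open>By Fubini the Gaussian coefficients \<open>G\<close> can be fixed before the sample is
  integrated out. The inner integral is then the n-th power of the characteristic function of one
  scalar summand, \<open>char_power_tendsto\<close> gives its limit, and dominated convergence with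
  bound 1 restores the average over \<open>G\<close>. The factor \<open>c a\<close> in the
  hypothesis on means lets a component of weight zero have a divergent drift.\<close>

lemma Laplace_quadratic_tendsto:
  fixes P :: "nat \<Rightarrow> 'a measure" and g :: "'b \<Rightarrow> 'a \<Rightarrow> real" and c \<mu> :: "'b \<Rightarrow> real"
  assumes A: "finite A"
    and P: "\<forall>\<^sub>F n in sequentially. prob_space (P n) \<and>
      (\<forall>a\<in>A. g a \<in> borel_measurable (P n) \<and> (\<forall>x\<in>space (P n). \<bar>g a x\<bar> \<le> B))"
    and mean: "\<And>a. a \<in> A \<Longrightarrow> (\<lambda>n. c a * (sqrt (real n) * (\<integral>x. g a x \<partial>P n))) \<longlonglongrightarrow> c a * \<mu> a"
    and cov: "\<And>a b. a \<in> A \<Longrightarrow> b \<in> A \<Longrightarrow>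
      (\<lambda>n. \<integral>x. g a x * g b x \<partial>P n) \<longlonglongrightarrow> (if a = b then 1 else 0)"
  shows "(\<lambda>n. \<integral>U. exp (- (\<Sum>a\<in>A. (c a * (\<Sum>i=1..n. g a (U i)) / sqrt (real n))\<^sup>2) / 2) \<partial>Pi\<^sub>M {1..n} (\<lambda>_. P n))
    \<longlonglongrightarrow> (\<Prod>a\<in>A. exp (- ((c a * \<mu> a)\<^sup>2 / (2 * (1 + (c a)\<^sup>2)))) / sqrt (1 + (c a)\<^sup>2))"
proof -
  let ?\<Gamma> = "Pi\<^sub>M A (\<lambda>_. std_normal_distribution)"
  let ?Q = "\<lambda>n. Pi\<^sub>M {1..n} (\<lambda>_. P n)"
  let ?F = "\<lambda>n U. exp (- (\<Sum>a\<in>A. (c a * (\<Sum>i=1..n. g a (U i)) / sqrt (real n))\<^sup>2) / 2)"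
  let ?Y = "\<lambda>G x. \<Sum>a\<in>A. c a * G a * g a x"
  interpret \<Gamma>: prob_space ?\<Gamma>
    by (intro prob_space_PiM prob_space_normal_density) simp
  from P obtain N where N: "\<And>n. n \<ge> N \<Longrightarrow> prob_space (P n) \<and>
      (\<forall>a\<in>A. g a \<in> borel_measurable (P n) \<and> (\<forall>x\<in>space (P n). \<bar>g a x\<bar> \<le> B))"
    unfolding eventually_sequentially by blast
  define H where "H n G = (\<integral>U. iexp (\<Sum>a\<in>A. (c a * (\<Sum>i=1..n. g a (U i)) / sqrt (real n)) * G a) \<partial>?Q n)"
    for n and G :: "'b \<Rightarrow> real"
  have H: "of_real (integral\<^sup>L (?Q n) (?F n)) = (\<integral>G. H n G \<partial>?\<Gamma>)
      \<and> H n \<in> borel_measurable ?\<Gamma> \<and> (\<forall>G. norm (H n G) \<le> 1)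
      \<and> (\<forall>G. H n G = (\<integral>x. iexp (?Y G x / sqrt (real n)) \<partial>P n) ^ n)"
    if n: "n \<ge> N" for n
  proof -
    interpret P: prob_space "P n" using N[OF n] by blast
    have [measurable]: "a \<in> A \<Longrightarrow> g a \<in> borel_measurable (P n)" for a
      using N[OF n] by blast
    interpret Q: prob_space "?Q n"
      by (intro prob_space_PiM P.prob_space_axioms)
    interpret PQ: pair_prob_space "?Q n" ?\<Gamma> ..
    let ?h = "\<lambda>U G. iexp (\<Sum>a\<in>A. (c a * (\<Sum>i=1..n. g a (U i)) / sqrt (real n)) * G a)"
    have meas[measurable]: "(\<lambda>(U, G). ?h U G) \<in> borel_measurable (?Q n \<Otimes>\<^sub>M ?\<Gamma>)"
      by measurable
    have meas'[measurable]: "(\<lambda>(G, U). ?h U G) \<in> borel_measurable (?\<Gamma> \<Otimes>\<^sub>M ?Q n)"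
      by measurable
    have int: "integrable (?Q n \<Otimes>\<^sub>M ?\<Gamma>) (\<lambda>(U, G). ?h U G)"
      by (rule PQ.P.integrable_const_bound[where B = 1]) (use meas in auto)
    have "complex_of_real (integral\<^sup>L (?Q n) (?F n)) = (\<integral>U. complex_of_real (?F n U) \<partial>?Q n)"
      by simp
    also have "\<dots> = (\<integral>U. (\<integral>G. ?h U G \<partial>?\<Gamma>) \<partial>?Q n)"
      by (subst exp_sum_squares_Gaussian[OF A]) simp
    also have "\<dots> = (\<integral>G. H n G \<partial>?\<Gamma>)"
      unfolding H_def using PQ.Fubini_integral[OF int] by simp
    finally have 1: "of_real (integral\<^sup>L (?Q n) (?F n)) = (\<integral>G. H n G \<partial>?\<Gamma>)" .
    have 2: "H n \<in> borel_measurable ?\<Gamma>"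
      unfolding H_def by (rule Q.borel_measurable_lebesgue_integral) (rule meas')
    have 3: "norm (H n G) \<le> 1" for G
    proof -
      have "norm (H n G) \<le> (\<integral>U. norm (?h U G) \<partial>?Q n)"
        unfolding H_def by (rule integral_norm_bound)
      then show ?thesis using Q.prob_space by simp
    qed
    have 4: "H n G = (\<integral>x. iexp (?Y G x / sqrt (real n)) \<partial>P n) ^ n" for G
    proof -
      have "(\<Sum>a\<in>A. (c a * (\<Sum>i=1..n. g a (U i)) / sqrt (real n)) * G a)
          = (\<Sum>i\<in>{1..n}. ?Y G (U i) / sqrt (real n))" for U
        unfolding sum_divide_distrib sum_distrib_left sum_distrib_right
        by (subst sum.swap) (simp add: mult_ac)
      then have "H n G = (\<integral>U. iexp (\<Sum>i\<in>{1..n}. ?Y G (U i) / sqrt (real n)) \<partial>?Q n)"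
        unfolding H_def by simp
      also have "\<dots> = (\<Prod>i\<in>{1..n}. \<integral>x. iexp (?Y G x / sqrt (real n)) \<partial>P n)"
        by (rule integral_PiM_iexp_sum) (auto intro: P.prob_space_axioms)
      finally show ?thesis by simp
    qed
    show ?thesis using 1 2 3 4 by blast
  qed
  have lim: "(\<lambda>n. H n G) \<longlonglongrightarrow> exp (\<i> * of_real (\<Sum>a\<in>A. c a * \<mu> a * G a) - of_real (\<Sum>a\<in>A. (c a * G a)\<^sup>2) / 2)"
    for G
  proof -
    have "(\<lambda>n. (\<integral>x. iexp (?Y G x / sqrt (real n)) \<partial>P n) ^ n)
        \<longlonglongrightarrow> exp (\<i> * of_real (\<Sum>a\<in>A. c a * \<mu> a * G a) - of_real (\<Sum>a\<in>A. (c a * G a)\<^sup>2) / 2)"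
    proof (rule char_power_tendsto[where B = "\<Sum>a\<in>A. \<bar>c a * G a\<bar> * B"])
      show "\<forall>\<^sub>F n in sequentially. prob_space (P n) \<and> ?Y G \<in> borel_measurable (P n)
          \<and> (\<forall>x\<in>space (P n). \<bar>?Y G x\<bar> \<le> (\<Sum>a\<in>A. \<bar>c a * G a\<bar> * B))"
        using P
      proof eventually_elim
        case (elim n)
        have "\<bar>?Y G x\<bar> \<le> (\<Sum>a\<in>A. \<bar>c a * G a\<bar> * B)" if "x \<in> space (P n)" for x
          by (rule order_trans[OF sum_abs sum_mono]) (use elim that in \<open>auto simp: abs_mult intro!: mult_left_mono\<close>)
        moreover have "?Y G \<in> borel_measurable (P n)"
          using elim by (intro borel_measurable_sum borel_measurable_times) auto
        ultimately show ?case using elim by blast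
      qed
      have int: "integrable (P n) (g a)" "integrable (P n) (\<lambda>x. g a x * g b x)"
        if "a \<in> A" "b \<in> A" "n \<ge> N" for a b n
      proof -
        interpret prob_space "P n" using N[OF that(3)] by blast
        have [measurable]: "g a \<in> borel_measurable (P n)" "g b \<in> borel_measurable (P n)"
          and B: "\<And>x. x \<in> space (P n) \<Longrightarrow> \<bar>g a x\<bar> \<le> B" "\<And>x. x \<in> space (P n) \<Longrightarrow> \<bar>g b x\<bar> \<le> B"
          using N[OF that(3)] that by auto
        show "integrable (P n) (g a)"
          by (rule integrable_const_bound[where B = B]) (use B in auto)
        show "integrable (P n) (\<lambda>x. g a x * g b x)"
          by (rule integrable_const_bound[where B = "B * B"])
            (use B in \<open>auto simp: abs_mult intro!: AE_I2 mult_mono order_trans[OF abs_ge_zero]\<close>)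
      qed
      have "(\<lambda>n. \<Sum>a\<in>A. G a * (c a * (sqrt (real n) * (\<integral>x. g a x \<partial>P n)))) \<longlonglongrightarrow> (\<Sum>a\<in>A. G a * (c a * \<mu> a))"
        by (intro tendsto_intros mean)
      moreover have "\<forall>\<^sub>F n in sequentially. (\<Sum>a\<in>A. G a * (c a * (sqrt (real n) * (\<integral>x. g a x \<partial>P n))))
          = sqrt (real n) * (\<integral>x. ?Y G x \<partial>P n)"
        using eventually_ge_at_top[of N]
        by eventually_elim (simp add: int sum_distrib_left mult_ac)
      ultimately have "(\<lambda>n. sqrt (real n) * (\<integral>x. ?Y G x \<partial>P n)) \<longlonglongrightarrow> (\<Sum>a\<in>A. G a * (c a * \<mu> a))"
        by (rule Lim_transform_eventually)
      also have "(\<Sum>a\<in>A. G a * (c a * \<mu> a)) = (\<Sum>a\<in>A. c a * \<mu> a * G a)"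
        by (simp add: mult_ac)
      finally show "(\<lambda>n. sqrt (real n) * (\<integral>x. ?Y G x \<partial>P n)) \<longlonglongrightarrow> (\<Sum>a\<in>A. c a * \<mu> a * G a)" .
      have "(\<lambda>n. \<Sum>a\<in>A. \<Sum>b\<in>A. c a * G a * (c b * G b) * (\<integral>x. g a x * g b x \<partial>P n))
          \<longlonglongrightarrow> (\<Sum>a\<in>A. \<Sum>b\<in>A. c a * G a * (c b * G b) * (if a = b then 1 else 0))"
        by (intro tendsto_intros cov)
      moreover have "\<forall>\<^sub>F n in sequentially. (\<Sum>a\<in>A. \<Sum>b\<in>A. c a * G a * (c b * G b) * (\<integral>x. g a x * g b x \<partial>P n))
          = (\<integral>x. (?Y G x)\<^sup>2 \<partial>P n)"
        using eventually_ge_at_top[of N]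
      proof eventually_elim
        case (elim n)
        have "(\<lambda>x. (?Y G x)\<^sup>2) = (\<lambda>x. \<Sum>a\<in>A. \<Sum>b\<in>A. c a * G a * (c b * G b) * (g a x * g b x))"
          unfolding power2_eq_square sum_product by (simp add: mult_ac)
        then show ?case using elim by (simp add: int)
      qed
      ultimately have "(\<lambda>n. \<integral>x. (?Y G x)\<^sup>2 \<partial>P n)
          \<longlonglongrightarrow> (\<Sum>a\<in>A. \<Sum>b\<in>A. c a * G a * (c b * G b) * (if a = b then 1 else 0))"
        by (rule Lim_transform_eventually)
      also have "(\<Sum>a\<in>A. \<Sum>b\<in>A. c a * G a * (c b * G b) * (if a = b then 1 else 0)) = (\<Sum>a\<in>A. (c a * G a)\<^sup>2)"
        by (simp add: A power2_eq_square if_distrib[of "(*) _"] cong: if_cong)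
      finally show "(\<lambda>n. \<integral>x. (?Y G x)\<^sup>2 \<partial>P n) \<longlonglongrightarrow> (\<Sum>a\<in>A. (c a * G a)\<^sup>2)" .
    qed
    moreover have "\<forall>\<^sub>F n in sequentially. (\<integral>x. iexp (?Y G x / sqrt (real n)) \<partial>P n) ^ n = H n G"
      using eventually_ge_at_top[of N] by eventually_elim (use H in auto)
    ultimately show ?thesis by (rule Lim_transform_eventually)
  qed
  let ?L = "\<lambda>G. exp (\<i> * of_real (\<Sum>a\<in>A. c a * \<mu> a * G a) - of_real (\<Sum>a\<in>A. (c a * G a)\<^sup>2) / 2) :: complex"
  \<comment> \<open>The shift by \<open>N\<close> makes measurability and domination hold along the
    whole sequence, as the first \<open>P n\<close> need not be probability measures.\<close>
  have "(\<lambda>n. \<integral>G. H (n + N) G \<partial>?\<Gamma>) \<longlonglongrightarrow> (\<integral>G. ?L G \<partial>?\<Gamma>)"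
  proof (rule integral_dominated_convergence[where w = "\<lambda>_. 1"])
    show "AE G in ?\<Gamma>. (\<lambda>n. H (n + N) G) \<longlonglongrightarrow> ?L G"
      using lim by (auto intro!: LIMSEQ_ignore_initial_segment)
    show "H (n + N) \<in> borel_measurable ?\<Gamma>" "AE G in ?\<Gamma>. norm (H (n + N) G) \<le> 1" for n
      using H[of "n + N"] by (blast intro: AE_I2 le_add2)+
  qed simp_all
  then have "(\<lambda>n. \<integral>G. H n G \<partial>?\<Gamma>) \<longlonglongrightarrow> (\<integral>G. ?L G \<partial>?\<Gamma>)"
    by (rule LIMSEQ_offset)
  moreover have "\<forall>\<^sub>F n in sequentially. (\<integral>G. H n G \<partial>?\<Gamma>) = of_real (integral\<^sup>L (?Q n) (?F n))"
    using eventually_ge_at_top[of N] by eventually_elim (use H in auto)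
  ultimately have "(\<lambda>n. of_real (integral\<^sup>L (?Q n) (?F n))) \<longlonglongrightarrow> (\<integral>G. ?L G \<partial>?\<Gamma>)"
    by (rule Lim_transform_eventually)
  also have "(\<integral>G. ?L G \<partial>?\<Gamma>)
      = (\<integral>G. (\<Prod>a\<in>A. iexp (c a * \<mu> a * G a) * of_real (exp (- ((c a)\<^sup>2 * (G a)\<^sup>2) / 2))) \<partial>?\<Gamma>)"
  proof (rule Bochner_Integration.integral_cong)
    fix G
    have "?L G = exp (\<Sum>a\<in>A. \<i> * of_real (c a * \<mu> a * G a) + of_real (- ((c a)\<^sup>2 * (G a)\<^sup>2) / 2))"
      by (simp add: sum.distrib sum_distrib_left sum_divide_distrib sum_negf sum_subtractf power_mult_distrib)
    also have "\<dots> = (\<Prod>a\<in>A. iexp (c a * \<mu> a * G a) * of_real (exp (- ((c a)\<^sup>2 * (G a)\<^sup>2) / 2)))"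
      by (simp only: exp_sum[OF A] exp_add exp_of_real)
    finally show "?L G = \<dots>" .
  qed simp
  also have "\<dots> = (\<Prod>a\<in>A. \<integral>z. iexp (c a * \<mu> a * z) * of_real (exp (- ((c a)\<^sup>2 * z\<^sup>2) / 2)) \<partial>std_normal_distribution)"
  proof (rule product_sigma_finite.product_integral_prod[OF _ A])
    interpret N: prob_space std_normal_distribution by (rule prob_space_normal_density) simp
    show "product_sigma_finite (\<lambda>_::'b. std_normal_distribution)"
      unfolding product_sigma_finite_def using N.sigma_finite_measure_axioms by blast
    show "integrable std_normal_distribution (\<lambda>z. iexp (c a * \<mu> a * z) * of_real (exp (- ((c a)\<^sup>2 * z\<^sup>2) / 2)))" for a
      by (rule N.integrable_const_bound[where B = 1]) (auto simp: norm_mult)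
  qed
  also have "\<dots> = of_real (\<Prod>a\<in>A. exp (- ((c a * \<mu> a)\<^sup>2 / (2 * (1 + (c a)\<^sup>2)))) / sqrt (1 + (c a)\<^sup>2))"
    by (subst integral_iexp_exp_square) simp_all
  finally show ?thesis unfolding tendsto_of_real_iff .
qed

section \<open>Laplace transforms of non-central chi-square laws and their weighted sums\<close>

lemma prob_space_chi_square: "prob_space (chi_square d \<xi>)"
  unfolding chi_square_def
  by (intro prob_space.prob_space_distr prob_space_PiM prob_space_normal_density) auto

lemma sets_chi_square [simp, measurable_cong]: "sets (chi_square d \<xi>) = sets borel"
  by (simp add: chi_square_def)

lemma integral_PiM_exp_sum:
  fixes f :: "'a \<Rightarrow> 'b \<Rightarrow> real"
  assumes "finite A" and M: "\<And>a. prob_space (M a)" and f: "\<And>a. a \<in> A \<Longrightarrow> f a \<in> borel_measurable (M a)"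
    "\<And>a y. a \<in> A \<Longrightarrow> AE y in M a. f a y \<le> 0"
  shows "(\<integral>x. exp (\<Sum>a\<in>A. f a (x a)) \<partial>Pi\<^sub>M A M) = (\<Prod>a\<in>A. \<integral>y. exp (f a y) \<partial>M a)"
proof -
  have int: "integrable (M a) (\<lambda>y. exp (f a y))" if "a \<in> A" for a
  proof -
    interpret prob_space "M a" by (rule M)
    show ?thesis
      by (rule integrable_const_bound[where B = 1]) (use f that in auto)
  qed
  interpret product_prob_space M by (simp add: product_prob_space_def product_sigma_finite_def
        product_prob_space_axioms_def M prob_space_imp_sigma_finite)
  show ?thesis
    unfolding exp_sum[OF assms(1)] by (rule product_integral_prod[OF assms(1) int])
qed

lemma AE_chi_square_nonneg: "AE x in chi_square d \<xi>. 0 \<le> x"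
  unfolding chi_square_def by (subst AE_distr_iff) (auto intro!: sum_nonneg)

text \<open>Each of the \<open>d\<close> coordinates contributes the square root in the denominator,
  and coordinate 0, which carries the whole mean, contributes the exponential; \<open>d > 0\<close>
  guarantees that this coordinate exists.\<close>

lemma Laplace_chi_square:
  assumes "0 \<le> l" "0 \<le> \<xi>" "d > 0"
  shows "(\<integral>x. exp (- (l * x)) \<partial>chi_square d \<xi>) = exp (- (l * \<xi> / (1 + 2 * l))) / sqrt (1 + 2 * l) ^ d"
proof -
  let ?N = "\<lambda>i::nat. density lborel (normal_density (if i = 0 then sqrt \<xi> else 0) 1)"
  have "(\<integral>x. exp (- (l * x)) \<partial>chi_square d \<xi>) = (\<integral>z. exp (\<Sum>i<d. - (l * (z i)\<^sup>2)) \<partial>Pi\<^sub>M {..<d} ?N)"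
    unfolding chi_square_def by (subst integral_distr) (auto simp: sum_distrib_left sum_negf)
  also have "\<dots> = (\<Prod>i<d. \<integral>z. exp (- (l * z\<^sup>2)) \<partial>?N i)"
    using assms(1) by (intro integral_PiM_exp_sum) (auto intro!: prob_space_normal_density)
  also have "\<dots> = (\<Prod>i<d. exp (- (l * (if i = 0 then \<xi> else 0) / (1 + 2 * l))) / sqrt (1 + 2 * l))"
    using assms(1,2) by (intro prod.cong) (simp_all add: integral_exp_square_normal)
  also have "\<dots> = (\<Prod>i<d. exp (- (l * (if i = 0 then \<xi> else 0) / (1 + 2 * l)))) / sqrt (1 + 2 * l) ^ d"
    by (simp add: prod_dividef)
  also have "(\<Prod>i<d. exp (- (l * (if i = 0 then \<xi> else 0) / (1 + 2 * l))))
      = (\<Prod>i<d. if i = 0 then exp (- (l * \<xi> / (1 + 2 * l))) else 1)"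
    by (intro prod.cong) auto
  also have "\<dots> = exp (- (l * \<xi> / (1 + 2 * l)))"
    using assms(3) by (simp add: prod.delta)
  finally show ?thesis .
qed

lemma real_distribution_weighted_chi_square: "real_distribution (weighted_chi_square K w d \<xi>)"
  unfolding weighted_chi_square_def
  by (intro prob_space.real_distribution_distr prob_space_PiM prob_space_chi_square) auto

lemma AE_weighted_chi_square_nonneg:
  assumes "\<And>k. 0 \<le> w k"
  shows "AE x in weighted_chi_square K w d \<xi>. 0 \<le> x"
proof -
  have "AE x in Pi\<^sub>M {1..K} (\<lambda>k. chi_square (d k) (\<xi> k)). \<forall>k\<in>{1..K}. 0 \<le> x k"
    by (intro AE_finite_allI AE_PiM_component prob_space_chi_square AE_chi_square_nonneg) auto
  then show ?thesis
    unfolding weighted_chi_square_def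
    by (subst AE_distr_iff) (auto elim!: eventually_mono intro!: sum_nonneg mult_nonneg_nonneg assms)
qed

text \<open>These factors are those of the limit in \<open>Laplace_quadratic_tendsto\<close> for
  \<open>(c a)\<^sup>2 = 2 * (l * w k)\<close>, multiplied over the basis indices of each
  degree.\<close>

lemma Laplace_weighted_chi_square:
  assumes "0 \<le> l" "\<And>k. 0 \<le> w k" "\<And>k. 0 \<le> \<xi> k" "\<And>k. 1 \<le> k \<Longrightarrow> d k > 0"
  shows "(\<integral>x. exp (- (l * x)) \<partial>weighted_chi_square K w d \<xi>)
    = (\<Prod>k=1..K. exp (- (l * w k * \<xi> k / (1 + 2 * (l * w k)))) / sqrt (1 + 2 * (l * w k)) ^ d k)"
proof -
  have "(\<integral>x. exp (- (l * x)) \<partial>weighted_chi_square K w d \<xi>)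
      = (\<integral>x. exp (\<Sum>k=1..K. - (l * w k * x k)) \<partial>Pi\<^sub>M {1..K} (\<lambda>k. chi_square (d k) (\<xi> k)))"
    unfolding weighted_chi_square_def by (subst integral_distr) (auto simp: sum_distrib_left sum_negf mult.assoc)
  also have "\<dots> = (\<Prod>k=1..K. \<integral>x. exp (- (l * w k * x)) \<partial>chi_square (d k) (\<xi> k))"
    by (rule integral_PiM_exp_sum)
      (auto intro!: prob_space_chi_square eventually_mono[OF AE_chi_square_nonneg] mult_nonneg_nonneg assms)
  also have "\<dots> = (\<Prod>k=1..K. exp (- (l * w k * \<xi> k / (1 + 2 * (l * w k)))) / sqrt (1 + 2 * (l * w k)) ^ d k)"
    by (intro prod.cong Laplace_chi_square) (auto intro!: mult_nonneg_nonneg assms)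
  finally show ?thesis .
qed

section \<open>The uniform law on the sphere\<close>

text \<open>The law of one observation at concentration 0. All moments under the alternatives are
  computed as perturbations of moments under this law.\<close>

definition sphere_unif :: "(real ^ 'p::{finite,wellorder}) measure" where
  "sphere_unif = density surface_measure (\<lambda>_. 1 / emeasure surface_measure (sphere 0 1 :: (real ^ 'p::_) set))"

lemma sets_surface_measure [simp, measurable_cong]:
  "sets (surface_measure :: (real ^ 'p::{finite,wellorder}) measure) = sets (restrict_space borel (sphere 0 1))"
  by (simp add: surface_measure_def)

lemma sets_sphere_unif [simp, measurable_cong]:
  "sets (sphere_unif :: (real ^ 'p::{finite,wellorder}) measure) = sets (restrict_space borel (sphere 0 1))"
  by (simp add: sphere_unif_def)

lemma space_surface_measure [simp]: "space (surface_measure :: (real ^ 'p::{finite,wellorder}) measure) = sphere 0 1"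
  by (simp add: surface_measure_def space_scale_measure space_restrict_space)

lemma space_sphere_unif [simp]: "space (sphere_unif :: (real ^ 'p::{finite,wellorder}) measure) = sphere 0 1"
  by (simp add: sphere_unif_def)

lemma normalize_measurable:
  "(\<lambda>x::real^'p::{finite,wellorder}. x /\<^sub>R norm x) \<in>
      restrict_space lborel (ball 0 1 - {0}) \<rightarrow>\<^sub>M restrict_space borel (sphere 0 1)"
  by (rule measurable_restrict_space2)
     (auto simp: space_restrict_space intro!: measurable_restrict_space1)

lemma emeasure_surface_measure_vimage:
  fixes A :: "(real ^ 'p::{finite,wellorder}) set"
  assumes "A \<in> sets (restrict_space borel (sphere 0 1))"
  shows "emeasure surface_measure A =
    of_nat CARD('p) * emeasure lborel {x \<in> ball 0 1 - {0}. x /\<^sub>R norm x \<in> A}"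
proof -
  have "emeasure (restrict_space lborel (ball 0 1 - {0})) ((\<lambda>x. x /\<^sub>R norm x) -` A \<inter> (ball 0 1 - {0}))
      = emeasure lborel ((\<lambda>x. x /\<^sub>R norm x) -` A \<inter> (ball 0 1 - {0}))"
    by (rule emeasure_restrict_space) auto
  then show ?thesis
    unfolding surface_measure_def emeasure_scale_measure emeasure_distr[OF normalize_measurable assms]
    by (simp add: space_restrict_space vimage_def Int_def conj_commute)
qed

text \<open>The cone over the whole sphere is the punctured unit ball, whose volume is positive and
  finite.\<close>

lemma emeasure_surface_sphere:
  "0 < emeasure surface_measure (sphere 0 1 :: (real ^ 'p::{finite,wellorder}) set)"
  "emeasure surface_measure (sphere 0 1 :: (real ^ 'p::{finite,wellorder}) set) < \<infinity>"
proof -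
  have "{x :: real ^ 'p::_. x \<in> ball 0 1 - {0} \<and> x /\<^sub>R norm x \<in> sphere 0 1} = ball 0 1 - {0}"
    by auto
  then have *: "emeasure surface_measure (sphere 0 1 :: (real ^ 'p::_) set)
      = of_nat CARD('p) * emeasure lborel (ball 0 1 - {0} :: (real ^ 'p::_) set)"
    using emeasure_surface_measure_vimage[of "sphere 0 1 :: (real ^ 'p::_) set"] by (simp add: sets_restrict_space_iff)
  have **: "emeasure lborel (ball 0 1 - {0} :: (real ^ 'p::_) set) = emeasure lborel (ball 0 1 :: (real ^ 'p::_) set)"
    by (rule emeasure_Diff_null_set) auto
  have "emeasure lborel (ball 0 1 :: (real ^ 'p::_) set) > 0"
    using content_ball_pos[of 1 "0 :: real ^ 'p::_"] emeasure_lborel_ball_finite[of "0 :: real ^ 'p::_" 1]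
    by (simp add: emeasure_eq_ennreal_measure)
  then show "0 < emeasure surface_measure (sphere 0 1 :: (real ^ 'p::_) set)"
    unfolding * ** by (simp add: ennreal_zero_less_mult_iff)
  have "emeasure lborel (ball 0 1 :: (real ^ 'p::_) set) < \<infinity>"
    by (rule emeasure_bounded_finite) simp
  then show "emeasure surface_measure (sphere 0 1 :: (real ^ 'p::_) set) < \<infinity>"
    unfolding * ** by (simp add: ennreal_mult_less_top of_nat_less_top)
qed

lemma prob_space_sphere_unif: "prob_space (sphere_unif :: (real ^ 'p::{finite,wellorder}) measure)"
proof
  let ?T = "emeasure surface_measure (sphere 0 1 :: (real ^ 'p::_) set)"
  have "(sphere 0 1 :: (real ^ 'p::_) set) \<in> sets surface_measure"
    by (metis sets.top space_surface_measure)
  then have "emeasure sphere_unif (space sphere_unif :: (real ^ 'p::_) set) = 1 / ?T * ?T"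
    unfolding sphere_unif_def by (simp add: emeasure_density nn_integral_cmult_indicator)
  also have "\<dots> = 1"
    using emeasure_surface_sphere[where 'p = 'p] by (simp add: ennreal_divide_times ennreal_divide_self less_top)
  finally show "emeasure sphere_unif (space sphere_unif :: (real ^ 'p::_) set) = 1" .
qed

interpretation sphere_unif: prob_space "sphere_unif :: (real ^ 'p::{finite,wellorder}) measure"
  by (rule prob_space_sphere_unif)

lemma sphere_unif_measurableI [measurable (raw)]:
  "g \<in> borel_measurable borel \<Longrightarrow> g \<in> borel_measurable (sphere_unif :: (real ^ 'p::{finite,wellorder}) measure)"
  by (simp add: measurable_restrict_space1 measurable_cong_sets[OF sets_sphere_unif refl])

lemma sphere_unif_integrable:
  fixes g :: "real ^ 'p::{finite,wellorder} \<Rightarrow> real"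
  assumes "g \<in> borel_measurable sphere_unif" "\<And>x. norm x = 1 \<Longrightarrow> \<bar>g x\<bar> \<le> B"
  shows "integrable sphere_unif g"
  by (rule sphere_unif.integrable_const_bound[where B = B]) (use assms in auto)

section \<open>Invariance of the uniform law under orthogonal maps\<close>

lemma distr_lborel_orthogonal:
  fixes T :: "real ^ 'p::{finite,wellorder} \<Rightarrow> real ^ 'p::_"
  assumes T: "orthogonal_transformation T"
  shows "distr lborel borel T = lborel"
proof (rule lborel_eqI[symmetric])
  have "linear T" "linear (inv T)" and invT: "orthogonal_transformation (inv T)"
    using T by (auto intro: orthogonal_transformation_linear orthogonal_transformation_inv)
  then have [measurable]: "T \<in> borel_measurable borel"
    by (auto intro!: borel_measurable_continuous_onI linear_continuous_on simp: linear_conv_bounded_linear)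
  fix l u :: "real ^ 'p::_" assume lu: "\<And>b. b \<in> Basis \<Longrightarrow> l \<bullet> b \<le> u \<bullet> b"
  have vimage: "T -` box l u = inv T ` box l u"
    using orthogonal_transformation_bij[OF T] by (rule bij_vimage_eq_inv_image)
  have box: "box l u \<in> lmeasurable" by simp
  have "emeasure (distr lborel borel T) (box l u) = emeasure lborel (T -` box l u)"
    by (subst emeasure_distr) auto
  \<comment> \<open>On Borel sets the completed measure agrees with \<open>lborel\<close>; passing
    to it lets the volume of an orthogonal image of a box be computed.\<close>
  also have "\<dots> = emeasure lebesgue (T -` box l u)"
    using measurable_sets_borel[of T borel "box l u"] by simp
  also have "\<dots> = ennreal (measure lebesgue (T -` box l u))"
    unfolding vimage using measurable_orthogonal_image[OF invT box]
    by (rule emeasure_eq_measure2)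
  also have "measure lebesgue (T -` box l u) = measure lebesgue (box l u)"
    unfolding vimage by (rule measure_orthogonal_image[OF invT box])
  also have "ennreal (measure lebesgue (box l u)) = (\<Prod>b\<in>Basis. (u - l) \<bullet> b)"
    using lu by (simp add: measure_completion measure_lborel_box)
  finally show "emeasure (distr lborel borel T) (box l u) = (\<Prod>b\<in>Basis. (u - l) \<bullet> b)" .
qed simp

text \<open>Since \<open>T\<close> is linear and preserves norms, it commutes with
  \<open>x \<mapsto> x /\<^sub>R norm x\<close>. The cone over a preimage is therefore the preimage
  of the cone, and invariance of surface measure reduces to that of volume.\<close>

lemma integral_sphere_unif_orthogonal:
  fixes T :: "real ^ 'p::{finite,wellorder} \<Rightarrow> real ^ 'p::_" and g :: "real ^ 'p::_ \<Rightarrow> real"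
  assumes T: "orthogonal_transformation T" and g: "g \<in> borel_measurable borel"
  shows "(\<integral>x. g (T x) \<partial>sphere_unif) = (\<integral>x. g x \<partial>sphere_unif)"
proof -
  have "linear T"
    using T by (rule orthogonal_transformation_linear)
  have norm_T: "norm (T x) = norm x" for x
    using T by (rule orthogonal_transformation_norm)
  from \<open>linear T\<close> have T_borel [measurable]: "T \<in> borel_measurable borel"
    by (auto intro!: borel_measurable_continuous_onI linear_continuous_on simp: linear_conv_bounded_linear)
  have T_meas [measurable]: "T \<in> surface_measure \<rightarrow>\<^sub>M surface_measure"
    unfolding measurable_cong_sets[OF sets_surface_measure sets_surface_measure]
    by (rule measurable_restrict_space2) (auto intro!: measurable_restrict_space1 simp: space_restrict_space norm_T)
  have "distr surface_measure surface_measure T = surface_measure"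
  proof (rule measure_eqI)
    fix A :: "(real ^ 'p::_) set" assume "A \<in> sets (distr surface_measure surface_measure T)"
    then have A: "A \<in> sets (restrict_space borel (sphere 0 1))" "A \<subseteq> sphere 0 1" "A \<in> sets borel"
      by (auto simp: sets_restrict_space)
    have vA: "T -` A \<inter> sphere 0 1 \<in> sets (restrict_space borel (sphere 0 1))"
      using measurable_sets[OF T_meas, of A] A by simp
    let ?C = "{x \<in> ball 0 1 - {0}. x /\<^sub>R norm x \<in> A}"
    have C: "?C \<in> sets borel"
      using measurable_sets[OF normalize_measurable A(1)] 
      by (simp add: sets_restrict_space_iff space_restrict_space vimage_def Int_def conj_commute)
    have "emeasure (distr surface_measure surface_measure T) A = emeasure surface_measure (T -` A \<inter> sphere 0 1)"
      using A by (subst emeasure_distr) auto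
    also have "\<dots> = of_nat CARD('p) * emeasure lborel {x \<in> ball 0 1 - {0}. x /\<^sub>R norm x \<in> T -` A \<inter> sphere 0 1}"
      by (rule emeasure_surface_measure_vimage[OF vA])
    also have "{x \<in> ball 0 1 - {0}. x /\<^sub>R norm x \<in> T -` A \<inter> sphere 0 1} = T -` ?C"
    proof -
      have "T 0 = 0" using \<open>linear T\<close> by (rule linear_0)
      moreover have "T (x /\<^sub>R norm x) = T x /\<^sub>R norm (T x)" for x
        using \<open>linear T\<close> by (simp add: norm_T linear_cmul)
      moreover have "T x = 0 \<longleftrightarrow> x = 0" for x
        using norm_T[of x] by (metis norm_eq_zero)
      ultimately show ?thesis by (auto simp: norm_T)
    qed
    also have "emeasure lborel (T -` ?C) = emeasure (distr lborel borel T) ?C"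
      using C by (subst emeasure_distr) auto
    also have "\<dots> = emeasure lborel ?C"
      unfolding distr_lborel_orthogonal[OF T] ..
    also have "of_nat CARD('p) * \<dots> = emeasure surface_measure A"
      by (rule emeasure_surface_measure_vimage[OF A(1), symmetric])
    finally show "emeasure (distr surface_measure surface_measure T) A = emeasure surface_measure A" .
  qed simp
  then have "distr sphere_unif surface_measure T = sphere_unif"
    unfolding sphere_unif_def by (subst density_distr[symmetric]) auto
  then have "(\<integral>x. g x \<partial>sphere_unif) = (\<integral>x. g x \<partial>distr sphere_unif surface_measure T)"
    by simp
  also have "\<dots> = (\<integral>x. g (T x) \<partial>sphere_unif)"
  proof (rule integral_distr)
    show "T \<in> sphere_unif \<rightarrow>\<^sub>M surface_measure"
      using T_meas by (simp add: measurable_cong_sets[OF sets_sphere_unif refl] measurable_cong_sets[OF sets_surface_measure refl])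
    show "g \<in> borel_measurable surface_measure"
      using g by (simp add: measurable_restrict_space1 measurable_cong_sets[OF sets_surface_measure refl])
  qed
  finally show ?thesis ..
qed

text \<open>The reflection in the hyperplane orthogonal to \<open>a\<close>. For
  \<open>a = 0\<close> the convention on division by zero makes it the identity, so
  \<open>reflection (u - v)\<close> may be used also when \<open>u = v\<close>.\<close>

definition reflection :: "'a::real_inner \<Rightarrow> 'a \<Rightarrow> 'a" where
  "reflection a x = x - (2 * (a \<bullet> x) / (a \<bullet> a)) *\<^sub>R a"

lemma orthogonal_transformation_reflection: "orthogonal_transformation (reflection a)"
proof -
  have "linear (reflection a)"
    by (rule linearI) (auto simp: reflection_def algebra_simps add_divide_distrib)
  moreover have "reflection a x \<bullet> reflection a y = x \<bullet> y" for x y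
    by (cases "a = 0") (auto simp: reflection_def inner_diff_left inner_diff_right inner_commute field_simps)
  ultimately show ?thesis by (simp add: orthogonal_transformation_def)
qed

lemma reflection_fixes: "a \<bullet> x = 0 \<Longrightarrow> reflection a x = x"
  by (simp add: reflection_def)

text \<open>For equal norms the hyperplane orthogonal to \<open>u - v\<close> through the origin
  bisects the segment from \<open>u\<close> to \<open>v\<close>.\<close>

lemma reflection_swap:
  assumes "norm u = norm v" shows "reflection (u - v) u = v"
proof (cases "u = v")
  case False
  have eq: "2 * ((u - v) \<bullet> u) = (u - v) \<bullet> (u - v)"
    using assms by (simp add: inner_diff_left inner_diff_right norm_eq inner_commute)
  have "(u - v) \<bullet> (u - v) \<noteq> 0"
    using False by simp
  then have "2 * ((u - v) \<bullet> u) / ((u - v) \<bullet> (u - v)) = 1"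
    unfolding eq by (rule divide_self)
  then have "reflection (u - v) u = u - 1 *\<^sub>R (u - v)"
    unfolding reflection_def by (simp only:)
  then show ?thesis by simp
qed (simp add: reflection_def)

text \<open>A reflection carries \<open>u\<close> to \<open>u'\<close>, a second one fixing \<open>u'\<close> adjusts the image of \<open>w\<close>.\<close>

lemma integral_sphere_unif_pair:
  fixes F :: "real \<times> real \<Rightarrow> real" and u w u' w' :: "real ^ 'p::{finite,wellorder}"
  assumes F: "F \<in> borel_measurable borel"
    and "norm u = norm u'" "norm w = norm w'" "u \<bullet> w = u' \<bullet> w'"
  shows "(\<integral>x. F (u \<bullet> x, w \<bullet> x) \<partial>sphere_unif) = (\<integral>x. F (u' \<bullet> x, w' \<bullet> x) \<partial>sphere_unif)"
proof -
  have [measurable]: "(\<lambda>x. F (a \<bullet> x, b \<bullet> x)) \<in> borel_measurable borel" for a b :: "real ^ 'p::_"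
    by (rule measurable_compose[OF _ F]) (intro borel_measurable_continuous_onI continuous_intros)
  have step: "(\<integral>x. F (T a \<bullet> x, T b \<bullet> x) \<partial>sphere_unif) = (\<integral>x. F (a \<bullet> x, b \<bullet> x) \<partial>sphere_unif)"
    if "orthogonal_transformation T" for T :: "real ^ 'p::_ \<Rightarrow> real ^ 'p::_" and a b :: "real ^ 'p::_"
    using integral_sphere_unif_orthogonal[OF that, of "\<lambda>x. F (T a \<bullet> x, T b \<bullet> x)"] that
    by (simp add: orthogonal_transformation_def)
  define w1 where "w1 = reflection (u - u') w"
  have w1: "norm w1 = norm w'" "u' \<bullet> w1 = u' \<bullet> w'"
    using orthogonal_transformation_reflection[of "u - u'"] reflection_swap[OF assms(2)] assms(3,4)
    unfolding w1_def orthogonal_transformation_def by (metis norm_eq)+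
  have "(\<integral>x. F (u \<bullet> x, w \<bullet> x) \<partial>sphere_unif) = (\<integral>x. F (u' \<bullet> x, w1 \<bullet> x) \<partial>sphere_unif)"
    using step[OF orthogonal_transformation_reflection[of "u - u'"], of u w] reflection_swap[OF assms(2)]
    by (simp add: w1_def)
  also have "\<dots> = (\<integral>x. F (u' \<bullet> x, w' \<bullet> x) \<partial>sphere_unif)"
    using step[OF orthogonal_transformation_reflection[of "w1 - w'"], of u' w1] reflection_swap[OF w1(1)]
      reflection_fixes[of "w1 - w'" u'] w1(2) by (simp add: inner_diff_left inner_diff_right inner_commute)
  finally show ?thesis .
qed

lemma norm_theta0 [simp]: "norm (theta0 :: real ^ 'p::{finite,wellorder}) = 1"
  by (simp add: theta0_def)

text \<open>The mass of the sphere cancels between the density and its normalising integral;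
  \<open>bound\<close> and \<open>pos\<close> make that integral finite and positive, so that
  extended division becomes real division.\<close>

lemma angular_law_eq:
  assumes f: "f \<in> borel_measurable borel" "\<And>x. 0 \<le> f x"
    and bound: "\<And>s. \<bar>s\<bar> \<le> 1 \<Longrightarrow> f (\<kappa> * s) \<le> B"
    and pos: "(\<integral>u. f (\<kappa> * (u \<bullet> theta0)) \<partial>(sphere_unif :: (real ^ 'p::{finite,wellorder}) measure)) > 0"
  shows "(angular_law \<kappa> f :: (real ^ 'p::{finite,wellorder}) measure) = density sphere_unif
    (\<lambda>u. ennreal (f (\<kappa> * (u \<bullet> theta0)) / (\<integral>u. f (\<kappa> * (u \<bullet> theta0)) \<partial>(sphere_unif :: (real ^ 'p::_) measure))))"
proof -
  let ?T = "emeasure surface_measure (sphere 0 1 :: (real ^ 'p::_) set)"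
  let ?F = "\<lambda>u :: real ^ 'p::_. f (\<kappa> * (u \<bullet> theta0))"
  let ?Z = "\<integral>u. ?F u \<partial>sphere_unif"
  have T: "?T \<noteq> 0" "?T \<noteq> \<infinity>"
    using emeasure_surface_sphere[where 'p = 'p] by auto
  have meas: "?F \<in> borel_measurable borel"
    by (rule measurable_compose[OF _ f(1)]) (intro borel_measurable_continuous_onI continuous_intros)
  then have meas': "?F \<in> borel_measurable surface_measure"
    by (simp add: measurable_restrict_space1 measurable_cong_sets[OF sets_surface_measure refl])
  have abs: "\<bar>u \<bullet> theta0\<bar> \<le> 1" if "norm u = 1" for u :: "real ^ 'p::_"
    using Cauchy_Schwarz_ineq2[of u theta0] that by simp
  have int: "integrable sphere_unif ?F"
    by (rule sphere_unif_integrable[where B = B]) (use meas f(2) bound abs in auto)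
  have Z: "(\<integral>\<^sup>+u. ennreal (?F u) \<partial>surface_measure) = ?T * ennreal ?Z"
  proof -
    have "ennreal ?Z = (\<integral>\<^sup>+u. ennreal (?F u) \<partial>sphere_unif)"
      using f(2) by (intro nn_integral_eq_integral[symmetric] int) auto
    also have "\<dots> = (\<integral>\<^sup>+u. 1 / ?T * ennreal (?F u) \<partial>surface_measure)"
      unfolding sphere_unif_def using meas' by (subst nn_integral_density) auto
    also have "\<dots> = 1 / ?T * (\<integral>\<^sup>+u. ennreal (?F u) \<partial>surface_measure)"
      using meas' by (subst nn_integral_cmult) auto
    finally have "?T * ennreal ?Z = ?T * (1 / ?T) * (\<integral>\<^sup>+u. ennreal (?F u) \<partial>surface_measure)"
      by (simp add: mult.assoc)
    also have "?T * (1 / ?T) = 1"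
      using T by (simp add: ennreal_times_divide ennreal_divide_self less_top)
    finally show ?thesis by simp
  qed
  have "ennreal (?F u) / (?T * ennreal ?Z) = 1 / ?T * ennreal (?F u / ?Z)" for u
  proof -
    obtain t where t: "?T = ennreal t" "0 < t"
      using T by (cases ?T) (auto simp: ennreal_eq_0_iff not_le)
    show ?thesis
      unfolding t(1) using t(2) pos f(2)
      by (simp add: divide_ennreal ennreal_mult[symmetric] flip: ennreal_1)
  qed
  then show ?thesis
    unfolding angular_law_def Z sphere_unif_def using meas'
    by (subst density_density_eq) auto
qed

section \<open>Gegenbauer polynomials\<close>

text \<open>Writing the degree as \<open>n + 2 * j\<close> builds the parity condition into the
  index, and the quotient of Gamma values becomes a Pochhammer symbol, to which recursions
  apply.\<close>

lemma coeff_gegenbauer: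
  assumes "\<nu> > 0"
  shows "coeff (gegenbauer \<nu> (n + 2 * j)) n = (- 1) ^ j * 2 ^ n * pochhammer \<nu> (n + j) / (fact j * fact n)"
    and "(\<And>j. k \<noteq> n + 2 * j) \<Longrightarrow> coeff (gegenbauer \<nu> k) n = 0"
proof -
  have "\<nu> \<notin> \<int>\<^sub>\<le>\<^sub>0"
    using assms by (auto elim!: nonpos_Ints_cases)
  let ?c = "\<lambda>k j. (-1) ^ j * (2 ^ (k - 2 * j) * Gamma (real k - real j + \<nu>)) / (Gamma \<nu> * fact j * fact (k - 2 * j))"
  have coeff: "coeff (gegenbauer \<nu> k) n = (\<Sum>j=0..k div 2. if k - 2 * j = n then ?c k j else 0)" for k
    using assms unfolding gegenbauer_def by (simp add: coeff_sum)
  have "coeff (gegenbauer \<nu> (n + 2 * j)) n = (\<Sum>i=0..(n + 2 * j) div 2. if i = j then ?c (n + 2 * j) j else 0)"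
    unfolding coeff by (intro sum.cong) auto
  also have "\<dots> = ?c (n + 2 * j) j"
    by simp
  also have "\<dots> = (- 1) ^ j * 2 ^ n * pochhammer \<nu> (n + j) / (fact j * fact n)"
    unfolding pochhammer_Gamma[OF \<open>\<nu> \<notin> \<int>\<^sub>\<le>\<^sub>0\<close>] by (simp add: algebra_simps)
  finally show "coeff (gegenbauer \<nu> (n + 2 * j)) n = (- 1) ^ j * 2 ^ n * pochhammer \<nu> (n + j) / (fact j * fact n)" .
  assume no: "\<And>j. k \<noteq> n + 2 * j"
  show "coeff (gegenbauer \<nu> k) n = 0"
    unfolding coeff
  proof (intro sum.neutral ballI)
    fix j assume "j \<in> {0..k div 2}"
    then have "k - 2 * j \<noteq> n" using no[of j] by auto
    then show "(if k - 2 * j = n then ?c k j else 0) = 0" by simp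
  qed
qed

text \<open>Comparing coefficients leaves a two-term recursion between those of index
  \<open>n\<close> and \<open>n + 2\<close>. For 2 \<nu> = p - 2 the eigenvalue k (k + p - 2) is
  that of the spherical Laplacian on harmonics of degree k.\<close>

lemma gegenbauer_ODE_pos:
  assumes "\<nu> > 0"
  shows "[:1, 0, -1:] * pderiv (pderiv (gegenbauer \<nu> k)) - smult (2 * \<nu> + 1) ([:0, 1:] * pderiv (gegenbauer \<nu> k))
    = smult (- (real k * (real k + 2 * \<nu>))) (gegenbauer \<nu> k)"
proof (rule poly_eqI)
  fix n
  let ?c = "coeff (gegenbauer \<nu> k)"
  have X: "coeff ([:0, 1:] * pderiv q) n = real n * coeff q n" for q :: "real poly"
    by (cases n) (simp_all add: coeff_pderiv)
  have "[:1, 0, -1:] * pderiv (pderiv q) = pderiv (pderiv q) - [:0, 1:] * ([:0, 1:] * pderiv (pderiv q))"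
    for q :: "real poly" by (simp add: algebra_simps)
  then have XX: "coeff ([:1, 0, -1:] * pderiv (pderiv q)) n
      = (real n + 2) * (real n + 1) * coeff q (n + 2) - real n * (real n - 1) * coeff q n" for q :: "real poly"
    by (cases n; cases "n - 1") (simp_all add: coeff_pderiv algebra_simps)
  have "(real n + 2) * (real n + 1) * ?c (n + 2)
      = (real n * (real n - 1) + (2 * \<nu> + 1) * real n - real k * (real k + 2 * \<nu>)) * ?c n"
  proof (cases "\<exists>j. k = n + 2 * j")
    case True
    then obtain j where k: "k = n + 2 * j" by blast
    show ?thesis
    proof (cases j)
      case 0
      then have "?c (n + 2) = 0"
        using coeff_gegenbauer(2)[OF assms, of k "n + 2"] k by auto
      with k 0 show ?thesis by (simp add: algebra_simps)
    next
      case (Suc i)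
      \<comment> \<open>The common part of two consecutive coefficients: (n + 2)(n + 1) times the
        upper one is 4 (\<nu> + n + i + 1) \<open>w\<close>, and (i + 1) times the lower one is
        -\<open>w\<close>.\<close>
      define w where "w = (- 1) ^ i * 2 ^ n * pochhammer \<nu> (n + i + 1) / (fact i * fact n :: real)"
      have k2: "k = (n + 2) + 2 * i" using k Suc by simp
      have c2: "?c (n + 2) = (- 1) ^ i * 2 ^ (n + 2) * pochhammer \<nu> (n + 2 + i) / (fact i * fact (n + 2))"
        unfolding k2 by (rule coeff_gegenbauer(1)[OF assms])
      have f: "fact (n + 2) = (real n + 2) * (real n + 1) * fact n"
        by (simp add: algebra_simps)
      have p: "pochhammer \<nu> (n + 2 + i) = pochhammer \<nu> (n + i + 1) * (\<nu> + real n + real i + 1)"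
        using pochhammer_Suc[of \<nu> "n + i + 1"] by (simp add: algebra_simps)
      have "(real n + 2) * (real n + 1) * ?c (n + 2) = 4 * (\<nu> + real n + real i + 1) * w"
      proof -
        have "A * (s * 2 ^ (n + 2) * (P * q) / (a * (A * b))) = 4 * q * (s * 2 ^ n * P / (a * b))"
          if "A \<noteq> 0" for A s P q a b :: real
          using that by (simp add: field_simps)
        moreover have "(real n + 2) * (real n + 1) \<noteq> 0"
          by (simp add: add_nonneg_eq_0_iff)
        ultimately show ?thesis
          unfolding c2 f p w_def by blast
      qed
      moreover have "?c n = (- 1) ^ Suc i * 2 ^ n * pochhammer \<nu> (n + Suc i) / (fact (Suc i) * fact n)"
        unfolding k Suc by (rule coeff_gegenbauer(1)[OF assms])
      then have "?c n = (- 1) ^ Suc i * 2 ^ n * pochhammer \<nu> (n + i + 1) / ((real i + 1) * fact i * fact n)"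
        by (simp add: add.commute)
      then have "(real i + 1) * ?c n = - w"
        unfolding w_def by simp
      moreover have "real n * (real n - 1) + (2 * \<nu> + 1) * real n - real k * (real k + 2 * \<nu>)
          = - (4 * (\<nu> + real n + real i + 1) * (real i + 1))"
        unfolding k2 by (simp add: algebra_simps power2_eq_square)
      ultimately show ?thesis by (simp add: mult.assoc)
    qed
  next
    case False
    then have "k \<noteq> n + 2 + 2 * j" for j
      by (metis ab_semigroup_add_class.add_ac(1) distrib_left mult.right_neutral)
    then show ?thesis
      using coeff_gegenbauer(2)[OF assms, of k n] coeff_gegenbauer(2)[OF assms, of k "n + 2"] False by auto
  qed
  then show "coeff ([:1, 0, -1:] * pderiv (pderiv (gegenbauer \<nu> k)) - smult (2 * \<nu> + 1) ([:0, 1:] * pderiv (gegenbauer \<nu> k))) n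
    = coeff (smult (- (real k * (real k + 2 * \<nu>))) (gegenbauer \<nu> k)) n"
    unfolding coeff_diff coeff_smult XX X by (simp add: algebra_simps)
qed

text \<open>Differentiating the relation with cos (k \<theta>) twice in \<theta> gives the equation
  at every point cos \<theta>; these fill an infinite set, so it holds between polynomials.\<close>

lemma chebyshev_ODE:
  "[:1, 0, -1:] * pderiv (pderiv (chebyshev k)) - [:0, 1:] * pderiv (chebyshev k)
    = smult (- ((real k)\<^sup>2)) (chebyshev k)"
proof -
  let ?P = "chebyshev k"
  let ?R = "[:1, 0, -1:] * pderiv (pderiv ?P) - [:0, 1:] * pderiv ?P - smult (- ((real k)\<^sup>2)) ?P"
  have d1: "poly (pderiv ?P) (cos \<theta>) * sin \<theta> = real k * sin (real k * \<theta>)" for \<theta>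
  proof -
    have "((\<lambda>\<theta>. poly ?P (cos \<theta>)) has_real_derivative poly (pderiv ?P) (cos \<theta>) * (- sin \<theta>)) (at \<theta>)"
      by (auto intro!: derivative_eq_intros)
    moreover have "((\<lambda>\<theta>. cos (real k * \<theta>)) has_real_derivative - sin (real k * \<theta>) * real k) (at \<theta>)"
      by (auto intro!: derivative_eq_intros)
    ultimately have "poly (pderiv ?P) (cos \<theta>) * (- sin \<theta>) = - sin (real k * \<theta>) * real k"
      unfolding chebyshev_cos by (rule DERIV_unique)
    then show ?thesis by (simp add: mult.commute)
  qed
  have "poly ?R (cos \<theta>) = 0" for \<theta>
  proof -
    have "((\<lambda>\<theta>. poly (pderiv ?P) (cos \<theta>) * sin \<theta>) has_real_derivative
        poly (pderiv (pderiv ?P)) (cos \<theta>) * (- sin \<theta>) * sin \<theta> + poly (pderiv ?P) (cos \<theta>) * cos \<theta>) (at \<theta>)"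
      by (auto intro!: derivative_eq_intros)
    moreover have "((\<lambda>\<theta>. real k * sin (real k * \<theta>)) has_real_derivative real k * (cos (real k * \<theta>) * real k)) (at \<theta>)"
      by (auto intro!: derivative_eq_intros)
    ultimately have "poly (pderiv (pderiv ?P)) (cos \<theta>) * (- sin \<theta>) * sin \<theta> + poly (pderiv ?P) (cos \<theta>) * cos \<theta>
        = real k * (poly ?P (cos \<theta>) * real k)"
      unfolding d1 chebyshev_cos by (rule DERIV_unique)
    moreover have "cos \<theta> * (cos \<theta> * poly (pderiv (pderiv ?P)) (cos \<theta>))
        + sin \<theta> * (sin \<theta> * poly (pderiv (pderiv ?P)) (cos \<theta>)) = poly (pderiv (pderiv ?P)) (cos \<theta>)"
      using arg_cong[OF sin_cos_squared_add3[of \<theta>], of "\<lambda>r. r * poly (pderiv (pderiv ?P)) (cos \<theta>)"]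
      by (simp only: distrib_right mult.assoc mult_1_left)
    ultimately show ?thesis
      by (simp add: algebra_simps power2_eq_square)
  qed
  then have "{-1..1} \<subseteq> {x. poly ?R x = 0}"
    by (metis (mono_tags, lifting) atLeastAtMost_iff cos_arccos mem_Collect_eq subsetI)
  moreover have "infinite {-1..(1::real)}"
    by simp
  ultimately have "?R = 0"
    using poly_roots_finite[of ?R] finite_subset by blast
  then show ?thesis unfolding right_minus_eq .
qed

lemma gegenbauer_ODE:
  assumes "\<nu> \<ge> 0"
  shows "[:1, 0, -1:] * pderiv (pderiv (gegenbauer \<nu> k)) - smult (2 * \<nu> + 1) ([:0, 1:] * pderiv (gegenbauer \<nu> k))
    = smult (- (real k * (real k + 2 * \<nu>))) (gegenbauer \<nu> k)"
proof (cases "\<nu> = 0")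
  case True
  then show ?thesis
    using chebyshev_ODE[of k] by (simp add: gegenbauer_def power2_eq_square)
qed (use assms gegenbauer_ODE_pos in simp)

lemma gegenbauer_rec:
  assumes "\<nu> > 0"
  shows "smult (real k + 2) (gegenbauer \<nu> (k + 2))
    = smult (2 * (real k + 1 + \<nu>)) ([:0, 1:] * gegenbauer \<nu> (k + 1)) - smult (real k + 2 * \<nu>) (gegenbauer \<nu> k)"
proof (rule poly_eqI)
  fix n
  let ?c = "\<lambda>k. coeff (gegenbauer \<nu> k)"
  let ?d = "if n = 0 then 0 else ?c (k + 1) (n - 1)"
  have "(real k + 2) * ?c (k + 2) n = 2 * (real k + 1 + \<nu>) * ?d - (real k + 2 * \<nu>) * ?c k n"
  proof (cases "\<exists>j. k + 2 = n + 2 * j")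
    case True
    then obtain j where k: "k + 2 = n + 2 * j" by blast
    \<comment> \<open>All three coefficients are multiples of \<open>w\<close>, with factors \<nu> +
      n + j - 1, n / 2 and -j for the degrees k + 2, k + 1 and k. The subtraction in
      \<open>n + j - 1\<close> is exact because \<open>n + 2 * j \<ge> 2\<close>.\<close>
    define w where "w = (- 1) ^ j * 2 ^ n * pochhammer \<nu> (n + j - 1) / (fact j * fact n :: real)"
    define m where "m = n + j - 1"
    have m: "n + j = Suc m" "real m = real n + real j - 1" using k by (auto simp: m_def)
    have p: "pochhammer \<nu> (n + j) = pochhammer \<nu> (n + j - 1) * (\<nu> + real n + real j - 1)"
      unfolding m_def[symmetric] unfolding m(1) pochhammer_Suc m(2) by simp
    have "?c (k + 2) n = (\<nu> + real n + real j - 1) * w"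
      unfolding k coeff_gegenbauer(1)[OF assms] p w_def by simp
    moreover have "2 * ?d = real n * w"
    proof (cases n)
      case (Suc m)
      then have "k + 1 = m + 2 * j" using k by simp
      then have "?c (k + 1) m = (- 1) ^ j * 2 ^ m * pochhammer \<nu> (m + j) / (fact j * fact m)"
        by (simp only: coeff_gegenbauer(1)[OF assms])
      moreover have "A * ((- 1) ^ j * (2 * 2 ^ m) * P / (a * (A * b))) = 2 * ((- 1) ^ j * 2 ^ m * P / (a * b))"
        if "A \<noteq> 0" for A P a b :: real
        using that by simp
      from this[of "real n" "pochhammer \<nu> (m + j)" "fact j" "fact m"]
      have "real n * w = 2 * ((- 1) ^ j * 2 ^ m * pochhammer \<nu> (m + j) / (fact j * fact m))"
        unfolding w_def using Suc by (simp only: fact_Suc power_Suc) simp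
      ultimately show ?thesis using Suc by simp
    qed simp
    moreover have "?c k n = - (real j * w)"
    proof (cases j)
      case 0
      then have "k \<noteq> n + 2 * i" for i using k by simp
      with 0 show ?thesis using coeff_gegenbauer(2)[OF assms, of k n] by simp
    next
      case (Suc i)
      then have "k = n + 2 * i" using k by simp
      then have "?c k n = (- 1) ^ i * 2 ^ n * pochhammer \<nu> (n + i) / (fact i * fact n)"
        by (simp only: coeff_gegenbauer(1)[OF assms])
      moreover have "A * (- s * P / (A * a * b)) = - (s * P / (a * b))" if "A \<noteq> 0" for A s P a b :: real
        using that by simp
      from this[of "real j" "(- 1) ^ i * 2 ^ n" "pochhammer \<nu> (n + i)" "fact i" "fact n"]
      have "real j * w = - ((- 1) ^ i * 2 ^ n * pochhammer \<nu> (n + i) / (fact i * fact n))"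
        unfolding w_def using Suc by (simp only: fact_Suc power_Suc) simp
      ultimately show ?thesis by simp
    qed
    moreover have "real k = real n + 2 * real j - 2"
      using k by linarith
    ultimately show ?thesis
      by (simp only: mult.assoc mult.left_commute[of 2]) (simp add: algebra_simps)
  next
    case False
    then have "k + 2 \<noteq> n + 2 * j" for j by blast
    moreover have "k \<noteq> n + 2 * j" for j
      using False by (auto dest: spec[of _ "j + 1"])
    moreover have "k + 1 \<noteq> n - 1 + 2 * j" if "n \<noteq> 0" for j
      using False that by auto
    ultimately show ?thesis
      using coeff_gegenbauer(2)[OF assms, of "k + 2" n] coeff_gegenbauer(2)[OF assms, of k n]
        coeff_gegenbauer(2)[OF assms, of "k + 1" "n - 1"] by simp
  qed
  then show "coeff (smult (real k + 2) (gegenbauer \<nu> (k + 2))) n = coeff (smult (2 * (real k + 1 + \<nu>)) ([:0, 1:] * gegenbauer \<nu> (k + 1)) - smult (real k + 2 * \<nu>) (gegenbauer \<nu> k)) n"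
    by (cases n) simp_all
qed

lemma gegenbauer_0 [simp]: "\<nu> \<ge> 0 \<Longrightarrow> gegenbauer \<nu> 0 = 1"
  using Gamma_real_pos[of \<nu>] by (cases "\<nu> > 0") (auto simp: gegenbauer_def monom_0 one_pCons less_imp_neq[symmetric])

lemma gegenbauer_1: "\<nu> > 0 \<Longrightarrow> gegenbauer \<nu> (Suc 0) = [:0, 2 * \<nu>:]"
proof -
  assume "\<nu> > 0"
  then have "Gamma (1 + \<nu>) = \<nu> * Gamma \<nu>"
    using Gamma_plus1[of \<nu>] by (simp add: add.commute nonpos_Ints_def)
  with \<open>\<nu> > 0\<close> show ?thesis
    using Gamma_real_pos[of \<nu>] by (simp add: gegenbauer_def monom_altdef less_imp_neq[symmetric])
qed

lemma gegenbauer_at_1: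
  assumes "\<nu> > 0"
  shows "poly (gegenbauer \<nu> k) 1 = pochhammer (2 * \<nu>) k / fact k"
\<comment> \<open>The rule \<open>chebyshev.induct\<close> serves only as an induction with step
  two, matching the three-term recurrence.\<close>
proof (induction k rule: chebyshev.induct)
  case (3 k)
  have "(real k + 2) * poly (gegenbauer \<nu> (k + 2)) 1
      = 2 * (real k + 1 + \<nu>) * (pochhammer (2 * \<nu>) (Suc k) / fact (Suc k))
        - (real k + 2 * \<nu>) * (pochhammer (2 * \<nu>) k / fact k)"
    using arg_cong[OF gegenbauer_rec[OF assms, of k], of "\<lambda>q. poly q 1"] 3 by simp
  also have "\<dots> = (real k + 2) * (pochhammer (2 * \<nu>) (Suc (Suc k)) / fact (Suc (Suc k)))"
    by (simp add: pochhammer_Suc divide_simps) (simp add: algebra_simps)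
  finally have "poly (gegenbauer \<nu> (k + 2)) 1 = pochhammer (2 * \<nu>) (Suc (Suc k)) / fact (Suc (Suc k))"
    by (subst (asm) mult_left_cancel) auto
  then show ?case by simp
qed (use assms gegenbauer_1 in auto)

text \<open>The ratio of \<open>h_fun\<close> to the Gegenbauer polynomial, since 1 + 2 k / (p - 2)
  = (k + \<nu>) / \<nu> for \<nu> = (p - 2) / 2. The value 2 at \<nu> = 0 is the planar
  normalisation for degrees \<open>k \<ge> 1\<close>.\<close>

definition zonal_factor :: "real \<Rightarrow> nat \<Rightarrow> real" where
  "zonal_factor \<nu> k = (if \<nu> = 0 then 2 else (real k + \<nu>) / \<nu>)"

text \<open>
  \<open>L\<close> stands for the integral over the sphere of a polynomial in one coordinate; the last
  assumption is integration by parts against the density proportional to \<open>(1 - t\<^sup>2)\<close> to the power \<open>\<nu> - 1/2\<close>.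
\<close>

locale axial_functional =
  fixes L :: "real poly \<Rightarrow> real" and \<nu> :: real
  assumes \<nu>: "0 \<le> \<nu>"
    and L_add: "\<And>q r. L (q + r) = L q + L r"
    and L_smult: "\<And>c q. L (smult c q) = c * L q"
    and L_1: "L 1 = 1"
    and L_parts: "\<And>q. L ([:1, 0, -1:] * pderiv q) = (2 * \<nu> + 1) * L ([:0, 1:] * q)"
begin

lemma L_diff: "L (q - r) = L q - L r"
  using L_add[of "q - r" r] by simp

lemma L_0: "L 0 = 0"
  using L_add[of 0 0] by simp

lemma L_sum: "L (\<Sum>i\<in>A. g i) = (\<Sum>i\<in>A. L (g i))"
  by (induction A rule: infinite_finite_induct) (simp_all add: L_0 L_add)

text \<open>Green's formula: the right-hand side is symmetric in \<open>a\<close> and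
  \<open>b\<close>, so the Gegenbauer operator is symmetric for the bilinear form given by
  \<open>L\<close>.\<close>

lemma L_ODE_sym:
  "L (([:1, 0, -1:] * pderiv (pderiv a) - smult (2 * \<nu> + 1) ([:0, 1:] * pderiv a)) * b)
    = - L ([:1, 0, -1:] * (pderiv a * pderiv b))"
proof -
  have "([:1, 0, -1:] * pderiv (pderiv a) - smult (2 * \<nu> + 1) ([:0, 1:] * pderiv a)) * b
      = [:1, 0, -1:] * pderiv (pderiv a * b) - [:1, 0, -1:] * (pderiv a * pderiv b)
        - smult (2 * \<nu> + 1) ([:0, 1:] * (pderiv a * b))"
    by (simp only: pderiv_mult left_diff_distrib mult_smult_left) (simp only: algebra_simps)
  then show ?thesis
    by (simp only: L_diff L_smult L_parts)
qed

text \<open>Eigenvectors of a symmetric operator for distinct eigenvalues; their difference is (i -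
  j)(i + j + 2 \<nu>).\<close>

lemma L_gegenbauer_orthogonal:
  assumes "i \<noteq> j"
  shows "L (gegenbauer \<nu> i * gegenbauer \<nu> j) = 0"
proof -
  have "- (real i * (real i + 2 * \<nu>)) * L (gegenbauer \<nu> i * gegenbauer \<nu> j)
      = - L ([:1, 0, -1:] * (pderiv (gegenbauer \<nu> i) * pderiv (gegenbauer \<nu> j)))" for i j
    using L_ODE_sym[of "gegenbauer \<nu> i" "gegenbauer \<nu> j"]
    unfolding gegenbauer_ODE[OF \<nu>] mult_smult_left L_smult .
  from this[of i j] this[of j i]
  have "(real i * (real i + 2 * \<nu>) - real j * (real j + 2 * \<nu>)) * L (gegenbauer \<nu> i * gegenbauer \<nu> j) = 0"
    by (simp add: algebra_simps)
  moreover have "real i * (real i + 2 * \<nu>) - real j * (real j + 2 * \<nu>) = (real i - real j) * (real i + real j + 2 * \<nu>)"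
    by (simp add: algebra_simps)
  moreover have "real i + real j + 2 * \<nu> > 0"
    using assms \<nu> by (cases i; cases j) auto
  ultimately show ?thesis
    using assms by simp
qed

lemma L_X_sq: "L ([:0, 1:] * [:0, 1:]) = 1 / (2 * \<nu> + 2)"
proof -
  have "[:1, 0, -1:] * pderiv [:0, 1:] = 1 - [:0, 1:] * [:0, 1::real:]"
    by (simp add: pderiv_pCons one_pCons)
  then have "1 - L ([:0, 1:] * [:0, 1:]) = (2 * \<nu> + 1) * L ([:0, 1:] * [:0, 1:])"
    using L_parts[of "[:0, 1:]"] by (simp only: L_diff L_1)
  then show ?thesis
    using \<nu> by (simp add: field_simps)
qed

text \<open>The value of \<open>L\<close> at t C_{k+1} C_{k+2} is computed twice, from the
  recurrences at \<open>k\<close> and at \<open>k + 1\<close>; orthogonality leaves one square in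
  each. Abstract coefficients \<open>a\<close>, \<open>b\<close>, \<open>e\<close> cover the
  Chebyshev and the Gegenbauer recurrence together.\<close>

lemma L_norm_step:
  assumes rec: "\<And>k. smult (a k) (gegenbauer \<nu> (k + 2)) = smult (b k) ([:0, 1:] * gegenbauer \<nu> (k + 1)) - smult (e k) (gegenbauer \<nu> k)"
  shows "a k * b (k + 1) * L (gegenbauer \<nu> (k + 2) * gegenbauer \<nu> (k + 2))
    = b k * e (k + 1) * L (gegenbauer \<nu> (k + 1) * gegenbauer \<nu> (k + 1))"
proof -
  let ?G = "gegenbauer \<nu>"
  have L_rec: "a k * L (?G (k + 2) * q) = b k * L ([:0, 1:] * ?G (k + 1) * q) - e k * L (?G k * q)" for k q
    using arg_cong[OF rec[of k], of "\<lambda>r. L (r * q)"] unfolding left_diff_distrib mult_smult_left L_diff L_smult .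
  define x where "x = L ([:0, 1:] * ?G (k + 1) * ?G (k + 2))"
  have x: "L ([:0, 1:] * ?G (k + 2) * ?G (k + 1)) = x"
    unfolding x_def by (simp only: mult_ac)
  have 1: "a k * L (?G (k + 2) * ?G (k + 2)) = b k * x"
    using L_rec[of k "?G (k + 2)"] L_gegenbauer_orthogonal[of k "k + 2"] unfolding x_def by simp
  have "k + 1 + 2 \<noteq> k + 1" "k + 1 + 1 = k + 2"
    by simp_all
  then have 2: "b (k + 1) * x = e (k + 1) * L (?G (k + 1) * ?G (k + 1))"
    using L_rec[of "k + 1" "?G (k + 1)"] L_gegenbauer_orthogonal[of "k + 1 + 2" "k + 1"] x by simp
  have "a k * b (k + 1) * L (?G (k + 2) * ?G (k + 2)) = b (k + 1) * (a k * L (?G (k + 2) * ?G (k + 2)))"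
    by simp
  also have "\<dots> = b k * (b (k + 1) * x)"
    unfolding 1 by simp
  finally show ?thesis
    unfolding 2 by simp
qed

text \<open>This identity is what makes convolution of \<open>h_fun\<close> with itself idempotent.
  Both sides obey the same first-order recursion from degree 1. It fails at \<open>k = 0\<close> for
  \<nu> = 0, where \<open>zonal_factor\<close> is 2.\<close>

lemma L_gegenbauer_norm:
  assumes "k \<ge> 1"
  shows "zonal_factor \<nu> k * L (gegenbauer \<nu> k * gegenbauer \<nu> k) = poly (gegenbauer \<nu> k) 1"
  using assms
proof (induction k rule: dec_induct)
  case base
  show ?case
  proof (cases "\<nu> = 0")
    case True
    then have "gegenbauer \<nu> 1 = [:0, 1:]" "zonal_factor \<nu> 1 = 2"
      by (simp_all add: gegenbauer_def zonal_factor_def)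
    with True show ?thesis by (simp only: L_X_sq) simp
  next
    case False
    then have "gegenbauer \<nu> 1 * gegenbauer \<nu> 1 = smult (4 * \<nu>\<^sup>2) ([:0, 1:] * [:0, 1:])"
      using \<nu> by (simp add: gegenbauer_1 power2_eq_square)
    moreover have "(1 + \<nu>) * (4 * \<nu>) / (2 * \<nu> + 2) = 2 * \<nu>"
      using \<nu> by (simp add: divide_eq_eq algebra_simps)
    ultimately show ?thesis
      using False \<nu> by (simp only: L_smult L_X_sq) (simp add: gegenbauer_1 zonal_factor_def power2_eq_square)
  qed
next
  case (step n)
  then obtain k where n: "n = k + 1" by (metis add.commute le_Suc_ex)
  let ?N = "\<lambda>k. L (gegenbauer \<nu> k * gegenbauer \<nu> k)"
  show ?case
  proof (cases "\<nu> = 0")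
    case True
    have "2 * ?N (k + 2) = 2 * ?N (k + 1)"
      using L_norm_step[of "\<lambda>_. 1" "\<lambda>_. 2" "\<lambda>_. 1" k] True by (simp add: gegenbauer_def)
    moreover have "poly (chebyshev i) 1 = 1" for i
      using chebyshev_cos[of i 0] by simp
    ultimately show ?thesis
      using step.IH True unfolding n by (simp add: gegenbauer_def zonal_factor_def)
  next
    case False
    then have "\<nu> > 0" using \<nu> by simp
    have 1: "(real k + 2) * (2 * (real k + 2 + \<nu>)) * ?N (k + 2) = 2 * (real k + 1 + \<nu>) * (real k + 1 + 2 * \<nu>) * ?N (k + 1)"
      using L_norm_step[OF gegenbauer_rec[OF \<open>\<nu> > 0\<close>], of k] by (simp add: algebra_simps)
    have 2: "(real k + 1 + \<nu>) * ?N (k + 1) = \<nu> * (pochhammer (2 * \<nu>) (k + 1) / fact (k + 1))"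
      using step.IH False unfolding n gegenbauer_at_1[OF \<open>\<nu> > 0\<close>]
      by (simp add: zonal_factor_def field_simps del: fact_Suc)
    have "(real k + 2) * ((real k + 2 + \<nu>) * ?N (k + 2)) = (real k + 1 + 2 * \<nu>) * ((real k + 1 + \<nu>) * ?N (k + 1))"
      using 1 by (simp add: algebra_simps)
    also have "\<dots> = (real k + 2) * (\<nu> * (pochhammer (2 * \<nu>) (k + 2) / fact (k + 2)))"
      unfolding 2 by (simp add: pochhammer_Suc divide_simps) (simp add: algebra_simps)
    finally have "(real k + 2 + \<nu>) * ?N (k + 2) = \<nu> * (pochhammer (2 * \<nu>) (k + 2) / fact (k + 2))"
      by (subst (asm) mult_left_cancel) auto
    then show ?thesis
      using False unfolding n gegenbauer_at_1[OF \<open>\<nu> > 0\<close>]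
      by (simp add: zonal_factor_def field_simps del: fact_Suc)
  qed
qed

end

section \<open>Zonal convolution\<close>

lemma measurable_sphere_unif_ident [measurable]:
  "(\<lambda>x. x) \<in> (sphere_unif :: (real ^ 'p::{finite,wellorder}) measure) \<rightarrow>\<^sub>M borel"
  by (simp add: measurable_restrict_space1 measurable_cong_sets[OF sets_sphere_unif refl])

lemma sphere_unif_continuous_integrable:
  fixes g :: "real ^ 'p::{finite,wellorder} \<Rightarrow> real"
  assumes "continuous_on UNIV g"
  shows "integrable sphere_unif g"
proof -
  have "compact (g ` sphere 0 1)"
    using assms by (intro compact_continuous_image) (auto intro: continuous_on_subset)
  then obtain B where B: "\<forall>y\<in>g ` sphere 0 1. \<bar>y\<bar> \<le> B"
    using compact_imp_bounded bounded_real by metis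
  then show ?thesis
    using assms by (intro sphere_unif_integrable[where B = B]) (auto intro!: sphere_unif_measurableI borel_measurable_continuous_onI)
qed

lemma sphere_inner_bound:
  assumes "norm u = 1" "norm w = 1" shows "\<bar>u \<bullet> w\<bar> \<le> 1"
  using Cauchy_Schwarz_ineq2[of u w] assms by simp

lemma poly_bounded_Icc: "\<exists>B. \<forall>t::real. \<bar>t\<bar> \<le> 1 \<longrightarrow> \<bar>poly q t\<bar> \<le> B"
proof -
  have "compact (poly q ` {-1..1})"
    by (intro compact_continuous_image continuous_intros) auto
  then obtain B where B: "\<forall>y\<in>poly q ` {-1..1}. \<bar>y\<bar> \<le> B"
    using compact_imp_bounded bounded_real by metis
  then show ?thesis
    by (auto simp: abs_le_iff intro!: exI[of _ B])
qed

lemma integral_sphere_unif_pair_power: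
  fixes u w u' w' :: "real ^ 'p::{finite,wellorder}"
  assumes "norm u = norm u'" "norm w = norm w'" "u \<bullet> w = u' \<bullet> w'"
  shows "(\<integral>x. poly q (u \<bullet> x) * poly r (w \<bullet> x) \<partial>sphere_unif) = (\<integral>x. poly q (u' \<bullet> x) * poly r (w' \<bullet> x) \<partial>sphere_unif)"
  using assms
  by (intro integral_sphere_unif_pair[where F = "\<lambda>z. poly q (fst z) * poly r (snd z)", simplified])
    (auto intro!: borel_measurable_continuous_onI continuous_intros)

text \<open>For orthogonal \<open>u\<close> and \<open>w\<close> the pairs \<open>(u, w)\<close> and
  \<open>(u, - w)\<close> have the same Gram matrix, so the integral equals its own
  negative.\<close>

lemma integral_sphere_unif_odd:
  fixes u w :: "real ^ 'p::{finite,wellorder}"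
  assumes "u \<bullet> w = 0" "odd r"
  shows "(\<integral>x. poly q (u \<bullet> x) * (w \<bullet> x) ^ r \<partial>sphere_unif) = 0"
proof -
  have "(\<integral>x. poly q (u \<bullet> x) * poly (monom 1 r) (w \<bullet> x) \<partial>sphere_unif)
      = (\<integral>x. poly q (u \<bullet> x) * poly (monom 1 r) ((- w) \<bullet> x) \<partial>sphere_unif)"
    using assms by (intro integral_sphere_unif_pair_power) auto
  then show ?thesis
    using assms(2) by (simp add: poly_monom)
qed

text \<open>Rotation in the plane of \<open>u\<close> and \<open>w\<close>: the derivative at angle \<open>0\<close> of a vanishing integral.\<close>

lemma sphere_moment_rotation:
  fixes u w :: "real ^ 'p::{finite,wellorder}"
  assumes "u \<bullet> w = 0" "norm u = norm w"
  shows "(real m + 1) * (\<integral>x. (u \<bullet> x) ^ m * (w \<bullet> x)\<^sup>2 \<partial>sphere_unif) = (\<integral>x. (u \<bullet> x) ^ (m + 2) \<partial>sphere_unif)"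
proof -
  let ?s = "\<lambda>b r x. real ((m + 1) choose r) * b ^ r * ((u \<bullet> x) ^ (m + 1 - r) * (w \<bullet> x) ^ (r + 1))
        - real ((m + 1) choose r) * b ^ (r + 1) * ((u \<bullet> x) ^ (m + 2 - r) * (w \<bullet> x) ^ r)"
  define M where "M i j = (\<integral>x. (u \<bullet> x) ^ i * (w \<bullet> x) ^ j \<partial>sphere_unif)" for i j
  have int: "integrable sphere_unif (\<lambda>x. (u \<bullet> x) ^ i * (w \<bullet> x) ^ j)" for i j
    by (intro sphere_unif_continuous_integrable continuous_intros)
  \<comment> \<open>\<open>P\<close> expands in \<open>b\<close> the integral of the
    \<open>m + 1\<close>-st power of (u + b w) . x times (w - b u) . x. The two vectors stay
    orthogonal for all \<open>b\<close>, so \<open>P\<close> vanishes identically. Its coefficient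
    of \<open>b\<close> is the claim; the polynomial form replaces differentiation under the
    integral.\<close>
  define P where "P = (\<Sum>r\<le>m + 1. monom (real ((m + 1) choose r) * M (m + 1 - r) (r + 1)) r
      - monom (real ((m + 1) choose r) * M (m + 2 - r) r) (r + 1))"
  have "poly P b = 0" for b
  proof -
    have "(u + b *\<^sub>R w) \<bullet> (w - b *\<^sub>R u) = 0"
    proof -
      have "(u + b *\<^sub>R w) \<bullet> (w - b *\<^sub>R u) = u \<bullet> w - b * (u \<bullet> u) + b * (w \<bullet> w) - b * b * (u \<bullet> w)"
        by (simp add: inner_add_left inner_diff_right inner_commute[of w u] algebra_simps)
      then show ?thesis using assms by (simp add: norm_eq)
    qed
    from integral_sphere_unif_odd[OF this, of 1 "monom 1 (m + 1)"]
    have "0 = (\<integral>x. (u \<bullet> x + b * (w \<bullet> x)) ^ (m + 1) * (w \<bullet> x - b * (u \<bullet> x)) \<partial>sphere_unif)"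
      by (simp add: poly_monom inner_add_left inner_diff_left)
    also have "\<dots> = (\<integral>x. (\<Sum>r\<le>m + 1. ?s b r x) \<partial>sphere_unif)"
    proof (rule Bochner_Integration.integral_cong)
      fix x :: "real ^ 'p::_"
      have "(u \<bullet> x + b * (w \<bullet> x)) ^ (m + 1) = (\<Sum>r\<le>m + 1. real ((m + 1) choose r) * (b * (w \<bullet> x)) ^ r * (u \<bullet> x) ^ (m + 1 - r))"
        using binomial_ring[of "b * (w \<bullet> x)" "u \<bullet> x" "m + 1"] by (simp add: add.commute)
      then have "(u \<bullet> x + b * (w \<bullet> x)) ^ (m + 1) * (w \<bullet> x - b * (u \<bullet> x))
          = (\<Sum>r\<le>m + 1. real ((m + 1) choose r) * (b * (w \<bullet> x)) ^ r * (u \<bullet> x) ^ (m + 1 - r) * (w \<bullet> x - b * (u \<bullet> x)))"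
        by (simp only: sum_distrib_right)
      also have "\<dots> = (\<Sum>r\<le>m + 1. ?s b r x)"
      proof (rule sum.cong)
        fix r assume "r \<in> {..m + 1}"
        then have "m + 2 - r = Suc (m + 1 - r)" by auto
        then show "real ((m + 1) choose r) * (b * (w \<bullet> x)) ^ r * (u \<bullet> x) ^ (m + 1 - r) * (w \<bullet> x - b * (u \<bullet> x))
            = ?s b r x"
          by (simp only: power_mult_distrib right_diff_distrib power_Suc Suc_eq_plus1[symmetric]) (simp only: mult_ac)
      qed simp
      finally show "(u \<bullet> x + b * (w \<bullet> x)) ^ (m + 1) * (w \<bullet> x - b * (u \<bullet> x)) = \<dots>" .
    qed simp
    also have "\<dots> = (\<Sum>r\<le>m + 1. real ((m + 1) choose r) * b ^ r * M (m + 1 - r) (r + 1)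
        - real ((m + 1) choose r) * b ^ (r + 1) * M (m + 2 - r) r)"
      unfolding M_def using int
      by (subst Bochner_Integration.integral_sum) (auto intro!: integrable_mult_right integrable_diff simp del: power_Suc)
    also have "\<dots> = poly P b"
      unfolding P_def poly_sum by (simp add: poly_monom mult_ac)
    finally show ?thesis by simp
  qed
  then have "P = 0"
    by (metis poly_0 poly_eq_poly_eq_iff ext)
  then have "0 = coeff P 1"
    by simp
  also have "\<dots> = (\<Sum>r\<le>m + 1. (if r = 1 then real ((m + 1) choose r) * M (m + 1 - r) (r + 1) else 0)
      - (if r = 0 then real ((m + 1) choose r) * M (m + 2 - r) r else 0))"
    unfolding P_def coeff_sum coeff_diff coeff_monom by (intro sum.cong) auto
  also have "\<dots> = (real m + 1) * M m 2 - M (m + 2) 0"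
    by (simp add: sum_subtractf numeral_2_eq_2)
  finally show ?thesis
    by (simp add: M_def)
qed

text \<open>The type argument carries the dimension, which the type
  \<open>real poly \<Rightarrow> real\<close> of the functional cannot show.\<close>

definition axial_mean :: "'p::{finite,wellorder} itself \<Rightarrow> real poly \<Rightarrow> real" where
  "axial_mean _ q = (\<integral>x. poly q (theta0 \<bullet> x) \<partial>(sphere_unif :: (real ^ 'p::_) measure))"

lemma axial_mean_pair:
  fixes u :: "real ^ 'p::{finite,wellorder}"
  assumes "norm u = 1"
  shows "(\<integral>x. poly q (u \<bullet> x) * poly r (u \<bullet> x) \<partial>sphere_unif) = axial_mean TYPE('p) (q * r)"
  unfolding axial_mean_def poly_mult using assms
  by (intro integral_sphere_unif_pair_power) (auto simp: dot_square_norm)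

text \<open>No density of the axial coordinate is used: integration by parts is checked on
  monomials, where it is a recursion between moments, and extended linearly.\<close>

lemma axial_functional_axial_mean:
  assumes dim: "2 \<le> CARD('p::{finite,wellorder})"
  shows "axial_functional (axial_mean TYPE('p)) ((real CARD('p) - 2) / 2)"
proof
  let ?L = "axial_mean TYPE('p)"
  have int: "integrable (sphere_unif :: (real ^ 'p::_) measure) (\<lambda>x. poly q (theta0 \<bullet> x))" for q
    by (intro sphere_unif_continuous_integrable continuous_intros)
  show "0 \<le> (real CARD('p) - 2) / 2"
    using dim by simp
  show add: "?L (q + r) = ?L q + ?L r" for q r
    unfolding axial_mean_def using int by simp
  show smult: "?L (smult c q) = c * ?L q" for c q
    unfolding axial_mean_def by simp
  show "?L 1 = 1"
    unfolding axial_mean_def by (simp add: sphere_unif.prob_space del: space_sphere_unif)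
  define \<mu> where "\<mu> m = ?L (monom 1 m)" for m
  have \<mu>: "\<mu> m = (\<integral>x. (theta0 \<bullet> x) ^ m \<partial>(sphere_unif :: (real ^ 'p::_) measure))" for m
    by (simp add: \<mu>_def axial_mean_def poly_monom)
  have "\<mu> 1 = 0"
  proof -
    have "(0 :: real ^ 'p::_) \<bullet> theta0 = 0" by simp
    from integral_sphere_unif_odd[OF this, of 1 1] show ?thesis by (simp add: \<mu>)
  qed
  \<comment> \<open>On the sphere the squared coordinates sum to 1. Inserting this sum into the
    moment of order \<open>m\<close>, the axial coordinate gives the moment of order
    \<open>m + 2\<close>, and each of the p - 1 others gives it divided by \<open>m + 1\<close>, by
    the rotation identity.\<close>
  have rec: "(real m + 1) * (\<mu> m - \<mu> (m + 2)) = (real CARD('p) - 1) * \<mu> (m + 2)" for m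
  proof -
    let ?N = "Max UNIV :: 'p"
    have int': "integrable (sphere_unif :: (real ^ 'p::_) measure) (\<lambda>x. (theta0 \<bullet> x) ^ m * (axis i 1 \<bullet> x)\<^sup>2)" for i
      by (intro sphere_unif_continuous_integrable continuous_intros)
    have "\<mu> m = (\<integral>x. (\<Sum>i\<in>UNIV. (theta0 \<bullet> x) ^ m * (axis i 1 \<bullet> x)\<^sup>2) \<partial>(sphere_unif :: (real ^ 'p::_) measure))"
      unfolding \<mu>
    proof (rule Bochner_Integration.integral_cong)
      fix x :: "real ^ 'p::_" assume "x \<in> space sphere_unif"
      then have "x \<bullet> x = 1" by (simp add: dot_square_norm)
      then have "(\<Sum>i\<in>UNIV. x $ i * x $ i) = 1"
        unfolding inner_vec_def by simp
      then have "(\<Sum>i\<in>UNIV. (axis i 1 \<bullet> x)\<^sup>2) = 1"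
        by (simp add: inner_axis' power2_eq_square)
      then show "(theta0 \<bullet> x) ^ m = (\<Sum>i\<in>UNIV. (theta0 \<bullet> x) ^ m * (axis i 1 \<bullet> x)\<^sup>2)"
        by (simp flip: sum_distrib_left)
    qed simp
    also have "\<dots> = (\<Sum>i\<in>UNIV. \<integral>x. (theta0 \<bullet> x) ^ m * (axis i 1 \<bullet> x)\<^sup>2 \<partial>(sphere_unif :: (real ^ 'p::_) measure))"
      using int' by (rule Bochner_Integration.integral_sum)
    also have "\<dots> = \<mu> (m + 2) + (\<Sum>i\<in>UNIV - {?N}. \<mu> (m + 2) / (real m + 1))"
    proof (subst sum.remove[of _ ?N])
      have "(\<integral>x. (theta0 \<bullet> x) ^ m * (axis i 1 \<bullet> x)\<^sup>2 \<partial>(sphere_unif :: (real ^ 'p::_) measure)) = \<mu> (m + 2) / (real m + 1)"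
        if "i \<noteq> ?N" for i
      proof -
        have "theta0 \<bullet> (axis i 1 :: real ^ 'p::_) = 0"
          using that by (simp add: theta0_def inner_axis_axis)
        from sphere_moment_rotation[OF this, of m] show ?thesis by (simp add: \<mu> field_simps)
      qed
      then show "(\<integral>x. (theta0 \<bullet> x) ^ m * (axis ?N 1 \<bullet> x)\<^sup>2 \<partial>(sphere_unif :: (real ^ 'p::_) measure)) +
          (\<Sum>i\<in>UNIV - {?N}. \<integral>x. (theta0 \<bullet> x) ^ m * (axis i 1 \<bullet> x)\<^sup>2 \<partial>(sphere_unif :: (real ^ 'p::_) measure))
          = \<mu> (m + 2) + (\<Sum>i\<in>UNIV - {?N}. \<mu> (m + 2) / (real m + 1))"
        by (simp add: \<mu> power_add power2_eq_square mult_ac flip: theta0_def)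
    qed simp_all
    also have "\<dots> = \<mu> (m + 2) + (real CARD('p) - 1) * (\<mu> (m + 2) / (real m + 1))"
      using dim by (simp add: card_Diff_singleton)
    finally show ?thesis by (simp add: field_simps)
  qed
  have parts_monom: "?L ([:1, 0, -1:] * pderiv (monom 1 m)) = (real CARD('p) - 1) * ?L ([:0, 1:] * monom 1 m)" for m
  proof (cases m)
    case 0
    then show ?thesis
      using \<open>\<mu> 1 = 0\<close> smult[of 0 0] by (simp add: monom_0 pderiv_pCons \<mu>_def monom_Suc)
  next
    case (Suc i)
    have "[:1, 0, -1:] * pderiv (monom 1 m) = smult (real i + 1) (monom 1 i) + smult (- (real i + 1)) (monom 1 (i + 2))"
    proof -
      have "pderiv (monom 1 m) = monom (real i + 1) i"
        using Suc by (simp add: pderiv_monom add.commute)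
      moreover have "[:1, 0, -1:] * monom c i = monom c i + monom (- c) (i + 2)" for c :: real
        by (simp add: monom_Suc minus_monom)
      ultimately show ?thesis by (simp only: smult_monom mult_1_right)
    qed
    moreover have "[:0, 1:] * monom 1 m = (monom 1 (i + 2) :: real poly)"
      using Suc by (simp add: monom_Suc)
    ultimately show ?thesis
      using rec[of i] by (simp only: add smult \<mu>_def) (simp add: algebra_simps)
  qed
  fix q :: "real poly"
  have L_sum: "?L (\<Sum>i\<in>A. g i) = (\<Sum>i\<in>A. ?L (g i))" for A :: "nat set" and g
    using add[of 0 0] by (induction A rule: infinite_finite_induct) (simp_all add: add)
  have pderiv_sum: "pderiv (\<Sum>i\<in>A. g i) = (\<Sum>i\<in>A. pderiv (g i))" for A :: "nat set" and g :: "nat \<Rightarrow> real poly"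
    by (induction A rule: infinite_finite_induct) (simp_all add: pderiv_add)
  have q: "q = (\<Sum>i\<le>degree q. smult (coeff q i) (monom 1 i))"
    by (subst poly_as_sum_of_monoms[symmetric]) (simp add: smult_monom)
  have "?L ([:1, 0, -1:] * pderiv q) = (\<Sum>i\<le>degree q. coeff q i * ?L ([:1, 0, -1:] * pderiv (monom 1 i)))"
    by (subst q) (simp only: pderiv_sum pderiv_smult sum_distrib_left mult_smult_right L_sum smult)
  also have "\<dots> = (real CARD('p) - 1) * (\<Sum>i\<le>degree q. coeff q i * ?L ([:0, 1:] * monom 1 i))"
    unfolding parts_monom sum_distrib_left by (simp add: mult_ac)
  also have "(\<Sum>i\<le>degree q. coeff q i * ?L ([:0, 1:] * monom 1 i)) = ?L ([:0, 1:] * q)"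
    by (subst (3) q) (simp only: sum_distrib_left mult_smult_right L_sum smult)
  also have "real CARD('p) - 1 = 2 * ((real CARD('p) - 2) / 2) + 1"
    by (simp add: field_simps)
  finally show "?L ([:1, 0, -1:] * pderiv q) = (2 * ((real CARD('p) - 2) / 2) + 1) * ?L ([:0, 1:] * q)" .
qed

text \<open>By invariance the pair \<open>u\<close>, \<open>w\<close> may be replaced by \<theta>0
  and t \<theta>0 + s e with t = u . w, s = sqrt (1 - t^2) and \<open>e\<close> a second coordinate
  vector. In the binomial expansion odd powers of s carry vanishing integrals and even ones are
  polynomials in t, so the degree does not grow.\<close>

lemma zonal_convolution_degree:
  fixes \<phi> q :: "real poly"
  assumes dim: "2 \<le> CARD('p::{finite,wellorder})"
  shows "\<exists>Q. degree Q \<le> degree q \<and> (\<forall>u w :: real ^ 'p::_. norm u = 1 \<longrightarrow> norm w = 1 \<longrightarrow>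
    (\<integral>x. poly \<phi> (u \<bullet> x) * poly q (w \<bullet> x) \<partial>sphere_unif) = poly Q (u \<bullet> w))"
proof -
  obtain i :: 'p where "i \<noteq> Max UNIV"
    using dim by (metis UNIV_I card_2_iff' card_le_Suc_iff ex_card insertCI subset_UNIV)
  define e where "e = (axis i 1 :: real ^ 'p::_)"
  have e: "theta0 \<bullet> e = 0" "norm e = 1"
    using \<open>i \<noteq> Max UNIV\<close> by (simp_all add: e_def theta0_def inner_axis_axis)
  define N where "N j r = (\<integral>x. poly \<phi> (theta0 \<bullet> x) * ((theta0 \<bullet> x) ^ r * (e \<bullet> x) ^ (j - r)) \<partial>sphere_unif)" for j r
  define R where "R j = (\<Sum>r\<le>j. if even (j - r)
    then smult (real (j choose r) * N j r) (monom 1 r * [:1, 0, -1:] ^ ((j - r) div 2)) else 0)" for j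
  have deg_R: "degree (R j) \<le> j" for j
  proof -
    have "degree (smult c (monom 1 r * [:1, 0, -1 :: real:] ^ ((j - r) div 2))) \<le> j" if "r \<le> j" for r c
    proof -
      have "degree ([:1, 0, -1 :: real:] ^ ((j - r) div 2)) \<le> 2 * ((j - r) div 2)"
        by (rule order_trans[OF degree_power_le]) simp
      then have "degree (monom 1 r * [:1, 0, -1 :: real:] ^ ((j - r) div 2)) \<le> r + 2 * ((j - r) div 2)"
        by (intro order_trans[OF degree_mult_le] add_mono) (auto simp: degree_monom_le)
      also have "\<dots> \<le> j" using that by linarith
      finally show ?thesis by (rule order_trans[OF degree_smult_le])
    qed
    then show ?thesis
      unfolding R_def by (intro degree_sum_le) auto
  qed
  have R: "(\<integral>x. poly \<phi> (u \<bullet> x) * (w \<bullet> x) ^ j \<partial>sphere_unif) = poly (R j) (u \<bullet> w)"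
    if uw: "norm u = 1" "norm w = 1" for u w :: "real ^ 'p::_" and j
  proof -
    define t where "t = u \<bullet> w"
    define s where "s = sqrt (1 - t\<^sup>2)"
    have "\<bar>t\<bar> \<le> 1"
      unfolding t_def using uw by (rule sphere_inner_bound)
    then have s: "s\<^sup>2 = 1 - t\<^sup>2"
      by (simp add: s_def abs_square_le_1)
    have "(norm (t *\<^sub>R theta0 + s *\<^sub>R e))\<^sup>2
        = t\<^sup>2 * (theta0 \<bullet> (theta0 :: real ^ 'p::_)) + 2 * t * s * (theta0 \<bullet> e) + s\<^sup>2 * (e \<bullet> e)"
      unfolding power2_norm_eq_inner
      by (simp add: inner_add_left inner_add_right inner_commute[of e theta0] power2_eq_square algebra_simps)
    also have "\<dots> = 1"
      using e s by (simp add: dot_square_norm)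
    finally have "(norm (t *\<^sub>R theta0 + s *\<^sub>R e))\<^sup>2 = 1" .
    then have norm_w: "norm (t *\<^sub>R theta0 + s *\<^sub>R e) = 1"
      using norm_ge_zero[of "t *\<^sub>R theta0 + s *\<^sub>R e"] by (auto simp: power2_eq_1_iff simp del: norm_ge_zero)
    have "(\<integral>x. poly \<phi> (u \<bullet> x) * poly (monom 1 j) (w \<bullet> x) \<partial>sphere_unif)
        = (\<integral>x. poly \<phi> (theta0 \<bullet> x) * poly (monom 1 j) ((t *\<^sub>R theta0 + s *\<^sub>R e) \<bullet> x) \<partial>sphere_unif)"
      using uw norm_w e by (intro integral_sphere_unif_pair_power) (auto simp: inner_add_right t_def dot_square_norm)
    also have "\<dots> = (\<integral>x. (\<Sum>r\<le>j. (real (j choose r) * t ^ r * s ^ (j - r))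
        * (poly \<phi> (theta0 \<bullet> x) * ((theta0 \<bullet> x) ^ r * (e \<bullet> x) ^ (j - r)))) \<partial>sphere_unif)"
      by (simp add: poly_monom inner_add_left binomial_ring power_mult_distrib sum_distrib_left mult_ac)
    also have "\<dots> = (\<Sum>r\<le>j. (real (j choose r) * t ^ r * s ^ (j - r)) * N j r)"
      unfolding N_def
      by (subst Bochner_Integration.integral_sum)
        (auto intro!: integrable_mult_right sphere_unif_continuous_integrable continuous_intros)
    also have "\<dots> = poly (R j) t"
      unfolding R_def poly_sum
    proof (rule sum.cong)
      fix r assume "r \<in> {..j}"
      show "(real (j choose r) * t ^ r * s ^ (j - r)) * N j r = poly (if even (j - r)
          then smult (real (j choose r) * N j r) (monom 1 r * [:1, 0, -1:] ^ ((j - r) div 2)) else 0) t"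
      proof (cases "even (j - r)")
        case True
        then have "s ^ (j - r) = (1 - t\<^sup>2) ^ ((j - r) div 2)"
          by (metis dvd_mult_div_cancel power_mult s)
        then show ?thesis using True by (simp add: poly_monom poly_power power2_eq_square algebra_simps)
      next
        case False
        have "N j r = 0"
          using integral_sphere_unif_odd[OF e(1) False, of "\<phi> * monom 1 r"] by (simp add: N_def poly_monom mult.assoc)
        with False show ?thesis by simp
      qed
    qed simp
    finally show ?thesis by (simp add: poly_monom t_def)
  qed
  let ?Q = "\<Sum>j\<le>degree q. smult (coeff q j) (R j)"
  have "degree ?Q \<le> degree q"
    by (intro degree_sum_le) (auto intro: order_trans[OF degree_smult_le] order_trans[OF deg_R])
  moreover have "(\<integral>x. poly \<phi> (u \<bullet> x) * poly q (w \<bullet> x) \<partial>sphere_unif) = poly ?Q (u \<bullet> w)"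
    if "norm u = 1" "norm w = 1" for u w :: "real ^ 'p::_"
  proof -
    have "(\<integral>x. poly \<phi> (u \<bullet> x) * poly q (w \<bullet> x) \<partial>sphere_unif)
        = (\<integral>x. (\<Sum>j\<le>degree q. coeff q j * (poly \<phi> (u \<bullet> x) * (w \<bullet> x) ^ j)) \<partial>sphere_unif)"
      by (simp add: poly_altdef sum_distrib_left mult_ac)
    also have "\<dots> = poly ?Q (u \<bullet> w)"
      by (subst Bochner_Integration.integral_sum)
        (auto intro!: integrable_mult_right sphere_unif_continuous_integrable continuous_intros simp: R[OF that] poly_sum)
    finally show ?thesis .
  qed
  ultimately show ?thesis by blast
qed

lemma gegenbauer_at_1_pos: "\<nu> \<ge> 0 \<Longrightarrow> poly (gegenbauer \<nu> k) 1 > 0"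
proof (cases "\<nu> = 0")
  case True
  then show ?thesis using chebyshev_cos[of k 0] by (simp add: gegenbauer_def)
next
  case False
  moreover assume "\<nu> \<ge> 0"
  ultimately show ?thesis
    by (simp add: gegenbauer_at_1 pochhammer_pos)
qed

lemma zonal_factor_pos: "\<nu> \<ge> 0 \<Longrightarrow> zonal_factor \<nu> k > 0"
  by (auto simp: zonal_factor_def intro!: divide_pos_pos add_nonneg_pos)

context axial_functional
begin

lemma L_gegenbauer_norm_pos: "L (gegenbauer \<nu> k * gegenbauer \<nu> k) > 0"
proof (cases k)
  case 0
  then show ?thesis using \<nu> L_1 by simp
next
  case (Suc i)
  then show ?thesis
    using L_gegenbauer_norm[of k] gegenbauer_at_1_pos[OF \<nu>, of k] zonal_factor_pos[OF \<nu>, of k]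
    by (metis One_nat_def Suc_le_mono le0 zero_less_mult_pos)
qed

lemma L_gegenbauer_expansion:
  assumes "degree q \<le> j"
  obtains m where "q = (\<Sum>i=0..j. smult (m i) (gegenbauer \<nu> i))"
    "\<And>i. L (q * gegenbauer \<nu> i) = (if i \<le> j then m i * L (gegenbauer \<nu> i * gegenbauer \<nu> i) else 0)"
proof -
  from gegenbauer_expansion[OF \<nu> assms] obtain m
    where m: "q = (\<Sum>i=0..j. smult (m i) (gegenbauer \<nu> i))" by blast
  have "L (q * gegenbauer \<nu> i) = (if i \<le> j then m i * L (gegenbauer \<nu> i * gegenbauer \<nu> i) else 0)" for i
  proof -
    have "L (q * gegenbauer \<nu> i) = (\<Sum>l=0..j. m l * L (gegenbauer \<nu> l * gegenbauer \<nu> i))"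
      unfolding m by (simp only: sum_distrib_right mult_smult_left L_sum L_smult)
    also have "\<dots> = (\<Sum>l=0..j. if l = i then m i * L (gegenbauer \<nu> i * gegenbauer \<nu> i) else 0)"
      by (intro sum.cong) (auto simp: L_gegenbauer_orthogonal)
    finally show ?thesis by (simp add: sum.delta)
  qed
  with m that show ?thesis by blast
qed

lemma L_gegenbauer_lower_degree: "degree q < j \<Longrightarrow> L (q * gegenbauer \<nu> j) = 0"
  using L_gegenbauer_expansion[OF order_refl, of q] by (metis not_less)

end

lemma sphere_unif_Fubini:
  fixes a b c :: "real poly" and e :: "real ^ 'p::{finite,wellorder}"
  assumes "norm e = 1"
  shows "(\<integral>w. (\<integral>x. poly a (e \<bullet> w) * (poly b (e \<bullet> x) * poly c (w \<bullet> x)) \<partial>sphere_unif) \<partial>sphere_unif)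
    = (\<integral>x. (\<integral>w. poly a (e \<bullet> w) * (poly b (e \<bullet> x) * poly c (w \<bullet> x)) \<partial>sphere_unif) \<partial>sphere_unif)"
proof -
  interpret S: pair_prob_space "sphere_unif :: (real ^ 'p::_) measure" "sphere_unif :: (real ^ 'p::_) measure" ..
  let ?g = "\<lambda>x w. poly a (e \<bullet> w) * (poly b (e \<bullet> x) * poly c (w \<bullet> x))"
  have [measurable]: "poly q \<in> borel_measurable borel" for q :: "real poly"
    by (intro borel_measurable_continuous_onI continuous_intros)
  have meas: "(\<lambda>(x, w). ?g x w) \<in> borel_measurable (sphere_unif \<Otimes>\<^sub>M sphere_unif)"
    by measurable
  obtain A B C where ABC: "\<And>t. \<bar>t\<bar> \<le> 1 \<Longrightarrow> \<bar>poly a t\<bar> \<le> A" "\<And>t. \<bar>t\<bar> \<le> 1 \<Longrightarrow> \<bar>poly b t\<bar> \<le> B" "\<And>t. \<bar>t\<bar> \<le> 1 \<Longrightarrow> \<bar>poly c t\<bar> \<le> C"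
    using poly_bounded_Icc by metis
  have bound: "\<bar>?g x w\<bar> \<le> A * (B * C)" if "norm x = 1" "norm w = 1" for x w
  proof -
    have "\<bar>poly a (e \<bullet> w)\<bar> \<le> A" "\<bar>poly b (e \<bullet> x)\<bar> \<le> B" "\<bar>poly c (w \<bullet> x)\<bar> \<le> C"
      by (intro ABC sphere_inner_bound assms that)+
    then show ?thesis
      unfolding abs_mult by (intro mult_mono) (auto intro: order_trans[OF abs_ge_zero])
  qed
  have "integrable (sphere_unif \<Otimes>\<^sub>M sphere_unif) (\<lambda>(x, w). ?g x w)"
    by (rule S.P.integrable_const_bound[where B = "A * (B * C)"])
      (use meas bound in \<open>auto simp: space_pair_measure intro!: AE_I2\<close>)
  then show ?thesis by (rule S.Fubini_integral)
qed

text \<open>The convolution \<open>Q\<close> of \<open>\<phi>\<close> with \<open>C\<^sub>k\<close> has degree at most \<open>k\<close>. Moving the convolution to the other factor by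
  Fubini shows that \<open>Q\<close> is orthogonal to \<open>C\<^sub>i\<close> for \<open>i < k\<close>, so it is a multiple of \<open>C\<^sub>k\<close>.\<close>

lemma Funk_Hecke_gegenbauer:
  fixes \<phi> :: "real poly" and u w :: "real ^ 'p::{finite,wellorder}"
  assumes dim: "2 \<le> CARD('p)" and uw: "norm u = 1" "norm w = 1"
  defines "C \<equiv> gegenbauer ((real CARD('p) - 2) / 2)"
  shows "(\<integral>x. poly \<phi> (u \<bullet> x) * poly (C k) (w \<bullet> x) \<partial>sphere_unif)
    = axial_mean TYPE('p) (\<phi> * C k) / poly (C k) 1 * poly (C k) (u \<bullet> w)"
proof -
  let ?\<nu> = "(real CARD('p) - 2) / 2"
  interpret axial_functional "axial_mean TYPE('p)" ?\<nu>
    by (rule axial_functional_axial_mean[OF dim])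
  note conv = zonal_convolution_degree[OF dim, where \<phi> = \<phi>]
  obtain Q where Q: "degree Q \<le> degree (C k)"
    "\<And>u w :: real ^ 'p::_. norm u = 1 \<Longrightarrow> norm w = 1 \<Longrightarrow>
      (\<integral>x. poly \<phi> (u \<bullet> x) * poly (C k) (w \<bullet> x) \<partial>sphere_unif) = poly Q (u \<bullet> w)"
    using conv[of "C k"] by blast
  have "degree Q \<le> k"
    using Q(1) coeff_gegenbauer_top(2)[OF \<nu>, of k] unfolding C_def by linarith
  then obtain m where m: "Q = (\<Sum>i=0..k. smult (m i) (C i))"
    "\<And>i. axial_mean TYPE('p) (Q * C i) = (if i \<le> k then m i * axial_mean TYPE('p) (C i * C i) else 0)"
    using L_gegenbauer_expansion[OF \<open>degree Q \<le> k\<close>] unfolding C_def by blast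
  have "m i = 0" if "i < k" for i
  proof -
    obtain R where R: "degree R \<le> degree (C i)"
      "\<And>u w :: real ^ 'p::_. norm u = 1 \<Longrightarrow> norm w = 1 \<Longrightarrow>
        (\<integral>x. poly \<phi> (u \<bullet> x) * poly (C i) (w \<bullet> x) \<partial>sphere_unif) = poly R (u \<bullet> w)"
      using conv[of "C i"] by blast
    let ?e = "theta0 :: real ^ 'p::_"
    let ?J = "\<lambda>a b x w. poly (C a) (?e \<bullet> w) * (poly \<phi> (?e \<bullet> x) * poly (C b) (w \<bullet> x))"
    \<comment> \<open>The pairs \<open>(?e, x)\<close> and \<open>(x, ?e)\<close> of unit vectors
      have the same Gram matrix, so the two polynomials may trade places.\<close>
    have swap: "(\<integral>w. poly (C i) (?e \<bullet> w) * poly (C k) (x \<bullet> w) \<partial>sphere_unif)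
        = (\<integral>w. poly (C k) (?e \<bullet> w) * poly (C i) (x \<bullet> w) \<partial>sphere_unif)" if "norm x = 1" for x
      using integral_sphere_unif_pair_power[of ?e x x ?e "C i" "C k"] that by (simp add: inner_commute mult.commute)
    have "axial_mean TYPE('p) (Q * C i) = (\<integral>w. poly (C i) (?e \<bullet> w) * poly Q (?e \<bullet> w) \<partial>sphere_unif)"
      unfolding axial_mean_def by (simp add: mult.commute)
    also have "\<dots> = (\<integral>w. (\<integral>x. ?J i k x w \<partial>sphere_unif) \<partial>sphere_unif)"
      by (intro Bochner_Integration.integral_cong) (auto simp: Q(2))
    also have "\<dots> = (\<integral>x. (\<integral>w. ?J i k x w \<partial>sphere_unif) \<partial>sphere_unif)"
      by (rule sphere_unif_Fubini) simp
    also have "\<dots> = (\<integral>x. poly \<phi> (?e \<bullet> x) * (\<integral>w. poly (C i) (?e \<bullet> w) * poly (C k) (x \<bullet> w) \<partial>sphere_unif) \<partial>sphere_unif)"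
      by (simp add: mult_ac inner_commute)
    also have "\<dots> = (\<integral>x. poly \<phi> (?e \<bullet> x) * (\<integral>w. poly (C k) (?e \<bullet> w) * poly (C i) (x \<bullet> w) \<partial>sphere_unif) \<partial>sphere_unif)"
      by (intro Bochner_Integration.integral_cong refl arg_cong2[where f = "(*)"] swap) simp
    also have "\<dots> = (\<integral>x. (\<integral>w. ?J k i x w \<partial>sphere_unif) \<partial>sphere_unif)"
      by (simp add: mult_ac inner_commute)
    also have "\<dots> = (\<integral>w. (\<integral>x. ?J k i x w \<partial>sphere_unif) \<partial>sphere_unif)"
      by (rule sphere_unif_Fubini[symmetric]) simp
    also have "\<dots> = (\<integral>w. poly (C k) (?e \<bullet> w) * poly R (?e \<bullet> w) \<partial>sphere_unif)"
      by (intro Bochner_Integration.integral_cong) (auto simp: R(2))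
    also have "\<dots> = axial_mean TYPE('p) (R * C k)"
      unfolding axial_mean_def by (simp add: mult.commute)
    also have "\<dots> = 0"
      unfolding C_def by (rule L_gegenbauer_lower_degree)
        (use R(1) coeff_gegenbauer_top(2)[OF \<nu>, of i] that in \<open>simp add: C_def\<close>)
    finally have "m i * axial_mean TYPE('p) (C i * C i) = 0"
      using m(2)[of i] that by simp
    then show "m i = 0"
      using L_gegenbauer_norm_pos[of i] unfolding C_def by simp
  qed
  then have "(\<Sum>i=0..k. smult (m i) (C i)) = (\<Sum>i=0..k. if i = k then smult (m k) (C k) else 0)"
    by (intro sum.cong) auto
  then have Qk: "Q = smult (m k) (C k)"
    using m(1) by simp
  \<comment> \<open>Evaluation at coinciding points identifies the remaining multiple.\<close>
  have "axial_mean TYPE('p) (\<phi> * C k) = poly Q 1"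
    using Q(2)[of theta0 theta0] axial_mean_pair[of "theta0 :: real ^ 'p::_" \<phi> "C k"] by (simp add: dot_square_norm)
  then have "axial_mean TYPE('p) (\<phi> * C k) = m k * poly (C k) 1"
    by (simp add: Qk)
  moreover have "poly (C k) 1 \<noteq> 0"
    using gegenbauer_at_1_pos[OF \<nu>, of k] by (simp add: C_def)
  ultimately show ?thesis
    using Q(2)[OF uw] by (simp add: Qk)
qed

section \<open>Constants of the theorem in terms of Gegenbauer polynomials\<close>

lemma h_fun_eq: "2 \<le> p \<Longrightarrow> h_fun p k s =
    zonal_factor ((real p - 2) / 2) k * poly (gegenbauer ((real p - 2) / 2) k) s"
  by (auto simp: h_fun_def zonal_factor_def field_simps)

lemma pochhammer_eq_choose: "m \<ge> 1 \<Longrightarrow> pochhammer (real m) k = fact k * real ((m + k - 1) choose k)"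
proof (induction k)
  case (Suc k)
  define n where "n = m + k - 1"
  have n: "m + Suc k - 1 = Suc n" "real m + real k = real (Suc n)"
    using Suc.prems by (auto simp: n_def)
  have IH: "pochhammer (real m) k = fact k * real (n choose k)"
    using Suc unfolding n_def by simp
  have "pochhammer (real m) (Suc k) = fact k * real (Suc n * (n choose k))"
    unfolding pochhammer_Suc IH n(2) by (simp only: of_nat_mult mult_ac)
  also have "Suc n * (n choose k) = Suc k * (Suc n choose Suc k)"
    by (rule Suc_times_binomial[symmetric])
  finally show ?case
    unfolding n(1) fact_Suc by (simp only: of_nat_mult of_nat_fact mult_ac)
qed simp

text \<open>This value is the trace of the kernel of degree \<open>k\<close>, hence the rank of the
  projection. For m = p - 2 and B the binomial coefficient of m + k - 1 over k, m times the two
  summands of \<open>d_const\<close> is k B and (m + k) B, adding up to (m + 2 k) B.\<close>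

lemma h_fun_at_1:
  assumes "2 \<le> p" "1 \<le> k"
  shows "h_fun p k 1 = real (d_const p k)"
proof (cases "p = 2")
  case True
  then show ?thesis
    using chebyshev_cos[of k 0] assms by (simp add: h_fun_def d_const_def gegenbauer_def)
next
  case False
  then obtain m where p: "p = m + 2" and m: "m \<ge> 1"
    using assms by (metis Suc_leI add.commute le_Suc_ex nat_less_le One_nat_def le_add_diff_inverse2 zero_less_diff)
  obtain i where k: "k = Suc i"
    using assms by (cases k) auto
  let ?B = "real ((m + i) choose k)"
  have C: "poly (gegenbauer ((real p - 2) / 2) k) 1 = ?B"
    using gegenbauer_at_1[of "(real p - 2) / 2" k] m pochhammer_eq_choose[OF m, of k] by (simp add: p k del: fact_Suc)
  obtain l where l: "m = Suc l" using m by (cases m) auto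
  have sym: "(m + i) choose k = (m + i) choose l"
    using binomial_symmetric[of k "m + i"] by (simp add: k l)
  have 1: "real m * real ((m + i) choose m) = real k * ?B"
    using binomial_absorb_comp[of "m + i" l] binomial_absorption[of l "m + i"] sym
    by (metis Suc_diff_Suc add_Suc_right add_diff_cancel_left' k l binomial_absorb_comp of_nat_mult Suc_times_binomial_add add.commute add_Suc)
  have 2: "real m * real (Suc (m + i) choose m) = real (m + k) * ?B"
    using Suc_times_binomial[of l "m + i"] sym by (metis l k add_Suc_right of_nat_mult)
  have "real m * real (d_const p k) = real m * real ((m + i) choose m) + real m * real (Suc (m + i) choose m)"
    by (simp add: d_const_def p k algebra_simps)
  also have "\<dots> = real m * ((1 + 2 * real k / real m) * ?B)"
    unfolding 1 2 using m by (simp add: field_simps)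
  finally show ?thesis
    using m False by (simp add: h_fun_def C) (simp add: p)
qed

lemma d_const_pos: "2 \<le> p \<Longrightarrow> 1 \<le> k \<Longrightarrow> d_const p k > 0"
  using h_fun_at_1[of p k] h_fun_eq[of p k 1] gegenbauer_at_1_pos[of "(real p - 2) / 2" k]
    zonal_factor_pos[of "(real p - 2) / 2" k]
  by (metis bot_nat_0.not_eq_extremum diff_ge_0_iff_ge divide_nonneg_nonneg less_irrefl mult_pos_pos of_nat_0 of_nat_le_iff of_nat_numeral zero_le_numeral)

lemma t_const_eq:
  assumes "2 \<le> p" "1 \<le> k"
  shows "(t_const p k)\<^sup>2 = (zonal_factor ((real p - 2) / 2) k)\<^sup>2 / real (d_const p k)"
proof (cases "p = 2")
  case True
  then show ?thesis using assms by (simp add: t_const_def zonal_factor_def d_const_def)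
next
  case False
  then have "1 + 2 * real k / (real p - 2) = zonal_factor ((real p - 2) / 2) k"
    using assms by (simp add: zonal_factor_def field_simps)
  with False show ?thesis by (simp add: t_const_def power_divide)
qed

text \<open>Only the polynomial of index \<open>k\<close> contributes to the leading coefficient of
  the expansion.\<close>

lemma monomial_coeff_top:
  assumes "2 \<le> p"
  shows "monomial_coeff p k k = 1 / coeff (gegenbauer ((real p - 2) / 2) k) k"
proof -
  let ?C = "gegenbauer ((real p - 2) / 2)"
  have nonneg: "(real p - 2) / 2 \<ge> 0" using assms by simp
  have "monom 1 k = (\<Sum>i=0..k. smult (monomial_coeff p i k) (?C i))"
    using monomial_coeff[OF assms, of _ k]
    by (auto simp: poly_eq_poly_eq_iff[symmetric] fun_eq_iff poly_sum poly_monom)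
  then have "1 = (\<Sum>i=0..k. monomial_coeff p i k * coeff (?C i) k)"
    by (auto dest!: arg_cong[of _ _ "\<lambda>q. coeff q k"] simp: coeff_sum)
  also have "\<dots> = (\<Sum>i=0..k. if i = k then monomial_coeff p k k * coeff (?C k) k else 0)"
    using coeff_gegenbauer_top(2)[OF nonneg]
    by (intro sum.cong refl) (auto intro!: coeff_eq_0 le_less_trans[OF coeff_gegenbauer_top(2)[OF nonneg]])
  finally show ?thesis
    using coeff_gegenbauer_top(1)[OF nonneg, of k] by (simp add: field_simps)
qed

lemma coeff_chebyshev_top: "coeff (chebyshev (Suc k)) (Suc k) = 2 ^ k"
proof (induction k rule: less_induct)
  case (less k)
  show ?case
  proof (cases k)
    case (Suc i)
    have "coeff (chebyshev i) (Suc (Suc i)) = 0"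
      using coeff_gegenbauer_top(2)[of 0 i] by (intro coeff_eq_0) (simp add: gegenbauer_def)
    with Suc less[of i] show ?thesis by simp
  qed simp
qed

lemma xi_eq:
  assumes "2 \<le> p" "1 \<le> k"
  shows "xi p f k \<tau> = real (d_const p k) * ((deriv ^^ k) f 0)\<^sup>2 * \<tau> ^ (2 * k)
    / (\<Prod>l=0..k-1. (real p + 2 * real l)\<^sup>2)"
proof -
  let ?\<nu> = "(real p - 2) / 2"
  let ?C = "gegenbauer ?\<nu>"
  obtain i where k: "k = Suc i" using assms by (cases k) auto
  \<comment> \<open>The core of the equality of the two forms of \<xi>: leading coefficient,
    factorial and zonal factor combine into the product of the p + 2 l. The planar case needs its
    own computation because its leading coefficient is 2^(k-1).\<close>
  have "coeff (?C k) k * fact k * zonal_factor ?\<nu> k = 2 ^ k * pochhammer (?\<nu> + 1) k"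
  proof (cases "p = 2")
    case True
    then show ?thesis
      using coeff_chebyshev_top[of i] by (simp add: gegenbauer_def zonal_factor_def k pochhammer_fact del: chebyshev.simps)
  next
    case False
    define \<mu> where "\<mu> = ?\<nu>"
    have "\<mu> > 0" using False assms by (simp add: \<mu>_def)
    have "pochhammer \<mu> k * (\<mu> + real k) = \<mu> * pochhammer (\<mu> + 1) k"
      using pochhammer_rec[of \<mu> k] pochhammer_rec'[of \<mu> k] by (simp add: mult.commute)
    then have "pochhammer \<mu> k * ((real k + \<mu>) / \<mu>) = pochhammer (\<mu> + 1) k"
      using \<open>\<mu> > 0\<close> by (simp add: field_simps)
    moreover have "coeff (gegenbauer \<mu> k) k * fact k = 2 ^ k * pochhammer \<mu> k"
      using coeff_gegenbauer(1)[OF \<open>\<mu> > 0\<close>, of k 0] by simp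
    moreover have "zonal_factor \<mu> k = (real k + \<mu>) / \<mu>"
      using \<open>\<mu> > 0\<close> by (simp add: zonal_factor_def)
    ultimately show ?thesis
      unfolding \<mu>_def[symmetric] by (simp only: mult.assoc)
  qed
  also have "2 ^ k * pochhammer (?\<nu> + 1) k = (\<Prod>l=0..k-1. real p + 2 * real l)"
  proof -
    have "2 ^ k * pochhammer (?\<nu> + 1) k = (\<Prod>l=0..<k. 2 * (?\<nu> + 1 + real l))"
      unfolding pochhammer_prod prod.distrib by simp
    also have "\<dots> = (\<Prod>l=0..k-1. real p + 2 * real l)"
      using k by (intro prod.cong) (auto simp: field_simps)
    finally show ?thesis .
  qed
  finally have "(\<Prod>l=0..k-1. (real p + 2 * real l)\<^sup>2) = (coeff (?C k) k * fact k * zonal_factor ?\<nu> k)\<^sup>2"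
    by (simp add: prod_power_distrib)
  then show ?thesis
    unfolding xi_def monomial_coeff_top[OF assms(1)] t_const_eq[OF assms]
    by (simp add: power_mult_distrib power_divide mult_ac)
qed

section \<open>Projection kernels\<close>

text \<open>Kernels of finite-rank orthogonal projections in \<open>L\<^sup>2(M)\<close>, as pointwise defined functions.\<close>

definition projection_kernel :: "'a measure \<Rightarrow> ('a \<Rightarrow> 'a \<Rightarrow> real) \<Rightarrow> bool" where
  "projection_kernel M K \<longleftrightarrow>
    (\<forall>x\<in>space M. \<forall>y\<in>space M. K x y = K y x) \<and>
    (\<forall>y\<in>space M. (\<lambda>x. K x y) \<in> borel_measurable M) \<and> (\<lambda>x. K x x) \<in> borel_measurable M \<and>
    (\<exists>B. \<forall>x\<in>space M. \<forall>y\<in>space M. \<bar>K x y\<bar> \<le> B) \<and>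
    (\<forall>x\<in>space M. \<forall>y\<in>space M. (\<integral>z. K z x * K z y \<partial>M) = K x y)"

context prob_space
begin

lemma integrable_mult_bounded:
  fixes f g :: "'a \<Rightarrow> real"
  assumes "f \<in> borel_measurable M" "g \<in> borel_measurable M"
    "\<And>x. x \<in> space M \<Longrightarrow> \<bar>f x\<bar> \<le> A" "\<And>x. x \<in> space M \<Longrightarrow> \<bar>g x\<bar> \<le> B"
  shows "integrable M (\<lambda>x. f x * g x)"
proof (rule integrable_const_bound[where B = "A * B"])
  show "AE x in M. norm (f x * g x) \<le> A * B"
    using assms(3,4) by (auto simp: abs_mult intro!: mult_mono order_trans[OF abs_ge_zero])
qed (use assms in auto)

lemma projection_kernel_diag_nonneg:
  assumes "projection_kernel M K" "x \<in> space M"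
  shows "0 \<le> K x x"
proof -
  have "0 \<le> (\<integral>z. K z x * K z x \<partial>M)" by (intro integral_nonneg_AE) auto
  also have "(\<integral>z. K z x * K z x \<partial>M) = K x x"
    using assms unfolding projection_kernel_def by blast
  finally show ?thesis .
qed

text \<open>The reproducing identity makes the section of \<open>K\<close> at \<open>x0\<close> a
  vector in the range with squared norm \<open>K x0 x0\<close>. Hence \<open>e\<close> is a unit
  vector of the range, and subtracting its rank-one kernel projects onto its orthogonal complement
  there.\<close>

lemma projection_kernel_deflate:
  assumes K: "projection_kernel M K" and x0: "x0 \<in> space M" "K x0 x0 \<noteq> 0"
  defines "e \<equiv> \<lambda>x. K x x0 / sqrt (K x0 x0)"
  shows "projection_kernel M (\<lambda>x y. K x y - e x * e y)"
    and "e \<in> borel_measurable M" "\<exists>B. \<forall>x\<in>space M. \<bar>e x\<bar> \<le> B"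
    and "(\<integral>x. e x * e x \<partial>M) = 1"
    and "\<And>y. y \<in> space M \<Longrightarrow> (\<integral>z. (K z y - e z * e y) * e z \<partial>M) = 0"
    and "(\<integral>x. K x x - e x * e x \<partial>M) = (\<integral>x. K x x \<partial>M) - 1"
proof -
  obtain B where B: "\<And>x y. x \<in> space M \<Longrightarrow> y \<in> space M \<Longrightarrow> \<bar>K x y\<bar> \<le> B"
    using K unfolding projection_kernel_def by metis
  have sym: "K x y = K y x" and idem: "(\<integral>z. K z x * K z y \<partial>M) = K x y"
    if "x \<in> space M" "y \<in> space M" for x y
    using K that unfolding projection_kernel_def by blast+
  have meas [measurable]: "y \<in> space M \<Longrightarrow> (\<lambda>x. K x y) \<in> borel_measurable M"
    "(\<lambda>x. K x x) \<in> borel_measurable M" for y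
    using K unfolding projection_kernel_def by blast+
  define s where "s = sqrt (K x0 x0)"
  have s: "s > 0" "s * s = K x0 x0"
    using projection_kernel_diag_nonneg[OF K x0(1)] x0(2) by (auto simp: s_def)
  have e: "e x = K x x0 / s" for x
    by (simp add: e_def s_def)
  show e_meas [measurable]: "e \<in> borel_measurable M"
    unfolding e_def using meas(1)[OF x0(1)] by measurable
  have e_bound: "\<bar>e x\<bar> \<le> B / s" if "x \<in> space M" for x
    unfolding e using B[OF that x0(1)] s by (simp add: divide_right_mono)
  then show "\<exists>B. \<forall>x\<in>space M. \<bar>e x\<bar> \<le> B" by blast
  have int_KK: "integrable M (\<lambda>z. K z x * K z y)" if "x \<in> space M" "y \<in> space M" for x y
    using that by (intro integrable_mult_bounded[where A = B and B = B] meas B)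
  have int_Ke: "integrable M (\<lambda>z. K z x * e z)" if "x \<in> space M" for x
    using that by (intro integrable_mult_bounded[where A = B and B = "B / s"] meas B e_meas e_bound)
  have int_ee: "integrable M (\<lambda>z. e z * e z)"
    by (intro integrable_mult_bounded[where A = "B / s" and B = "B / s"] e_meas e_bound)
  have Ke: "(\<integral>z. K z y * e z \<partial>M) = e y" if "y \<in> space M" for y
    using idem[OF that x0(1)] by (simp add: e)
  show ee: "(\<integral>x. e x * e x \<partial>M) = 1"
    using idem[OF x0(1) x0(1)] s by (simp add: e) (metis divide_self less_irrefl mult_eq_0_iff)
  show "(\<integral>z. (K z y - e z * e y) * e z \<partial>M) = 0" if "y \<in> space M" for y
  proof -
    have "(\<integral>z. (K z y - e z * e y) * e z \<partial>M) = (\<integral>z. K z y * e z - e y * (e z * e z) \<partial>M)"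
      by (simp add: algebra_simps)
    also have "\<dots> = 0"
      using int_Ke[OF that] int_ee by (simp add: Ke[OF that] ee)
    finally show ?thesis .
  qed
  have int_diag: "integrable M (\<lambda>x. K x x)"
    by (rule integrable_const_bound[where B = B]) (use B in auto)
  show "(\<integral>x. K x x - e x * e x \<partial>M) = (\<integral>x. K x x \<partial>M) - 1"
    using int_diag int_ee by (simp add: ee)
  show "projection_kernel M (\<lambda>x y. K x y - e x * e y)"
    unfolding projection_kernel_def
  proof (intro conjI ballI)
    fix x y assume xy: "x \<in> space M" "y \<in> space M"
    show "K x y - e x * e y = K y x - e y * e x"
      using sym[OF xy] by simp
    have "(\<integral>z. (K z x - e z * e x) * (K z y - e z * e y) \<partial>M)
        = (\<integral>z. K z x * K z y - e y * (K z x * e z) - e x * (K z y * e z) + e x * e y * (e z * e z) \<partial>M)"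
      by (simp add: algebra_simps)
    also have "\<dots> = K x y - e y * e x - e x * e y + e x * e y * 1"
      using int_KK[OF xy] int_Ke[OF xy(1)] int_Ke[OF xy(2)] int_ee
      by (simp add: Ke xy ee idem)
    finally show "(\<integral>z. (K z x - e z * e x) * (K z y - e z * e y) \<partial>M) = K x y - e x * e y"
      by simp
  next
    show "\<exists>C. \<forall>x\<in>space M. \<forall>y\<in>space M. \<bar>K x y - e x * e y\<bar> \<le> C"
    proof (intro exI ballI)
      fix x y assume xy: "x \<in> space M" "y \<in> space M"
      have "\<bar>K x y - e x * e y\<bar> \<le> \<bar>K x y\<bar> + \<bar>e x\<bar> * \<bar>e y\<bar>"
        by (metis abs_mult abs_triangle_ineq4)
      also have "\<dots> \<le> B + B / s * (B / s)"
        using xy by (intro add_mono mult_mono B e_bound) (auto intro: order_trans[OF abs_ge_zero e_bound])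
      finally show "\<bar>K x y - e x * e y\<bar> \<le> B + B / s * (B / s)" .
    qed
  qed auto
qed

text \<open>Deflation lowers the trace by one and the trace stays nonnegative, so integrality of the
  trace alone bounds the rank.\<close>

lemma projection_kernel_decomposition:
  assumes "projection_kernel M K" "(\<integral>x. K x x \<partial>M) = real d"
  shows "\<exists>g. (\<forall>r<d. g r \<in> borel_measurable M \<and> (\<exists>B. \<forall>x\<in>space M. \<bar>g r x\<bar> \<le> B)) \<and>
    (\<forall>r<d. \<forall>s<d. (\<integral>x. g r x * g s x \<partial>M) = (if r = s then 1 else 0)) \<and>
    (\<forall>x\<in>space M. \<forall>y\<in>space M. K x y = (\<Sum>r<d. g r x * g r y))"
  using assms
proof (induction d arbitrary: K)
  case 0
  have diag: "K x x = 0" if "x \<in> space M" for x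
  proof (rule ccontr)
    assume "K x x \<noteq> 0"
    note defl = projection_kernel_deflate[OF 0(1) that this]
    have "0 \<le> (\<integral>y. K y y - K y x / sqrt (K x x) * (K y x / sqrt (K x x)) \<partial>M)"
      using projection_kernel_diag_nonneg[OF defl(1)] by (intro integral_nonneg_AE) auto
    then show False
      unfolding defl(6) 0(2) by simp
  qed
  have "K x y = 0" if xy: "x \<in> space M" "y \<in> space M" for x y
  proof -
    obtain B where B: "\<And>x y. x \<in> space M \<Longrightarrow> y \<in> space M \<Longrightarrow> \<bar>K x y\<bar> \<le> B"
      using 0(1) unfolding projection_kernel_def by metis
    have idem: "(\<integral>z. K z x * K z x \<partial>M) = K x x" "(\<integral>z. K z x * K z y \<partial>M) = K x y"
      and meas: "(\<lambda>z. K z x) \<in> borel_measurable M" "(\<lambda>z. K z y) \<in> borel_measurable M"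
      using 0(1) xy unfolding projection_kernel_def by blast+
    have "integrable M (\<lambda>z. K z x * K z x)"
      using xy by (intro integrable_mult_bounded[where A = B and B = B] meas B)
    \<comment> \<open>A zero on the diagonal makes the section vanish almost everywhere; the
      reproducing identity then turns this into vanishing at every pair of points.\<close>
    then have "AE z in M. K z x * K z x = 0"
      using idem(1) diag[OF xy(1)] by (subst integral_nonneg_eq_0_iff_AE[symmetric]) auto
    then have "(\<integral>z. K z x * K z y \<partial>M) = (\<integral>z. 0 \<partial>M)"
      using meas by (intro integral_cong_AE) auto
    then show ?thesis using idem(2) by simp
  qed
  then show ?case by auto
next
  case (Suc d)
  obtain x0 where x0: "x0 \<in> space M" "K x0 x0 \<noteq> 0"
  proof (rule ccontr)
    assume "\<not> thesis"
    then have "(\<integral>x. K x x \<partial>M) = (\<integral>x. 0 \<partial>M)"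
      using that by (intro Bochner_Integration.integral_cong) auto
    with Suc.prems(2) show False by simp
  qed
  define e where "e x = K x x0 / sqrt (K x0 x0)" for x
  note defl = projection_kernel_deflate[OF Suc.prems(1) x0, folded e_def]
  have "(\<integral>x. K x x - e x * e x \<partial>M) = real d"
    unfolding defl(6) Suc.prems(2) by simp
  from Suc.IH[OF defl(1) this] obtain g where
    g_meas: "\<And>r. r < d \<Longrightarrow> g r \<in> borel_measurable M" "\<And>r. r < d \<Longrightarrow> \<exists>B. \<forall>x\<in>space M. \<bar>g r x\<bar> \<le> B"
    and g_orth: "\<And>r s. r < d \<Longrightarrow> s < d \<Longrightarrow> (\<integral>x. g r x * g s x \<partial>M) = (if r = s then 1 else 0)"
    and g_sum: "\<And>x y. x \<in> space M \<Longrightarrow> y \<in> space M \<Longrightarrow> K x y - e x * e y = (\<Sum>r<d. g r x * g r y)"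
    by blast
  have int: "integrable M (\<lambda>x. g r x * g s x)" "integrable M (\<lambda>x. g r x * e x)" if "r < d" "s < d" for r s
    using g_meas[OF that(1)] g_meas[OF that(2)] defl(2,3) by (auto intro: integrable_mult_bounded)
  \<comment> \<open>The deflated kernel annihilates \<open>e\<close>. Written through the
    \<open>g s\<close>, this is a vanishing combination whose coefficients are the inner products
    with \<open>e\<close>; integration against \<open>g r\<close> isolates one of them.\<close>
  have ge: "(\<integral>x. g r x * e x \<partial>M) = 0" if r: "r < d" for r
  proof -
    have "(\<Sum>s<d. g s y * (\<integral>x. g s x * e x \<partial>M)) = 0" if y: "y \<in> space M" for y
    proof -
      have "(\<integral>z. (K z y - e z * e y) * e z \<partial>M) = (\<integral>z. (\<Sum>s<d. g s y * (g s z * e z)) \<partial>M)"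
        by (intro Bochner_Integration.integral_cong) (auto simp: g_sum y sum_distrib_left sum_distrib_right mult_ac)
      also have "\<dots> = (\<Sum>s<d. g s y * (\<integral>x. g s x * e x \<partial>M))"
        using int by (subst Bochner_Integration.integral_sum) auto
      finally show ?thesis using defl(5)[OF y] by simp
    qed
    note zero = this
    have "0 = (\<integral>y. (\<Sum>s<d. (\<integral>x. g s x * e x \<partial>M) * (g r y * g s y)) \<partial>M)"
    proof -
      have "(\<Sum>s<d. (\<integral>x. g s x * e x \<partial>M) * (g r y * g s y)) = 0" if "y \<in> space M" for y
      proof -
        have "(\<Sum>s<d. (\<integral>x. g s x * e x \<partial>M) * (g r y * g s y))
            = g r y * (\<Sum>s<d. g s y * (\<integral>x. g s x * e x \<partial>M))"
          by (simp add: sum_distrib_left mult_ac)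
        then show ?thesis using zero[OF that] by simp
      qed
      then have "(\<integral>y. (\<Sum>s<d. (\<integral>x. g s x * e x \<partial>M) * (g r y * g s y)) \<partial>M) = (\<integral>y. 0 \<partial>M)"
        by (intro Bochner_Integration.integral_cong) auto
      then show ?thesis by simp
    qed
    also have "\<dots> = (\<Sum>s<d. (\<integral>x. g s x * e x \<partial>M) * (if r = s then 1 else 0))"
      using int r by (subst Bochner_Integration.integral_sum) (auto simp: g_orth intro!: sum.cong)
    finally show ?thesis using r by (simp add: if_distrib[of "(*) _"] cong: if_cong)
  qed
  let ?g = "\<lambda>r. if r < d then g r else e"
  have "?g r \<in> borel_measurable M \<and> (\<exists>B. \<forall>x\<in>space M. \<bar>?g r x\<bar> \<le> B)" for r
    using g_meas defl(2,3) by auto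
  moreover have "(\<integral>x. ?g r x * ?g s x \<partial>M) = (if r = s then 1 else 0)" if "r < Suc d" "s < Suc d" for r s
    using that g_orth ge defl(4) by (auto simp: less_Suc_eq mult.commute)
  moreover have "K x y = (\<Sum>r<Suc d. ?g r x * ?g r y)" if "x \<in> space M" "y \<in> space M" for x y
    using g_sum[OF that] by simp
  ultimately show ?case
    by (intro exI[of _ ?g]) blast
qed

end

section \<open>Means under shrinking angular alternatives\<close>

lemma times_differentiable_at_mono: "times_differentiable_at K f a \<Longrightarrow> k \<le> K \<Longrightarrow> times_differentiable_at k f a"
  by (auto simp: times_differentiable_at_def)

text \<open>The derivative of the remainder of \<open>f\<close> is the remainder of
  \<open>deriv f\<close> of one order less, so the mean value inequality on the interval between
  -|x| and |x| raises the order with the same \<epsilon>. The base case is differentiability at 0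
  itself.\<close>

lemma Taylor_Peano:
  fixes f :: "real \<Rightarrow> real"
  assumes "times_differentiable_at (Suc k) f 0" "0 < \<epsilon>"
  shows "\<forall>\<^sub>F x in nhds 0. \<bar>f x - (\<Sum>j\<le>Suc k. (deriv ^^ j) f 0 / fact j * x ^ j)\<bar> \<le> \<epsilon> * \<bar>x\<bar> ^ Suc k"
  using assms(1)
proof (induction k arbitrary: f)
  case 0
  then have "f differentiable (at 0)"
    by (auto simp: times_differentiable_at_def)
  then have "(f has_derivative (\<lambda>x. deriv f 0 * x)) (at 0)"
    by (simp add: DERIV_deriv_iff_real_differentiable flip: has_field_derivative_def)
  then obtain \<delta> where \<delta>: "\<delta> > 0" "\<And>y. norm (y - 0) < \<delta> \<Longrightarrow> norm (f y - f 0 - deriv f 0 * (y - 0)) \<le> \<epsilon> * norm (y - 0)"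
    using \<open>0 < \<epsilon>\<close> unfolding has_derivative_at_alt by blast
  show ?case
    unfolding eventually_nhds_metric
    by (rule exI[of _ \<delta>]) (use \<delta> in \<open>auto simp: dist_real_def algebra_simps\<close>)
next
  case (Suc k)
  let ?T = "\<lambda>x. \<Sum>j\<le>Suc k. (deriv ^^ j) (deriv f) 0 / fact j * x ^ j"
  have pow: "(deriv ^^ j) (deriv f) = (deriv ^^ Suc j) f" for j
    by (simp add: funpow_swap1)
  have "times_differentiable_at (Suc k) (deriv f) 0"
    using Suc.prems unfolding times_differentiable_at_def pow by auto
  note IH = Suc.IH[OF this]
  have "\<forall>\<^sub>F x in nhds 0. (deriv ^^ 0) f differentiable (at x)"
    using Suc.prems unfolding times_differentiable_at_def by blast
  then have "\<forall>\<^sub>F x in nhds 0. f differentiable (at x) \<and>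
      \<bar>deriv f x - ?T x\<bar> \<le> \<epsilon> * \<bar>x\<bar> ^ Suc k"
    using IH by eventually_elim simp
  then obtain \<delta> where \<delta>: "\<delta> > 0" "\<And>x. \<bar>x\<bar> < \<delta> \<Longrightarrow> f differentiable (at x)"
    "\<And>x. \<bar>x\<bar> < \<delta> \<Longrightarrow> \<bar>deriv f x - ?T x\<bar> \<le> \<epsilon> * \<bar>x\<bar> ^ Suc k"
    unfolding eventually_nhds_metric by (auto simp: dist_real_def)
  let ?R = "\<lambda>x. f x - (\<Sum>j\<le>Suc (Suc k). (deriv ^^ j) f 0 / fact j * x ^ j)"
  have "\<bar>?R x\<bar> \<le> \<epsilon> * \<bar>x\<bar> ^ Suc (Suc k)" if x: "\<bar>x\<bar> < \<delta>" for x
  proof -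
    have deriv: "(?R has_field_derivative
        deriv f z - ?T z) (at z within {-\<bar>x\<bar>..\<bar>x\<bar>})"
      if "\<bar>z\<bar> < \<delta>" for z
    proof -
      have "(f has_field_derivative deriv f z) (at z)"
        using \<delta>(2)[OF that] by (simp add: DERIV_deriv_iff_real_differentiable)
      moreover have "((\<lambda>x. \<Sum>j\<le>Suc (Suc k). (deriv ^^ j) f 0 / fact j * x ^ j) has_field_derivative
          ?T z) (at z)"
      proof -
        have "((\<lambda>x. (deriv ^^ 0) f 0 / fact 0 * x ^ 0 + (\<Sum>j\<le>Suc k. (deriv ^^ Suc j) f 0 / fact (Suc j) * x ^ Suc j))
            has_field_derivative 0 + (\<Sum>j\<le>Suc k. (deriv ^^ Suc j) f 0 / fact (Suc j) * (real (Suc j) * z ^ j))) (at z)"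
          by (intro DERIV_add DERIV_sum DERIV_cmult) (auto intro!: derivative_eq_intros simp del: power_Suc)
        moreover have "(deriv ^^ Suc j) f 0 / fact (Suc j) * (real (Suc j) * z ^ j) = (deriv ^^ j) (deriv f) 0 / fact j * z ^ j" for j
          unfolding pow by (simp only: fact_Suc) (simp del: funpow.simps)
        ultimately show ?thesis
          unfolding sum.atMost_Suc_shift[of _ "Suc k"] by (simp only: add_0)
      qed
      ultimately show ?thesis
        by (intro DERIV_subset[OF DERIV_diff]) auto
    qed
    have "norm (?R x - ?R 0) \<le> \<epsilon> * \<bar>x\<bar> ^ Suc k * norm (x - 0)"
    proof (rule field_differentiable_bound)
      show "(?R has_field_derivative
          deriv f z - ?T z) (at z within {-\<bar>x\<bar>..\<bar>x\<bar>})"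
        if "z \<in> {-\<bar>x\<bar>..\<bar>x\<bar>}" for z
        using that x by (intro deriv) auto
      show "norm (deriv f z - ?T z) \<le> \<epsilon> * \<bar>x\<bar> ^ Suc k"
        if z: "z \<in> {-\<bar>x\<bar>..\<bar>x\<bar>}" for z
      proof -
        have "\<bar>z\<bar> \<le> \<bar>x\<bar>" using z by auto
        then have "\<epsilon> * \<bar>z\<bar> ^ Suc k \<le> \<epsilon> * \<bar>x\<bar> ^ Suc k"
          using \<open>0 < \<epsilon>\<close> by (intro mult_left_mono power_mono) auto
        then show ?thesis
          using \<delta>(3)[of z] \<open>\<bar>z\<bar> \<le> \<bar>x\<bar>\<close> x by simp
      qed
    qed auto
    moreover have "?R 0 = 0"
      by (simp add: sum.atMost_Suc_shift del: sum.atMost_Suc)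
    ultimately show ?thesis
      by (simp only: diff_zero real_norm_def power_Suc mult_ac)
  qed
  then show ?case
    unfolding eventually_nhds_metric
    by (intro exI[of _ \<delta>]) (use \<delta>(1) in \<open>simp only: dist_real_def diff_zero, blast\<close>)
qed

text \<open>The arguments of \<open>f\<close> are \<kappa> times an inner product of unit vectors,
  so a property near 0 eventually holds uniformly over the sphere.\<close>

lemma eventually_nhds_0_scaled:
  fixes \<kappa> :: "nat \<Rightarrow> real"
  assumes "\<forall>\<^sub>F x in nhds 0. P x" "\<kappa> \<longlonglongrightarrow> 0"
  shows "\<forall>\<^sub>F n in sequentially. \<forall>s. \<bar>s\<bar> \<le> 1 \<longrightarrow> P (\<kappa> n * s)"
proof -
  obtain \<delta> where \<delta>: "\<delta> > 0" "\<And>x. \<bar>x\<bar> < \<delta> \<Longrightarrow> P x"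
    using assms(1) unfolding eventually_nhds_metric by (auto simp: dist_real_def)
  have "\<forall>\<^sub>F n in sequentially. \<bar>\<kappa> n\<bar> < \<delta>"
    using tendstoD[OF assms(2) \<open>\<delta> > 0\<close>] by (simp add: dist_real_def)
  then show ?thesis
  proof eventually_elim
    case (elim n)
    have "\<bar>\<kappa> n * s\<bar> < \<delta>" if "\<bar>s\<bar> \<le> 1" for s
      using mult_left_mono[OF that, of "\<bar>\<kappa> n\<bar>"] elim by (simp add: abs_mult)
    then show ?case using \<delta>(2) by blast
  qed
qed

lemma integral_sphere_unif_bound:
  fixes g :: "real ^ 'p::{finite,wellorder} \<Rightarrow> real"
  assumes "g \<in> borel_measurable sphere_unif" "\<And>x. norm x = 1 \<Longrightarrow> \<bar>g x\<bar> \<le> B"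
  shows "\<bar>\<integral>x. g x \<partial>sphere_unif\<bar> \<le> B"
proof -
  have "\<bar>\<integral>x. g x \<partial>sphere_unif\<bar> \<le> (\<integral>x. \<bar>g x\<bar> \<partial>sphere_unif)"
    by (rule integral_abs_bound)
  also have "\<dots> \<le> (\<integral>x. B \<partial>(sphere_unif :: (real ^ 'p::_) measure))"
    using sphere_unif_integrable[OF assms] assms(2) by (intro integral_mono) auto
  finally show ?thesis by (simp add: sphere_unif.prob_space del: space_sphere_unif)
qed

text \<open>\<open>1 \<le> K\<close> makes \<open>f\<close> continuous at 0, hence close to 1 on the
  shrinking interval seen by the sphere; this is what makes the observation laws proper for large
  \<open>n\<close>.\<close>

locale shrinking_angular =
  fixes f :: "real \<Rightarrow> real" and \<kappa> :: "nat \<Rightarrow> real" and K :: nat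
  assumes f: "angular_function f" "times_differentiable_at K f 0" and K: "1 \<le> K"
    and \<kappa>: "\<And>n. n \<ge> 1 \<Longrightarrow> \<kappa> n > 0" "\<kappa> \<longlonglongrightarrow> 0"
begin

lemma f_props: "f \<in> borel_measurable borel" "0 \<le> f x" "f 0 = 1"
  using f(1) by (auto simp: angular_function_def)

lemma f_near_1:
  assumes "0 < \<epsilon>"
  shows "\<forall>\<^sub>F n in sequentially. \<forall>s. \<bar>s\<bar> \<le> 1 \<longrightarrow> \<bar>f (\<kappa> n * s) - 1\<bar> \<le> \<epsilon>"
proof -
  have "f differentiable (at 0)"
    using f(2) K by (auto simp: times_differentiable_at_def)
  then have "isCont f 0"
    by (metis differentiable_imp_continuous_within)
  then have "(f \<longlongrightarrow> 1) (nhds 0)"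
    by (simp add: isCont_def f_props(3) tendsto_nhds_iff)
  from tendstoD[OF this assms] have "\<forall>\<^sub>F x in nhds 0. \<bar>f x - 1\<bar> \<le> \<epsilon>"
    by eventually_elim (simp add: dist_real_def)
  then show ?thesis using \<kappa>(2) by (rule eventually_nhds_0_scaled)
qed

lemma f_inner_measurable: "(\<lambda>u. f (c * (u \<bullet> theta0))) \<in> borel_measurable (sphere_unif :: (real ^ 'p::{finite,wellorder}) measure)"
  by (intro sphere_unif_measurableI measurable_compose[OF _ f_props(1)] borel_measurable_continuous_onI continuous_intros)

definition unnormalized_mean :: "(real ^ 'p::{finite,wellorder} \<Rightarrow> real) \<Rightarrow> nat \<Rightarrow> real" where
  "unnormalized_mean g n = (\<integral>u. f (\<kappa> n * (u \<bullet> theta0)) * g u \<partial>sphere_unif)"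

lemma f_inner_bound:
  assumes "\<forall>s. \<bar>s\<bar> \<le> 1 \<longrightarrow> \<bar>f (\<kappa> n * s) - 1\<bar> \<le> \<epsilon>" "norm (u :: real ^ 'p::{finite,wellorder}) = 1"
  shows "\<bar>f (\<kappa> n * (u \<bullet> theta0)) - 1\<bar> \<le> \<epsilon>"
  using assms sphere_inner_bound[OF assms(2), of theta0] by simp

lemma unnormalized_mean_tendsto:
  fixes g :: "real ^ 'p::{finite,wellorder} \<Rightarrow> real"
  assumes g: "g \<in> borel_measurable sphere_unif" "\<And>x. norm x = 1 \<Longrightarrow> \<bar>g x\<bar> \<le> B"
  shows "unnormalized_mean g \<longlonglongrightarrow> (\<integral>u. g u \<partial>sphere_unif)"
proof (rule LIMSEQ_I)
  fix r :: real assume "r > 0"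
  have "0 \<le> B" using g(2)[of theta0] by simp
  define \<epsilon> where "\<epsilon> = min 1 (r / (2 * (B + 1)))"
  have \<epsilon>: "0 < \<epsilon>" "\<epsilon> * B < r"
  proof -
    show "0 < \<epsilon>" using \<open>0 \<le> B\<close> \<open>r > 0\<close> by (simp add: \<epsilon>_def)
    have "\<epsilon> * B \<le> r / (2 * (B + 1)) * B"
      using \<open>0 \<le> B\<close> by (intro mult_right_mono) (auto simp: \<epsilon>_def)
    also have "\<dots> < r"
      using \<open>0 \<le> B\<close> \<open>r > 0\<close> by (simp add: divide_less_eq algebra_simps add_nonneg_pos)
    finally show "\<epsilon> * B < r" .
  qed
  have "\<forall>\<^sub>F n in sequentially. norm (unnormalized_mean g n - (\<integral>u. g u \<partial>sphere_unif)) < r"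
    using f_near_1[OF \<epsilon>(1)]
  proof eventually_elim
    case (elim n)
    note bnd = f_inner_bound[OF elim]
    have "integrable sphere_unif (\<lambda>u. f (\<kappa> n * (u \<bullet> theta0)) * g u)"
    proof (rule sphere_unif_integrable[where B = "(1 + \<epsilon>) * B"])
      show "\<bar>f (\<kappa> n * (u \<bullet> theta0)) * g u\<bar> \<le> (1 + \<epsilon>) * B" if "norm u = 1" for u
        unfolding abs_mult using bnd[OF that] g(2)[OF that] by (intro mult_mono) auto
    qed (intro borel_measurable_times f_inner_measurable g)
    then have "unnormalized_mean g n - (\<integral>u. g u \<partial>sphere_unif) = (\<integral>u. (f (\<kappa> n * (u \<bullet> theta0)) - 1) * g u \<partial>sphere_unif)"
      unfolding unnormalized_mean_def using sphere_unif_integrable[OF g] by (simp add: left_diff_distrib)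
    also have "\<bar>\<dots>\<bar> \<le> \<epsilon> * B"
    proof (rule integral_sphere_unif_bound)
      show "\<bar>(f (\<kappa> n * (u \<bullet> theta0)) - 1) * g u\<bar> \<le> \<epsilon> * B" if "norm u = 1" for u
        unfolding abs_mult using bnd[OF that] g(2)[OF that] \<epsilon>(1) by (intro mult_mono) auto
    qed (intro borel_measurable_times borel_measurable_diff f_inner_measurable g borel_measurable_const)
    finally show ?case using \<epsilon>(2) by simp
  qed
  then show "\<exists>no. \<forall>n\<ge>no. norm (unnormalized_mean g n - (\<integral>u. g u \<partial>sphere_unif)) < r"
    by (simp add: eventually_sequentially)
qed

lemma unnormalized_mean_1: "unnormalized_mean (\<lambda>_ :: real ^ 'p::{finite,wellorder}. 1) \<longlonglongrightarrow> 1"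
  using unnormalized_mean_tendsto[of "\<lambda>_ :: real ^ 'p::_. 1" 1]
  by (simp add: sphere_unif.prob_space del: space_sphere_unif)

text \<open>The normalising integral tends to 1, so it is eventually positive, and boundedness of
  \<open>f\<close> near 0 makes it finite.\<close>

lemma angular_law_eventually:
  "\<forall>\<^sub>F n in sequentially. prob_space (angular_law (\<kappa> n) f :: (real ^ 'p::{finite,wellorder}) measure) \<and>
    sets (angular_law (\<kappa> n) f :: (real ^ 'p::{finite,wellorder}) measure) = sets sphere_unif \<and>
    (\<forall>g\<in>borel_measurable (sphere_unif :: (real ^ 'p::{finite,wellorder}) measure).
      (\<integral>u. g u \<partial>angular_law (\<kappa> n) f) = unnormalized_mean g n / unnormalized_mean (\<lambda>_ :: real ^ 'p::_. 1) n)"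
proof -
  have "\<forall>\<^sub>F n in sequentially. unnormalized_mean (\<lambda>_ :: real ^ 'p::_. 1) n > 0"
    by (rule order_tendstoD(1)[OF unnormalized_mean_1]) simp
  then show ?thesis
    using f_near_1[of 1, OF zero_less_one]
  proof eventually_elim
    case (elim n)
    let ?F = "\<lambda>u :: real ^ 'p::_. f (\<kappa> n * (u \<bullet> theta0))" and ?Z = "unnormalized_mean (\<lambda>_ :: real ^ 'p::_. 1) n"
    have Z: "?Z = (\<integral>u. ?F u \<partial>sphere_unif)" by (simp add: unnormalized_mean_def)
    have bnd: "f (\<kappa> n * s) \<le> 2" if "\<bar>s\<bar> \<le> 1" for s
      using elim(2) that by (auto dest!: spec[of _ s])
    have law: "angular_law (\<kappa> n) f = density sphere_unif (\<lambda>u. ennreal (?F u / ?Z))"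
      unfolding Z by (rule angular_law_eq[where B = 2]) (use f_props bnd elim(1) Z in auto)
    have [measurable]: "?F \<in> borel_measurable sphere_unif" by (rule f_inner_measurable)
    have int: "integrable sphere_unif ?F"
      by (rule sphere_unif_integrable[where B = 2]) (auto simp: f_props intro!: bnd sphere_inner_bound)
    have "emeasure (angular_law (\<kappa> n) f) (space (angular_law (\<kappa> n) f :: (real ^ 'p::_) measure)) = (\<integral>\<^sup>+u. ennreal (?F u / ?Z) \<partial>sphere_unif)"
      unfolding law space_density
      by (subst emeasure_density) (auto intro!: nn_integral_cong simp del: space_sphere_unif sets_sphere_unif)
    also have "\<dots> = ennreal (\<integral>u. ?F u / ?Z \<partial>sphere_unif)"
      using int elim(1) f_props by (intro nn_integral_eq_integral) auto
    also have "\<dots> = 1"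
      using elim(1) by (simp flip: Z)
    finally have "prob_space (angular_law (\<kappa> n) f :: (real ^ 'p::_) measure)"
      by (rule prob_spaceI)
    moreover have "(\<integral>u. g u \<partial>angular_law (\<kappa> n) f) = unnormalized_mean g n / ?Z"
      if [measurable]: "g \<in> borel_measurable (sphere_unif :: (real ^ 'p::_) measure)" for g
      unfolding law using elim(1) f_props by (subst integral_density) (auto simp: unnormalized_mean_def)
    moreover have "sets (angular_law (\<kappa> n) f :: (real ^ 'p::_) measure) = sets sphere_unif"
      unfolding law by simp
    ultimately show ?case by blast
  qed
qed

lemma angular_mean_tendsto:
  fixes g :: "real ^ 'p::{finite,wellorder} \<Rightarrow> real"
  assumes g: "g \<in> borel_measurable sphere_unif" "\<And>x. norm x = 1 \<Longrightarrow> \<bar>g x\<bar> \<le> B"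
  shows "(\<lambda>n. \<integral>u. g u \<partial>angular_law (\<kappa> n) f) \<longlonglongrightarrow> (\<integral>u. g u \<partial>sphere_unif)"
proof -
  have "(\<lambda>n. unnormalized_mean g n / unnormalized_mean (\<lambda>_ :: real ^ 'p::_. 1) n) \<longlonglongrightarrow> (\<integral>u. g u \<partial>sphere_unif) / 1"
    by (intro tendsto_divide unnormalized_mean_tendsto[OF g] unnormalized_mean_1) auto
  then show ?thesis
    unfolding div_by_1
    by (rule Lim_transform_eventually)
      (use angular_law_eventually[where 'p = 'p] in \<open>eventually_elim, use g in auto\<close>)
qed

text \<open>All Taylor terms of order below \<open>k\<close>, the constant one included, integrate
  to 0 against \<open>g\<close>. The remainder is o(\<kappa>^k) uniformly on the sphere, and the
  normalisation, tending to 1, does not affect the leading term.\<close>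

lemma angular_mean_expansion:
  fixes g :: "real ^ 'p::{finite,wellorder} \<Rightarrow> real"
  assumes g: "g \<in> borel_measurable sphere_unif" "\<And>x. norm x = 1 \<Longrightarrow> \<bar>g x\<bar> \<le> B"
    and k: "1 \<le> k" "k \<le> K"
    and orth: "\<And>j. j < k \<Longrightarrow> (\<integral>u. (theta0 \<bullet> u) ^ j * g u \<partial>sphere_unif) = 0"
  shows "(\<lambda>n. (\<integral>u. g u \<partial>angular_law (\<kappa> n) f) / \<kappa> n ^ k)
    \<longlonglongrightarrow> (deriv ^^ k) f 0 / fact k * (\<integral>u. (theta0 \<bullet> u) ^ k * g u \<partial>sphere_unif)"
proof -
  let ?m = "\<lambda>j. \<integral>u. (theta0 \<bullet> u) ^ j * g u \<partial>sphere_unif"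
  let ?D = "(deriv ^^ k) f 0 / fact k * ?m k"
  have "0 \<le> B" using g(2)[of theta0] by simp
  obtain l where l: "k = Suc l" using k by (cases k) auto
  have "(\<lambda>n. unnormalized_mean g n / \<kappa> n ^ k) \<longlonglongrightarrow> ?D"
  proof (rule LIMSEQ_I)
    fix r :: real assume "r > 0"
    define \<epsilon> where "\<epsilon> = r / (2 * (B + 1))"
    have \<epsilon>: "0 < \<epsilon>" "\<epsilon> * B < r"
      using \<open>0 \<le> B\<close> \<open>r > 0\<close> by (auto simp: \<epsilon>_def divide_less_eq algebra_simps add_nonneg_pos)
    have "times_differentiable_at (Suc l) f 0"
      using times_differentiable_at_mono[OF f(2) k(2)] l by simp
    from eventually_nhds_0_scaled[OF Taylor_Peano[OF this \<epsilon>(1)] \<kappa>(2)]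
    have "\<forall>\<^sub>F n in sequentially. \<forall>s. \<bar>s\<bar> \<le> 1 \<longrightarrow>
        \<bar>f (\<kappa> n * s) - (\<Sum>j\<le>k. (deriv ^^ j) f 0 / fact j * (\<kappa> n * s) ^ j)\<bar> \<le> \<epsilon> * \<bar>\<kappa> n * s\<bar> ^ k"
      unfolding l .
    then have "\<forall>\<^sub>F n in sequentially. norm (unnormalized_mean g n / \<kappa> n ^ k - ?D) < r"
      using f_near_1[of 1, OF zero_less_one] eventually_ge_at_top[of 1]
    proof eventually_elim
      case (elim n)
      have \<kappa>n: "\<kappa> n > 0" using \<kappa>(1) elim(3) by simp
      let ?F = "\<lambda>u :: real ^ 'p::_. f (\<kappa> n * (u \<bullet> theta0))"
      let ?T = "\<lambda>u :: real ^ 'p::_. \<Sum>j\<le>k. (deriv ^^ j) f 0 / fact j * (\<kappa> n * (u \<bullet> theta0)) ^ j"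
      have int: "integrable sphere_unif (\<lambda>u. (theta0 \<bullet> u) ^ j * g u)" for j
      proof (rule sphere_unif_integrable[where B = B])
        fix u :: "real ^ 'p::_" assume "norm u = 1"
        then have "\<bar>(theta0 \<bullet> u) ^ j\<bar> \<le> 1"
          using sphere_inner_bound[of theta0 u] by (simp add: power_abs power_le_one)
        then show "\<bar>(theta0 \<bullet> u) ^ j * g u\<bar> \<le> B"
          unfolding abs_mult using mult_mono[of "\<bar>(theta0 \<bullet> u) ^ j\<bar>" 1 "\<bar>g u\<bar>" B] g(2)[OF \<open>norm u = 1\<close>] by simp
      qed (intro borel_measurable_times g sphere_unif_measurableI borel_measurable_continuous_onI continuous_intros)
      have T: "?T u * g u = (\<Sum>j\<le>k. ((deriv ^^ j) f 0 / fact j * \<kappa> n ^ j) * ((theta0 \<bullet> u) ^ j * g u))" for u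
        unfolding sum_distrib_right by (intro sum.cong refl) (simp add: power_mult_distrib inner_commute mult_ac)
      have int_T: "integrable sphere_unif (\<lambda>u. ?T u * g u)"
        unfolding T using int by auto
      have "(\<integral>u. ?T u * g u \<partial>sphere_unif) = (\<Sum>j\<le>k. ((deriv ^^ j) f 0 / fact j * \<kappa> n ^ j) * ?m j)"
        unfolding T using int by (subst Bochner_Integration.integral_sum) auto
      also have "\<dots> = (\<Sum>j\<le>k. if j = k then ((deriv ^^ k) f 0 / fact k * \<kappa> n ^ k) * ?m k else 0)"
        by (intro sum.cong) (auto simp: orth)
      also have "\<dots> = ?D * \<kappa> n ^ k"
        by simp
      finally have T_int: "(\<integral>u. ?T u * g u \<partial>sphere_unif) = ?D * \<kappa> n ^ k" .
      have int_F: "integrable sphere_unif (\<lambda>u. ?F u * g u)"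
      proof (rule sphere_unif_integrable[where B = "2 * B"])
        show "\<bar>?F u * g u\<bar> \<le> 2 * B" if "norm u = 1" for u
          unfolding abs_mult using f_inner_bound[OF elim(2) that] g(2)[OF that] by (intro mult_mono) auto
      qed (intro borel_measurable_times f_inner_measurable g)
      have "unnormalized_mean g n - ?D * \<kappa> n ^ k = (\<integral>u. (?F u - ?T u) * g u \<partial>sphere_unif)"
        unfolding unnormalized_mean_def T_int[symmetric] left_diff_distrib
        using int_F int_T by simp
      also have "\<bar>\<dots>\<bar> \<le> \<epsilon> * \<kappa> n ^ k * B"
      proof (rule integral_sphere_unif_bound)
        fix u :: "real ^ 'p::_" assume u: "norm u = 1"
        have s: "\<bar>u \<bullet> theta0\<bar> \<le> 1" using u by (intro sphere_inner_bound) auto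
        then have "\<bar>?F u - ?T u\<bar> \<le> \<epsilon> * \<bar>\<kappa> n * (u \<bullet> theta0)\<bar> ^ k"
          using elim(1) by blast
        also have "\<dots> \<le> \<epsilon> * \<kappa> n ^ k"
          using s \<kappa>n \<epsilon>(1) by (intro mult_left_mono power_mono) (auto simp: abs_mult mult_left_le)
        finally show "\<bar>(?F u - ?T u) * g u\<bar> \<le> \<epsilon> * \<kappa> n ^ k * B"
          unfolding abs_mult using g(2)[OF u] \<kappa>n \<epsilon>(1) by (intro mult_mono) auto
      next
        have "?T \<in> borel_measurable sphere_unif"
          by (intro sphere_unif_measurableI borel_measurable_continuous_onI continuous_intros)
        then show "(\<lambda>u. (?F u - ?T u) * g u) \<in> borel_measurable sphere_unif"
          by (intro borel_measurable_times borel_measurable_diff f_inner_measurable g)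
      qed
      finally have "\<bar>unnormalized_mean g n - ?D * \<kappa> n ^ k\<bar> \<le> \<epsilon> * B * \<kappa> n ^ k"
        by (simp add: mult_ac)
      then have "\<bar>unnormalized_mean g n - ?D * \<kappa> n ^ k\<bar> / \<kappa> n ^ k \<le> \<epsilon> * B"
        using \<kappa>n by (simp add: pos_divide_le_eq)
      moreover have "unnormalized_mean g n / \<kappa> n ^ k - ?D = (unnormalized_mean g n - ?D * \<kappa> n ^ k) / \<kappa> n ^ k"
        using \<kappa>n by (simp add: diff_divide_distrib)
      ultimately show ?case
        using \<epsilon>(2) \<kappa>n by (simp only: real_norm_def abs_divide) simp
    qed
    then show "\<exists>no. \<forall>n\<ge>no. norm (unnormalized_mean g n / \<kappa> n ^ k - ?D) < r"
      by (simp add: eventually_sequentially)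
  qed
  then have "(\<lambda>n. unnormalized_mean g n / \<kappa> n ^ k / unnormalized_mean (\<lambda>_ :: real ^ 'p::_. 1) n) \<longlonglongrightarrow> ?D / 1"
    by (intro tendsto_divide unnormalized_mean_1) auto
  then show ?thesis
    unfolding div_by_1
    by (rule Lim_transform_eventually)
      (use angular_law_eventually[where 'p = 'p] in \<open>eventually_elim, use g in \<open>auto simp: field_simps\<close>\<close>)
qed

end

section \<open>Spherical harmonics\<close>

lemma h_fun_eq_poly:
  "2 \<le> p \<Longrightarrow> h_fun p k s = poly (smult (zonal_factor ((real p - 2) / 2) k) (gegenbauer ((real p - 2) / 2) k)) s"
  by (simp add: h_fun_eq)

lemma Funk_Hecke_h_fun:
  fixes \<phi> :: "real poly" and u w :: "real ^ 'p::{finite,wellorder}"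
  assumes dim: "2 \<le> CARD('p)" and uw: "norm u = 1" "norm w = 1"
  defines "C \<equiv> gegenbauer ((real CARD('p) - 2) / 2)"
  shows "(\<integral>x. poly \<phi> (u \<bullet> x) * h_fun CARD('p) k (w \<bullet> x) \<partial>sphere_unif)
    = axial_mean TYPE('p) (\<phi> * C k) / poly (C k) 1 * h_fun CARD('p) k (u \<bullet> w)"
  unfolding h_fun_eq[OF dim] C_def[symmetric] mult.left_commute[of _ "zonal_factor _ k"]
    Bochner_Integration.integral_mult_right_zero Funk_Hecke_gegenbauer[OF dim uw, of \<phi> k, folded C_def] ..

text \<open>Convolving \<open>h_fun\<close> with itself multiplies it by the Funk-Hecke eigenvalue,
  which \<open>L_gegenbauer_norm\<close> identifies as 1.\<close>

lemma h_fun_projection_kernel: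
  assumes dim: "2 \<le> CARD('p::{finite,wellorder})" and k: "1 \<le> k"
  shows "projection_kernel sphere_unif (\<lambda>x y :: real ^ 'p::_. h_fun CARD('p) k (x \<bullet> y))"
proof -
  let ?\<nu> = "(real CARD('p) - 2) / 2"
  let ?c = "zonal_factor ?\<nu> k" and ?C = "gegenbauer ?\<nu> k"
  interpret axial_functional "axial_mean TYPE('p)" ?\<nu>
    by (rule axial_functional_axial_mean[OF dim])
  have idem: "(\<integral>z. h_fun CARD('p) k (z \<bullet> x) * h_fun CARD('p) k (z \<bullet> y) \<partial>sphere_unif) = h_fun CARD('p) k (x \<bullet> y)"
    if "norm x = 1" "norm y = 1" for x y :: "real ^ 'p::_"
  proof -
    have "axial_mean TYPE('p) (smult ?c ?C * ?C) / poly ?C 1 = 1"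
      using L_gegenbauer_norm[OF k] gegenbauer_at_1_pos[OF \<nu>, of k] by (simp add: L_smult)
    then show ?thesis
      using Funk_Hecke_h_fun[OF dim that, of "smult ?c ?C" k]
      unfolding h_fun_eq_poly[OF dim, symmetric] by (simp add: inner_commute)
  qed
  obtain B where B: "\<And>t. \<bar>t\<bar> \<le> 1 \<Longrightarrow> \<bar>poly (smult ?c ?C) t\<bar> \<le> B"
    using poly_bounded_Icc by metis
  show ?thesis
    unfolding projection_kernel_def
  proof (intro conjI ballI)
    show "\<exists>B. \<forall>x\<in>space sphere_unif. \<forall>y\<in>space sphere_unif. \<bar>h_fun CARD('p) k (x \<bullet> y :: real)\<bar> \<le> B"
      unfolding h_fun_eq_poly[OF dim]
      by (intro exI[of _ B] ballI B sphere_inner_bound) auto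
    fix x y :: "real ^ 'p::_" assume "x \<in> space sphere_unif" "y \<in> space sphere_unif"
    then show "(\<integral>z. h_fun CARD('p) k (z \<bullet> x) * h_fun CARD('p) k (z \<bullet> y) \<partial>sphere_unif) = h_fun CARD('p) k (x \<bullet> y)"
      by (intro idem) auto
    show "h_fun CARD('p) k (x \<bullet> y) = h_fun CARD('p) k (y \<bullet> x)"
      by (simp add: inner_commute)
  qed (auto simp: h_fun_eq_poly[OF dim]
      intro!: sphere_unif_measurableI borel_measurable_continuous_onI continuous_intros)
qed

text \<open>An orthonormal basis of the spherical harmonics of degree \<open>k\<close>; the last clause is the addition
  theorem.\<close>

definition harmonic_basis ::
  "nat \<Rightarrow> (nat \<Rightarrow> real ^ 'p::{finite,wellorder} \<Rightarrow> real) \<Rightarrow> bool" where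
  "harmonic_basis k g \<longleftrightarrow>
    (\<forall>r<d_const CARD('p) k. g r \<in> borel_measurable sphere_unif) \<and>
    (\<forall>r<d_const CARD('p) k. \<forall>s<d_const CARD('p) k.
      (\<integral>x. g r x * g s x \<partial>sphere_unif) = (if r = s then 1 else 0)) \<and>
    (\<forall>x y. norm x = 1 \<longrightarrow> norm y = 1 \<longrightarrow> h_fun CARD('p) k (x \<bullet> y) = (\<Sum>r<d_const CARD('p) k. g r x * g r y))"

text \<open>The trace is the constant h_k(1), equal to the natural number \<open>d_const\<close>, as
  the decomposition of projection kernels requires.\<close>

lemma harmonic_basis_exists:
  assumes dim: "2 \<le> CARD('p::{finite,wellorder})" and k: "1 \<le> k"
  shows "\<exists>g :: nat \<Rightarrow> real ^ 'p::_ \<Rightarrow> real. harmonic_basis k g"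
proof -
  have "(\<integral>x. h_fun CARD('p) k (x \<bullet> x) \<partial>(sphere_unif :: (real ^ 'p::_) measure))
      = (\<integral>x. real (d_const CARD('p) k) \<partial>(sphere_unif :: (real ^ 'p::_) measure))"
    by (intro Bochner_Integration.integral_cong) (auto simp: dot_square_norm h_fun_at_1[OF dim k])
  also have "\<dots> = real (d_const CARD('p) k)"
    by (simp add: sphere_unif.prob_space del: space_sphere_unif)
  finally obtain g :: "nat \<Rightarrow> real ^ 'p::_ \<Rightarrow> real" where
    "(\<forall>r<d_const CARD('p) k. g r \<in> borel_measurable sphere_unif \<and> (\<exists>B. \<forall>x\<in>space sphere_unif. \<bar>g r x\<bar> \<le> B)) \<and>
    (\<forall>r<d_const CARD('p) k. \<forall>s<d_const CARD('p) k. (\<integral>x. g r x * g s x \<partial>sphere_unif) = (if r = s then 1 else 0)) \<and>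
    (\<forall>x\<in>space sphere_unif. \<forall>y\<in>space sphere_unif. h_fun CARD('p) k (x \<bullet> y) = (\<Sum>r<d_const CARD('p) k. g r x * g r y))"
    using sphere_unif.projection_kernel_decomposition[OF h_fun_projection_kernel[OF dim k]] by blast
  then show ?thesis
    by (intro exI[of _ g]) (simp add: harmonic_basis_def)
qed

section \<open>Funk-Hecke formula and axial moments for a harmonic basis\<close>

context
  fixes k :: nat and g :: "nat \<Rightarrow> real ^ 'p::{finite,wellorder} \<Rightarrow> real"
  assumes dim: "2 \<le> CARD('p)" and k: "1 \<le> k" and g: "harmonic_basis k g"
begin

lemma harmonic_measurable: "r < d_const CARD('p) k \<Longrightarrow> g r \<in> borel_measurable sphere_unif"
  and harmonic_orthonormal: "r < d_const CARD('p) k \<Longrightarrow> s < d_const CARD('p) k \<Longrightarrow>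
    (\<integral>x. g r x * g s x \<partial>sphere_unif) = (if r = s then 1 else 0)"
  and harmonic_sum: "norm x = 1 \<Longrightarrow> norm y = 1 \<Longrightarrow>
    (\<Sum>r<d_const CARD('p) k. g r x * g r y) = h_fun CARD('p) k (x \<bullet> y)"
  using g unfolding harmonic_basis_def by auto

lemma harmonic_sum_squares: "norm x = 1 \<Longrightarrow> (\<Sum>r<d_const CARD('p) k. (g r x)\<^sup>2) = real (d_const CARD('p) k)"
  using harmonic_sum[of x x] h_fun_at_1[OF dim k] by (simp add: power2_eq_square dot_square_norm)

lemma harmonic_bound:
  assumes "r < d_const CARD('p) k" "norm x = 1"
  shows "\<bar>g r x\<bar> \<le> sqrt (real (d_const CARD('p) k))"
proof -
  have "(g r x)\<^sup>2 \<le> (\<Sum>r<d_const CARD('p) k. (g r x)\<^sup>2)"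
    using assms(1) by (intro member_le_sum) auto
  then show ?thesis
    using harmonic_sum_squares[OF assms(2)] by (simp add: real_le_rsqrt abs_le_square_iff)
qed

text \<open>Expanding the kernel in the basis turns its Funk-Hecke formula into an equality of two
  expansions; integration against \<open>g r\<close> compares their coefficients.\<close>

lemma Funk_Hecke_harmonic:
  assumes r: "r < d_const CARD('p) k" and u: "norm u = 1"
  defines "C \<equiv> gegenbauer ((real CARD('p) - 2) / 2)"
  shows "(\<integral>x. poly \<phi> (u \<bullet> x) * g r x \<partial>sphere_unif) = axial_mean TYPE('p) (\<phi> * C k) / poly (C k) 1 * g r u"
proof -
  let ?d = "d_const CARD('p) k"
  let ?l = "axial_mean TYPE('p) (\<phi> * C k) / poly (C k) 1"
  let ?I = "\<lambda>s. \<integral>x. poly \<phi> (u \<bullet> x) * g s x \<partial>sphere_unif"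
  obtain B where B: "\<And>t. \<bar>t\<bar> \<le> 1 \<Longrightarrow> \<bar>poly \<phi> t\<bar> \<le> B"
    using poly_bounded_Icc by metis
  have int: "integrable sphere_unif (\<lambda>x. poly \<phi> (u \<bullet> x) * g s x)" if "s < ?d" for s
  proof (rule sphere_unif.integrable_mult_bounded[where A = B and B = "sqrt (real ?d)"])
    show "(\<lambda>x. poly \<phi> (u \<bullet> x)) \<in> borel_measurable sphere_unif"
      by (intro sphere_unif_measurableI borel_measurable_continuous_onI continuous_intros)
  qed (use that u in \<open>auto intro!: B sphere_inner_bound harmonic_bound harmonic_measurable\<close>)
  have int_gg: "integrable sphere_unif (\<lambda>x. g s x * g t x)" if "s < ?d" "t < ?d" for s t
    by (rule sphere_unif.integrable_mult_bounded[where A = "sqrt (real ?d)" and B = "sqrt (real ?d)"])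
      (use that in \<open>auto intro!: harmonic_bound harmonic_measurable\<close>)
  have eq: "(\<Sum>s<?d. ?I s * g s w) = (\<Sum>s<?d. (?l * g s u) * g s w)" if w: "norm w = 1" for w
  proof -
    have "(\<integral>x. poly \<phi> (u \<bullet> x) * h_fun CARD('p) k (w \<bullet> x) \<partial>sphere_unif)
        = (\<integral>x. (\<Sum>s<?d. (poly \<phi> (u \<bullet> x) * g s x) * g s w) \<partial>sphere_unif)"
      by (intro Bochner_Integration.integral_cong)
        (auto simp: harmonic_sum[OF w, symmetric] sum_distrib_left mult_ac)
    also have "\<dots> = (\<Sum>s<?d. ?I s * g s w)"
      using int by (subst Bochner_Integration.integral_sum) auto
    finally show ?thesis
      using Funk_Hecke_h_fun[OF dim u w, of \<phi> k] unfolding C_def[symmetric] harmonic_sum[OF u w, symmetric]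
      by (simp add: sum_distrib_left mult_ac)
  qed
  have project: "(\<integral>w. (\<Sum>s<?d. a s * g s w) * g r w \<partial>sphere_unif) = a r" for a
  proof -
    have "(\<integral>w. (\<Sum>s<?d. a s * g s w) * g r w \<partial>sphere_unif) = (\<integral>w. (\<Sum>s<?d. a s * (g s w * g r w)) \<partial>sphere_unif)"
      by (simp add: sum_distrib_right mult.assoc)
    also have "\<dots> = (\<Sum>s<?d. a s * (if s = r then 1 else 0))"
      using int_gg r by (subst Bochner_Integration.integral_sum) (auto simp: harmonic_orthonormal intro!: sum.cong)
    also have "\<dots> = a r"
      using r by (simp add: if_distrib[of "(*) _"] cong: if_cong)
    finally show ?thesis .
  qed
  have "?I r = (\<integral>w. (\<Sum>s<?d. ?I s * g s w) * g r w \<partial>sphere_unif)"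
    by (rule project[symmetric])
  also have "\<dots> = (\<integral>w. (\<Sum>s<?d. (?l * g s u) * g s w) * g r w \<partial>sphere_unif)"
    by (intro Bochner_Integration.integral_cong) (simp_all only: eq space_sphere_unif mem_sphere_0)
  also have "\<dots> = ?l * g r u"
    by (rule project)
  finally show ?thesis .
qed

text \<open>By orthogonality only the top term of the expansion of t^k survives, with coefficient
  \<open>monomial_coeff\<close>; \<open>L_gegenbauer_norm\<close> supplies the reciprocal of the
  zonal factor.\<close>

lemma axial_mean_monom_gegenbauer:
  defines "C \<equiv> gegenbauer ((real CARD('p) - 2) / 2)"
  shows "j < k \<Longrightarrow> axial_mean TYPE('p) (monom 1 j * C k) = 0"
    and "axial_mean TYPE('p) (monom 1 k * C k) / poly (C k) 1
      = monomial_coeff CARD('p) k k / zonal_factor ((real CARD('p) - 2) / 2) k"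
proof -
  let ?\<nu> = "(real CARD('p) - 2) / 2"
  interpret axial_functional "axial_mean TYPE('p)" ?\<nu>
    by (rule axial_functional_axial_mean[OF dim])
  show "j < k \<Longrightarrow> axial_mean TYPE('p) (monom 1 j * C k) = 0"
    unfolding C_def by (rule L_gegenbauer_lower_degree) (simp add: degree_monom_eq)
  have deg: "degree (monom (1::real) k) \<le> k"
    by (rule degree_monom_le)
  obtain m where m: "monom 1 k = (\<Sum>i=0..k. smult (m i) (C i))"
    "\<And>i. axial_mean TYPE('p) (monom 1 k * C i) = (if i \<le> k then m i * axial_mean TYPE('p) (C i * C i) else 0)"
    using L_gegenbauer_expansion[OF deg] unfolding C_def by blast
  have "1 = (\<Sum>i=0..k. m i * coeff (C i) k)"
    using arg_cong[OF m(1), of "\<lambda>q. coeff q k"] by (simp add: coeff_sum)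
  also have "\<dots> = (\<Sum>i=0..k. if i = k then m k * coeff (C k) k else 0)"
    by (intro sum.cong refl)
      (auto simp: C_def intro!: coeff_eq_0 le_less_trans[OF coeff_gegenbauer_top(2)[OF \<nu>]])
  finally have "m k = monomial_coeff CARD('p) k k"
    unfolding monomial_coeff_top[OF dim] using coeff_gegenbauer_top(1)[OF \<nu>, of k]
    by (simp add: C_def field_simps)
  moreover have "axial_mean TYPE('p) (C k * C k) / poly (C k) 1 = 1 / zonal_factor ?\<nu> k"
    using L_gegenbauer_norm[OF k] gegenbauer_at_1_pos[OF \<nu>, of k] zonal_factor_pos[OF \<nu>, of k]
    by (simp add: C_def field_simps)
  ultimately show "axial_mean TYPE('p) (monom 1 k * C k) / poly (C k) 1 = monomial_coeff CARD('p) k k / zonal_factor ?\<nu> k"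
    using m(2)[of k] by (metis order_refl times_divide_eq_right mult.right_neutral)
qed

text \<open>The squares of these top moments, summed over \<open>r\<close>, equal the squared
  \<open>monomial_coeff\<close> over the squared \<open>t_const\<close>; this is how these constants
  enter \<xi>.\<close>

lemma harmonic_axial_moment:
  assumes r: "r < d_const CARD('p) k"
  shows "j < k \<Longrightarrow> (\<integral>x. (theta0 \<bullet> x) ^ j * g r x \<partial>sphere_unif) = 0"
    and "(\<integral>x. (theta0 \<bullet> x) ^ k * g r x \<partial>sphere_unif)
      = monomial_coeff CARD('p) k k / zonal_factor ((real CARD('p) - 2) / 2) k * g r theta0"
  using Funk_Hecke_harmonic[OF r norm_theta0, of "monom 1 j"] Funk_Hecke_harmonic[OF r norm_theta0, of "monom 1 k"]
    axial_mean_monom_gegenbauer by (simp_all add: poly_monom)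

lemma h_fun_axial_moment:
  shows "j < k \<Longrightarrow> (\<integral>x. (theta0 \<bullet> x) ^ j * h_fun CARD('p) k (theta0 \<bullet> x) \<partial>(sphere_unif :: (real ^ 'p::_) measure)) = 0"
    and "(\<integral>x. (theta0 \<bullet> x) ^ k * h_fun CARD('p) k (theta0 \<bullet> x) \<partial>(sphere_unif :: (real ^ 'p::_) measure))
      = monomial_coeff CARD('p) k k / zonal_factor ((real CARD('p) - 2) / 2) k * real (d_const CARD('p) k)"
  using Funk_Hecke_h_fun[OF dim norm_theta0 norm_theta0, of "monom 1 j" k]
    Funk_Hecke_h_fun[OF dim norm_theta0 norm_theta0, of "monom 1 k" k]
    axial_mean_monom_gegenbauer h_fun_at_1[OF dim k] by (simp_all add: poly_monom dot_square_norm)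

end

text \<open>Convolution of \<open>g r\<close> with the kernel of degree \<open>l\<close> is computed
  twice: its Funk-Hecke eigenvalue vanishes for distinct degrees, and through the basis
  \<open>h\<close> it is the expansion whose coefficients are the inner products in
  question.\<close>

lemma harmonic_orthogonal:
  fixes g h :: "nat \<Rightarrow> real ^ 'p::{finite,wellorder} \<Rightarrow> real"
  assumes dim: "2 \<le> CARD('p)" and k: "1 \<le> k" "harmonic_basis k g" and l: "1 \<le> l" "harmonic_basis l h" and "k \<noteq> l"
    and r: "r < d_const CARD('p) k" and s: "s < d_const CARD('p) l"
  shows "(\<integral>x. g r x * h s x \<partial>sphere_unif) = 0"
proof -
  let ?\<nu> = "(real CARD('p) - 2) / 2"
  let ?d = "d_const CARD('p) l"
  interpret axial_functional "axial_mean TYPE('p)" ?\<nu>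
    by (rule axial_functional_axial_mean[OF dim])
  note G = harmonic_measurable[OF dim k] harmonic_bound[OF dim k]
  note H = harmonic_measurable[OF dim l] harmonic_bound[OF dim l]
  have int: "integrable sphere_unif (\<lambda>x. g r x * h t x)" if "t < ?d" for t
    by (rule sphere_unif.integrable_mult_bounded) (use that r in \<open>auto intro!: G H\<close>)
  have int_hh: "integrable sphere_unif (\<lambda>x. h t x * h s x)" if "t < ?d" for t
    by (rule sphere_unif.integrable_mult_bounded) (use that s in \<open>auto intro!: H\<close>)
  have zero: "(\<Sum>t<?d. (\<integral>x. g r x * h t x \<partial>sphere_unif) * h t u) = 0" if u: "norm u = 1" for u
  proof -
    let ?\<phi> = "smult (zonal_factor ?\<nu> l) (gegenbauer ?\<nu> l)"
    have "(\<Sum>t<?d. (\<integral>x. g r x * h t x \<partial>sphere_unif) * h t u) = (\<integral>x. (\<Sum>t<?d. (g r x * h t x) * h t u) \<partial>sphere_unif)"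
      using int by (subst Bochner_Integration.integral_sum) auto
    also have "\<dots> = (\<integral>x. poly ?\<phi> (u \<bullet> x) * g r x \<partial>sphere_unif)"
    proof (rule Bochner_Integration.integral_cong)
      fix x :: "real ^ 'p::_" assume "x \<in> space sphere_unif"
      then have x: "norm x = 1" by simp
      have "(\<Sum>t<?d. (g r x * h t x) * h t u) = (\<Sum>t<?d. h t u * h t x) * g r x"
        by (simp add: sum_distrib_right sum_distrib_left mult_ac)
      then show "(\<Sum>t<?d. (g r x * h t x) * h t u) = poly ?\<phi> (u \<bullet> x) * g r x"
        unfolding harmonic_sum[OF dim l u x] h_fun_eq_poly[OF dim] .
    qed simp
    also have "\<dots> = 0"
      using L_gegenbauer_orthogonal[of l k] \<open>k \<noteq> l\<close>
      by (subst Funk_Hecke_harmonic[OF dim k r u]) (simp add: L_smult)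
    finally show ?thesis .
  qed
  have "0 = (\<integral>u. (\<Sum>t<?d. (\<integral>x. g r x * h t x \<partial>sphere_unif) * h t u) * h s u \<partial>sphere_unif)"
    by (subst Bochner_Integration.integral_cong[where g = "\<lambda>_. 0", OF refl]) (simp_all add: zero)
  also have "\<dots> = (\<integral>u. (\<Sum>t<?d. (\<integral>x. g r x * h t x \<partial>sphere_unif) * (h t u * h s u)) \<partial>sphere_unif)"
    by (simp add: sum_distrib_left sum_distrib_right mult_ac)
  also have "\<dots> = (\<Sum>t<?d. (\<integral>x. g r x * h t x \<partial>sphere_unif) * (if t = s then 1 else 0))"
    using int_hh s by (subst Bochner_Integration.integral_sum) (auto simp: harmonic_orthonormal[OF dim l] intro!: sum.cong)
  also have "\<dots> = (\<integral>x. g r x * h s x \<partial>sphere_unif)"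
    using s by (simp add: if_distrib[of "(*) _"] cong: if_cong)
  finally show ?thesis ..
qed

section \<open>Asymptotics of the Sobolev statistic\<close>

lemma second_moment_centred_sum:
  fixes Y :: "'a \<Rightarrow> real"
  assumes M: "prob_space M" and I: "finite I" and Y: "Y \<in> borel_measurable M"
    "\<And>x. x \<in> space M \<Longrightarrow> \<bar>Y x\<bar> \<le> B"
  defines "m \<equiv> \<integral>x. Y x \<partial>M"
  shows "(\<integral>U. (\<Sum>i\<in>I. Y (U i) - m)\<^sup>2 \<partial>Pi\<^sub>M I (\<lambda>_. M)) \<le> real (card I) * B\<^sup>2"
proof -
  let ?Q = "Pi\<^sub>M I (\<lambda>_. M)"
  interpret M: prob_space M by fact
  interpret P: product_prob_space "\<lambda>_. M" I ..
  have Q: "prob_space ?Q"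
    by (intro prob_space_PiM M)
  define y where "y x = Y x - m" for x
  have [measurable]: "Y \<in> borel_measurable M" "y \<in> borel_measurable M"
    unfolding y_def using Y(1) by auto
  have int_Y: "integrable M Y"
    using Y(2) by (intro M.integrable_const_bound[where B = B]) auto
  have int_YY: "integrable M (\<lambda>x. Y x * Y x)"
    by (rule M.integrable_mult_bounded[OF Y(1) Y(1) Y(2) Y(2)])
  have y_bound: "\<bar>y x\<bar> \<le> B + \<bar>m\<bar>" if "x \<in> space M" for x
    using Y(2)[OF that] by (simp add: y_def)
  have int_y: "integrable M y"
    using y_bound by (intro M.integrable_const_bound[where B = "B + \<bar>m\<bar>"]) auto
  have int_yy: "integrable M (\<lambda>x. y x * y x)"
    by (rule M.integrable_mult_bounded[OF _ _ y_bound y_bound]) auto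
  have y_0: "(\<integral>x. y x \<partial>M) = 0"
    unfolding y_def m_def using int_Y by (simp add: M.prob_space)
  have y_2: "(\<integral>x. y x * y x \<partial>M) \<le> B\<^sup>2"
  proof -
    have "(\<integral>x. y x * y x \<partial>M) = (\<integral>x. Y x * Y x - 2 * m * Y x + m * m \<partial>M)"
      by (simp add: y_def algebra_simps)
    also have "\<dots> = (\<integral>x. Y x * Y x \<partial>M) - m * m"
      using int_Y int_YY by (simp add: M.prob_space m_def[symmetric])
    also have "\<dots> \<le> (\<integral>x. Y x * Y x \<partial>M)"
      by simp
    also have "\<dots> \<le> (\<integral>x. B\<^sup>2 \<partial>M)"
      using int_YY Y(2) by (intro integral_mono) (auto simp: power2_eq_square[symmetric] abs_le_square_iff[symmetric]
          intro: order_trans[OF _ abs_ge_self])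
    finally show ?thesis by (simp add: M.prob_space)
  qed
  have int_pair: "integrable ?Q (\<lambda>U. y (U i) * y (U j))" if "i \<in> I" "j \<in> I" for i j
  proof (rule prob_space.integrable_mult_bounded[OF Q])
    show "(\<lambda>U. y (U i)) \<in> borel_measurable ?Q" "(\<lambda>U. y (U j)) \<in> borel_measurable ?Q"
      using that by measurable
    show "\<bar>y (U i)\<bar> \<le> B + \<bar>m\<bar>" "\<bar>y (U j)\<bar> \<le> B + \<bar>m\<bar>" if "U \<in> space ?Q" for U
      using y_bound that \<open>i \<in> I\<close> \<open>j \<in> I\<close> by (auto simp: space_PiM PiE_iff)
  qed
  have pair: "(\<integral>U. y (U i) * y (U j) \<partial>?Q) = (if i = j then \<integral>x. y x * y x \<partial>M else 0)"
    if ij: "i \<in> I" "j \<in> I" for i j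
  proof -
    \<comment> \<open>Factors equal to 1 at the other indices turn the pair into a product over all
      of \<open>I\<close>, covering equal and distinct indices at once.\<close>
    let ?F = "\<lambda>l x. (if l = i then y x else 1) * (if l = j then y x else 1)"
    have "(\<integral>U. y (U i) * y (U j) \<partial>?Q) = (\<integral>U. (\<Prod>l\<in>I. ?F l (U l)) \<partial>?Q)"
      using ij I by (simp add: prod.distrib)
    also have "\<dots> = (\<Prod>l\<in>I. \<integral>x. ?F l x \<partial>M)"
    proof (rule P.product_integral_prod[OF I])
      show "integrable M (?F l)" for l
        using int_y int_yy by (cases "l = i"; cases "l = j") auto
    qed
    also have "\<dots> = (if i = j then \<integral>x. y x * y x \<partial>M else 0)"
    proof (cases "i = j")
      case True
      then have "(\<Prod>l\<in>I. \<integral>x. ?F l x \<partial>M) = (\<Prod>l\<in>I. if l = i then \<integral>x. y x * y x \<partial>M else 1)"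
        by (intro prod.cong) (auto simp: M.prob_space)
      with True ij I show ?thesis by simp
    next
      case False
      then have "(\<integral>x. ?F i x \<partial>M) = 0"
        using y_0 by simp
      then show ?thesis using False ij I by (auto intro!: prod_zero bexI[of _ i])
    qed
    finally show ?thesis .
  qed
  have "(\<integral>U. (\<Sum>i\<in>I. Y (U i) - m)\<^sup>2 \<partial>?Q) = (\<integral>U. (\<Sum>i\<in>I. \<Sum>j\<in>I. y (U i) * y (U j)) \<partial>?Q)"
    unfolding y_def[symmetric] power2_eq_square sum_product ..
  also have "\<dots> = (\<Sum>i\<in>I. \<Sum>j\<in>I. if i = j then \<integral>x. y x * y x \<partial>M else 0)"
    using int_pair by (simp add: Bochner_Integration.integral_sum pair cong: sum.cong)
  also have "\<dots> = real (card I) * (\<integral>x. y x * y x \<partial>M)"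
    using I by simp
  also have "\<dots> \<le> real (card I) * B\<^sup>2"
    using y_2 by (rule mult_left_mono) simp
  finally show ?thesis .
qed

lemma sobolev_stat_finite:
  assumes "\<forall>k>K. v k = 0"
  shows "sobolev_stat v n (U :: nat \<Rightarrow> real ^ 'p::{finite,wellorder})
    = (\<Sum>k=1..K. (v k)\<^sup>2 * (1 / real n * (\<Sum>i=1..n. \<Sum>j=1..n. h_fun CARD('p) k (U i \<bullet> U j))))"
proof -
  let ?h = "\<lambda>k i j. (v k)\<^sup>2 * h_fun CARD('p) k (U i \<bullet> U j)"
  have "(\<Sum>k. (v (Suc k))\<^sup>2 * h_fun CARD('p) (Suc k) s) = (\<Sum>k=1..K. (v k)\<^sup>2 * h_fun CARD('p) k s)" for s
  proof -
    have "(\<Sum>k. (v (Suc k))\<^sup>2 * h_fun CARD('p) (Suc k) s) = (\<Sum>k<K. (v (Suc k))\<^sup>2 * h_fun CARD('p) (Suc k) s)"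
      by (rule suminf_finite) (auto simp: assms)
    also have "\<dots> = (\<Sum>k=1..K. (v k)\<^sup>2 * h_fun CARD('p) k s)"
      by (simp add: sum.atLeast1_atMost_eq)
    finally show ?thesis .
  qed
  then have "sobolev_stat v n U = 1 / real n * (\<Sum>i=1..n. \<Sum>j=1..n. \<Sum>k=1..K. ?h k i j)"
    by (simp only: sobolev_stat_def)
  also have "(\<Sum>i=1..n. \<Sum>j=1..n. \<Sum>k=1..K. ?h k i j)
      = (\<Sum>i=1..n. \<Sum>k=1..K. \<Sum>j=1..n. ?h k i j)"
    by (rule sum.cong[OF refl]) (rule sum.swap)
  also have "\<dots> = (\<Sum>k=1..K. \<Sum>i=1..n. \<Sum>j=1..n. ?h k i j)"
    by (rule sum.swap)
  finally show ?thesis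
    by (simp only: sum_distrib_left mult.left_commute[of "1 / real n"])
qed

lemma sobolev_stat_harmonics:
  fixes g :: "nat \<Rightarrow> nat \<Rightarrow> real ^ 'p::{finite,wellorder} \<Rightarrow> real"
  assumes dim: "2 \<le> CARD('p)" and v: "\<forall>k>K. v k = 0"
    and g: "\<And>k. 1 \<le> k \<Longrightarrow> harmonic_basis k (g k)"
    and U: "\<And>i. i \<in> {1..n} \<Longrightarrow> norm (U i) = 1"
  shows "sobolev_stat v n U = (\<Sum>k=1..K. (v k)\<^sup>2 * (\<Sum>r<d_const CARD('p) k. ((\<Sum>i=1..n. g k r (U i)) / sqrt (real n))\<^sup>2))"
  unfolding sobolev_stat_finite[OF v]
proof (rule sum.cong)
  fix k assume "k \<in> {1..K}"
  then have k: "1 \<le> k" by simp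
  let ?d = "d_const CARD('p) k"
  have "(\<Sum>i=1..n. \<Sum>j=1..n. h_fun CARD('p) k (U i \<bullet> U j)) = (\<Sum>i=1..n. \<Sum>j=1..n. \<Sum>r<?d. g k r (U i) * g k r (U j))"
    by (intro sum.cong refl) (simp add: harmonic_sum[OF dim k g[OF k]] U)
  also have "\<dots> = (\<Sum>i=1..n. \<Sum>r<?d. \<Sum>j=1..n. g k r (U i) * g k r (U j))"
    by (rule sum.cong[OF refl]) (rule sum.swap)
  also have "\<dots> = (\<Sum>r<?d. \<Sum>i=1..n. \<Sum>j=1..n. g k r (U i) * g k r (U j))"
    by (rule sum.swap)
  also have "\<dots> = (\<Sum>r<?d. (\<Sum>i=1..n. g k r (U i))\<^sup>2)"
    unfolding power2_eq_square sum_product ..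
  finally have "1 / real n * (\<Sum>i=1..n. \<Sum>j=1..n. h_fun CARD('p) k (U i \<bullet> U j))
      = (\<Sum>r<?d. ((\<Sum>i=1..n. g k r (U i)) / sqrt (real n))\<^sup>2)"
    by (simp add: power_divide flip: sum_divide_distrib)
  then show "(v k)\<^sup>2 * (1 / real n * (\<Sum>i=1..n. \<Sum>j=1..n. h_fun CARD('p) k (U i \<bullet> U j)))
      = (v k)\<^sup>2 * (\<Sum>r<?d. ((\<Sum>i=1..n. g k r (U i)) / sqrt (real n))\<^sup>2)"
    by simp
qed simp

lemma weak_conv_m_offset: "weak_conv_m (\<lambda>n. \<mu> (n + N)) M \<Longrightarrow> weak_conv_m \<mu> M"
  unfolding weak_conv_m_def weak_conv_def by (auto dest: LIMSEQ_offset)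

lemma sobolev_stat_measurable:
  fixes P :: "(real ^ 'p::{finite,wellorder}) measure"
  assumes dim: "2 \<le> CARD('p)" and v: "\<forall>k>K. v k = 0" and P: "sets P = sets sphere_unif"
  shows "sobolev_stat v n \<in> borel_measurable (Pi\<^sub>M {1..n} (\<lambda>_. P))"
proof -
  have "(\<lambda>x. x) \<in> P \<rightarrow>\<^sub>M borel"
    using measurable_sphere_unif_ident by (simp add: measurable_cong_sets[OF P refl])
  then have [measurable]: "(\<lambda>U. U i) \<in> Pi\<^sub>M {1..n} (\<lambda>_. P) \<rightarrow>\<^sub>M borel" if "i \<in> {1..n}" for i
    by (rule measurable_compose[OF measurable_component_singleton[OF that]])
  have [measurable]: "(\<lambda>s. h_fun CARD('p) k s) \<in> borel_measurable borel" for k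
    unfolding h_fun_eq_poly[OF dim] by (intro borel_measurable_continuous_onI continuous_intros)
  have "(\<lambda>U :: nat \<Rightarrow> real ^ 'p::_. sobolev_stat v n U) = (\<lambda>U. \<Sum>k=1..K. (v k)\<^sup>2 * (1 / real n * (\<Sum>i\<in>{1..n}. \<Sum>j\<in>{1..n}. h_fun CARD('p) k (U i \<bullet> U j))))"
    using sobolev_stat_finite[OF v] by blast
  also have "\<dots> \<in> borel_measurable (Pi\<^sub>M {1..n} (\<lambda>_. P))"
    by measurable
  finally show ?thesis .
qed

context shrinking_angular
begin

lemma angular_law_eventually_prob:
  "\<forall>\<^sub>F n in sequentially. prob_space (angular_law (\<kappa> n) f :: (real ^ 'p::{finite,wellorder}) measure) \<and>
    sets (angular_law (\<kappa> n) f :: (real ^ 'p::_) measure) = sets sphere_unif \<and>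
    space (angular_law (\<kappa> n) f :: (real ^ 'p::_) measure) = sphere 0 1"
  using angular_law_eventually[where 'p = 'p]
  by eventually_elim (metis sets_eq_imp_space_eq space_sphere_unif)

text \<open>Both weak limits are instances: \<open>s\<close> is zero throughout, or nonzero only at
  the smallest active degree. The rates are required only where \<open>v k \<noteq> 0\<close>,
  because lower degrees may drift to infinity.\<close>

lemma sobolev_stat_weak_conv:
  assumes dim: "2 \<le> CARD('p::{finite,wellorder})" and v: "\<forall>k>K. v k = 0"
    and s: "\<And>k. 1 \<le> k \<Longrightarrow> k \<le> K \<Longrightarrow> v k \<noteq> 0 \<Longrightarrow> (\<lambda>n. sqrt (real n) * \<kappa> n ^ k) \<longlonglongrightarrow> s k"
    and \<xi>: "\<And>k. 0 \<le> \<xi> k" "\<And>k. 1 \<le> k \<Longrightarrow> k \<le> K \<Longrightarrow> v k \<noteq> 0 \<Longrightarrow>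
      \<xi> k = (s k * ((deriv ^^ k) f 0 / fact k) *
        (monomial_coeff CARD('p) k k / zonal_factor ((real CARD('p) - 2) / 2) k))\<^sup>2 * real (d_const CARD('p) k)"
  shows "weak_conv_m
    (\<lambda>n. distr (sample_law n (\<kappa> n) f :: (nat \<Rightarrow> real ^ 'p::_) measure) borel (sobolev_stat v n))
    (weighted_chi_square K (\<lambda>k. (v k)\<^sup>2) (d_const CARD('p)) \<xi>)"
proof -
  let ?Q = "\<lambda>n. sample_law n (\<kappa> n) f :: (nat \<Rightarrow> real ^ 'p::_) measure"
  let ?W = "weighted_chi_square K (\<lambda>k. (v k)\<^sup>2) (d_const CARD('p)) \<xi>"
  let ?P = "\<lambda>n. angular_law (\<kappa> n) f :: (real ^ 'p::_) measure"
  let ?d = "d_const CARD('p)"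
  let ?A = "SIGMA k:{1..K}. {..<?d k}"
  obtain g :: "nat \<Rightarrow> nat \<Rightarrow> real ^ 'p::_ \<Rightarrow> real" where g: "\<And>k. 1 \<le> k \<Longrightarrow> harmonic_basis k (g k)"
    using harmonic_basis_exists[OF dim] by metis
  define G where "G a = g (fst a) (snd a)" for a :: "nat \<times> nat"
  \<comment> \<open>The limiting mean of the component, from the moment expansion; the value 0 at
    inactive degrees is a placeholder, as no limit need exist there.\<close>
  define \<mu> where "\<mu> a = (if v (fst a) = 0 then 0 else s (fst a) * ((deriv ^^ fst a) f 0 / fact (fst a)) *
        (monomial_coeff CARD('p) (fst a) (fst a) / zonal_factor ((real CARD('p) - 2) / 2) (fst a)) * G a theta0)"
    for a :: "nat \<times> nat"
  define B where "B = (\<Sum>k=1..K. sqrt (real (?d k)))"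
  have G: "G a \<in> borel_measurable sphere_unif" "\<And>x. norm x = 1 \<Longrightarrow> \<bar>G a x\<bar> \<le> B" if "a \<in> ?A" for a
  proof -
    have k: "1 \<le> fst a" and r: "snd a < ?d (fst a)" "fst a \<in> {1..K}"
      using that by auto
    show "G a \<in> borel_measurable sphere_unif"
      unfolding G_def by (rule harmonic_measurable[OF dim k g[OF k] r(1)])
    fix x :: "real ^ 'p::_" assume "norm x = 1"
    from harmonic_bound[OF dim k g[OF k] r(1) this] have "\<bar>G a x\<bar> \<le> sqrt (real (?d (fst a)))"
      unfolding G_def .
    also have "\<dots> \<le> B"
      unfolding B_def using r(2) by (intro member_le_sum) auto
    finally show "\<bar>G a x\<bar> \<le> B" .
  qed
  have cov: "(\<lambda>n. \<integral>x. G a x * G b x \<partial>?P n) \<longlonglongrightarrow> (if a = b then 1 else 0)" if ab: "a \<in> ?A" "b \<in> ?A" for a b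
  proof -
    have "(\<lambda>n. \<integral>x. G a x * G b x \<partial>?P n) \<longlonglongrightarrow> (\<integral>x. G a x * G b x \<partial>sphere_unif)"
    proof (rule angular_mean_tendsto[where B = "B * B"])
      show "\<bar>G a x * G b x\<bar> \<le> B * B" if "norm x = 1" for x
        unfolding abs_mult using G(2)[OF ab(1) that] G(2)[OF ab(2) that] by (intro mult_mono) auto
    qed (intro borel_measurable_times G ab)
    also have "(\<integral>x. G a x * G b x \<partial>sphere_unif) = (if a = b then 1 else 0)"
    proof (cases "fst a = fst b")
      case True
      then show ?thesis
        using harmonic_orthonormal[OF dim _ g, of "fst a" "snd a" "snd b"] ab by (auto simp: G_def prod_eq_iff)
    next
      case False
      then show ?thesis
        using harmonic_orthogonal[OF dim _ g _ g, of "fst a" "fst b" "snd a" "snd b"] ab by (auto simp: G_def prod_eq_iff)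
    qed
    finally show ?thesis .
  qed
  have mean: "(\<lambda>n. sqrt (real n) * (\<integral>x. G a x \<partial>?P n)) \<longlonglongrightarrow> \<mu> a" if a: "a \<in> ?A" "v (fst a) \<noteq> 0" for a
  proof -
    let ?k = "fst a"
    have k: "1 \<le> ?k" "?k \<le> K" and r: "snd a < ?d ?k"
      using a by auto
    have "(\<lambda>n. (\<integral>x. G a x \<partial>?P n) / \<kappa> n ^ ?k) \<longlonglongrightarrow> (deriv ^^ ?k) f 0 / fact ?k * (\<integral>x. (theta0 \<bullet> x) ^ ?k * G a x \<partial>sphere_unif)"
      using harmonic_axial_moment(1)[OF dim k(1) g[OF k(1)] r]
      by (intro angular_mean_expansion[where B = B] G a k) (auto simp: G_def)
    then have "(\<lambda>n. (sqrt (real n) * \<kappa> n ^ ?k) * ((\<integral>x. G a x \<partial>?P n) / \<kappa> n ^ ?k))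
        \<longlonglongrightarrow> s ?k * ((deriv ^^ ?k) f 0 / fact ?k * (\<integral>x. (theta0 \<bullet> x) ^ ?k * G a x \<partial>sphere_unif))"
      using s[OF k a(2)] by (intro tendsto_mult)
    also have "s ?k * ((deriv ^^ ?k) f 0 / fact ?k * (\<integral>x. (theta0 \<bullet> x) ^ ?k * G a x \<partial>sphere_unif)) = \<mu> a"
      using harmonic_axial_moment(2)[OF dim k(1) g[OF k(1)] r] a(2) by (simp add: \<mu>_def G_def)
    finally show ?thesis
    proof (rule Lim_transform_eventually)
      show "\<forall>\<^sub>F n in sequentially. sqrt (real n) * \<kappa> n ^ ?k * ((\<integral>x. G a x \<partial>?P n) / \<kappa> n ^ ?k) = sqrt (real n) * (\<integral>x. G a x \<partial>?P n)"
        using eventually_ge_at_top[of 1]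
      proof eventually_elim
        case (elim n)
        then have "\<kappa> n \<noteq> 0" using \<kappa>(1)[of n] by simp
        then show ?case by simp
      qed
    qed
  qed
  have lap: "(\<lambda>n. \<integral>U. exp (- (l * sobolev_stat v n U)) \<partial>?Q n)
      \<longlonglongrightarrow> (\<integral>x. exp (- (l * x)) \<partial>?W)" if l: "0 \<le> l" for l
  proof -
    \<comment> \<open>Chosen so that half the sum of the squares \<open>(c a * X a)\<^sup>2\<close>
      is \<open>l\<close> times the statistic.\<close>
    define c where "c a = sqrt (2 * l) * v (fst a)" for a :: "nat \<times> nat"
    have c2: "(c a)\<^sup>2 = 2 * (l * (v (fst a))\<^sup>2)" for a
      using l by (simp add: c_def power_mult_distrib)
    have "(\<lambda>n. \<integral>U. exp (- (\<Sum>a\<in>?A. (c a * (\<Sum>i=1..n. G a (U i)) / sqrt (real n))\<^sup>2) / 2) \<partial>Pi\<^sub>M {1..n} (\<lambda>_. ?P n))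
      \<longlonglongrightarrow> (\<Prod>a\<in>?A. exp (- ((c a * \<mu> a)\<^sup>2 / (2 * (1 + (c a)\<^sup>2)))) / sqrt (1 + (c a)\<^sup>2))"
    proof (rule Laplace_quadratic_tendsto[where B = B])
      show "finite ?A" by simp
      show "\<forall>\<^sub>F n in sequentially. prob_space (?P n) \<and>
          (\<forall>a\<in>?A. G a \<in> borel_measurable (?P n) \<and> (\<forall>x\<in>space (?P n). \<bar>G a x\<bar> \<le> B))"
        using angular_law_eventually_prob[where 'p = 'p]
      proof eventually_elim
        case (elim n)
        then show ?case using G by (auto simp: measurable_cong_sets[of "?P n" sphere_unif])
      qed
      show "(\<lambda>n. c a * (sqrt (real n) * (\<integral>x. G a x \<partial>?P n))) \<longlonglongrightarrow> c a * \<mu> a" if "a \<in> ?A" for a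
      proof (cases "v (fst a) = 0")
        case False
        then show ?thesis using mean[OF that] by (intro tendsto_mult_left)
      qed (simp add: c_def)
    qed (rule cov)
    also have "(\<Prod>a\<in>?A. exp (- ((c a * \<mu> a)\<^sup>2 / (2 * (1 + (c a)\<^sup>2)))) / sqrt (1 + (c a)\<^sup>2))
        = (\<Prod>k=1..K. \<Prod>r<?d k. exp (- ((c (k, r) * \<mu> (k, r))\<^sup>2 / (2 * (1 + (c (k, r))\<^sup>2)))) / sqrt (1 + (c (k, r))\<^sup>2))"
      by (subst prod.Sigma) (auto simp: case_prod_unfold)
    also have "\<dots> = (\<Prod>k=1..K. exp (- (l * (v k)\<^sup>2 * \<xi> k / (1 + 2 * (l * (v k)\<^sup>2)))) / sqrt (1 + 2 * (l * (v k)\<^sup>2)) ^ ?d k)"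
    proof (rule prod.cong)
      fix k assume "k \<in> {1..K}"
      then have k: "1 \<le> k" "k \<le> K" by auto
      \<comment> \<open>The drifts are a constant times the values of the basis at
        \<open>theta0\<close>, whose squares sum to \<open>d_const\<close>.\<close>
      have sum_\<mu>: "(v k)\<^sup>2 * (\<Sum>r<?d k. (\<mu> (k, r))\<^sup>2) = (v k)\<^sup>2 * \<xi> k"
      proof (cases "v k = 0")
        case False
        define b where "b = s k * ((deriv ^^ k) f 0 / fact k) *
          (monomial_coeff CARD('p) k k / zonal_factor ((real CARD('p) - 2) / 2) k)"
        have "\<mu> (k, r) = b * g k r theta0" for r
          using False by (simp add: \<mu>_def G_def b_def)
        then have "(\<Sum>r<?d k. (\<mu> (k, r))\<^sup>2) = b\<^sup>2 * (\<Sum>r<?d k. (g k r theta0)\<^sup>2)"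
          by (simp add: power_mult_distrib sum_distrib_left)
        then show ?thesis
          using \<xi>(2)[OF k False] harmonic_sum_squares[OF dim k(1) g[OF k(1)], of theta0]
          unfolding b_def[symmetric] by simp
      qed simp
      let ?q = "1 + 2 * (l * (v k)\<^sup>2)"
      have "(\<Prod>r<?d k. exp (- ((c (k, r) * \<mu> (k, r))\<^sup>2 / (2 * (1 + (c (k, r))\<^sup>2)))) / sqrt (1 + (c (k, r))\<^sup>2))
          = (\<Prod>r<?d k. exp (- (l * ((v k)\<^sup>2 * (\<mu> (k, r))\<^sup>2) / ?q))) / sqrt ?q ^ ?d k"
      proof -
        have eq: "2 * (l * w) * m / (2 * q) = l * (w * m) / q" for w m q :: real
          by simp
        show ?thesis
          unfolding prod_dividef power_mult_distrib c2 fst_conv eq by simp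
      qed
      also have "(\<Prod>r<?d k. exp (- (l * ((v k)\<^sup>2 * (\<mu> (k, r))\<^sup>2) / ?q))) = exp (- (l * ((v k)\<^sup>2 * (\<Sum>r<?d k. (\<mu> (k, r))\<^sup>2)) / ?q))"
        by (simp add: sum_negf sum_divide_distrib sum_distrib_left flip: exp_sum)
      finally show "(\<Prod>r<?d k. exp (- ((c (k, r) * \<mu> (k, r))\<^sup>2 / (2 * (1 + (c (k, r))\<^sup>2)))) / sqrt (1 + (c (k, r))\<^sup>2))
          = exp (- (l * (v k)\<^sup>2 * \<xi> k / ?q)) / sqrt ?q ^ ?d k"
        unfolding sum_\<mu> by (simp add: mult.assoc)
    qed simp
    also have "\<dots> = (\<integral>x. exp (- (l * x)) \<partial>?W)"
      using l \<xi>(1) d_const_pos[OF dim] by (intro Laplace_weighted_chi_square[symmetric]) auto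
    finally show ?thesis
    proof (rule Lim_transform_eventually)
      show "\<forall>\<^sub>F n in sequentially.
          (\<integral>U. exp (- (\<Sum>a\<in>?A. (c a * (\<Sum>i=1..n. G a (U i)) / sqrt (real n))\<^sup>2) / 2) \<partial>Pi\<^sub>M {1..n} (\<lambda>_. ?P n))
          = (\<integral>U. exp (- (l * sobolev_stat v n U)) \<partial>?Q n)"
        using angular_law_eventually_prob[where 'p = 'p]
      proof eventually_elim
        case (elim n)
        show ?case
          unfolding sample_law_def
        proof (rule Bochner_Integration.integral_cong)
          fix U assume "U \<in> space (Pi\<^sub>M {1..n} (\<lambda>_. ?P n))"
          then have U: "norm (U i) = 1" if "i \<in> {1..n}" for i
            using that elim by (auto simp: space_PiM PiE_iff)
          have "(\<Sum>a\<in>?A. (c a * (\<Sum>i=1..n. G a (U i)) / sqrt (real n))\<^sup>2)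
              = (\<Sum>k=1..K. \<Sum>r<?d k. 2 * (l * (v k)\<^sup>2) * ((\<Sum>i=1..n. g k r (U i)) / sqrt (real n))\<^sup>2)"
            unfolding times_divide_eq_right[symmetric] power_mult_distrib c2
            by (subst sum.Sigma) (auto simp: case_prod_unfold G_def)
          also have "\<dots> = 2 * (l * sobolev_stat v n U)"
          proof -
            have stat: "sobolev_stat v n U = (\<Sum>k=1..K. (v k)\<^sup>2 * (\<Sum>r<?d k. ((\<Sum>i=1..n. g k r (U i)) / sqrt (real n))\<^sup>2))"
              by (rule sobolev_stat_harmonics[OF dim v]) (use g U in auto)
            show ?thesis
              unfolding stat by (simp add: sum_distrib_left mult_ac)
          qed
          finally show "exp (- (\<Sum>a\<in>?A. (c a * (\<Sum>i=1..n. G a (U i)) / sqrt (real n))\<^sup>2) / 2) = exp (- (l * sobolev_stat v n U))"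
            by simp
        qed simp
      qed
    qed
  qed
  obtain N where N: "\<And>n. n \<ge> N \<Longrightarrow> prob_space (?P n) \<and> sets (?P n) = sets sphere_unif \<and> space (?P n) = sphere 0 1"
    using angular_law_eventually_prob[where 'p = 'p] unfolding eventually_sequentially by blast
  have stat_meas: "sobolev_stat v n \<in> borel_measurable (?Q n)" if "n \<ge> N" for n
    unfolding sample_law_def using N[OF that] by (intro sobolev_stat_measurable[OF dim v]) auto
  show ?thesis
  proof (rule weak_conv_m_offset[where N = N], rule weak_conv_m_Laplace)
    fix n
    have n: "n + N \<ge> N" by simp
    have "prob_space (?Q (n + N))"
      unfolding sample_law_def using N[OF n] by (intro prob_space_PiM) auto
    then show "real_distribution (distr (?Q (n + N)) borel (sobolev_stat v (n + N)))"
      using stat_meas[OF n] by (rule prob_space.real_distribution_distr)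
    show "AE x in distr (?Q (n + N)) borel (sobolev_stat v (n + N)). 0 \<le> x"
    proof (subst AE_distr_iff[OF stat_meas[OF n]])
      show "AE U in ?Q (n + N). 0 \<le> sobolev_stat v (n + N) U"
      proof (rule AE_I2)
        fix U :: "nat \<Rightarrow> real ^ 'p::_" assume "U \<in> space (?Q (n + N))"
        then have U: "norm (U i) = 1" if "i \<in> {1..n + N}" for i
          using that N[OF n] by (auto simp: sample_law_def space_PiM PiE_iff)
        show "0 \<le> sobolev_stat v (n + N) U"
          by (subst sobolev_stat_harmonics[OF dim v, where g = g]) (use g U in \<open>auto intro!: sum_nonneg mult_nonneg_nonneg\<close>)
      qed
    qed auto
  next
    show "real_distribution (?W)"
      by (rule real_distribution_weighted_chi_square)
    show "AE x in ?W. 0 \<le> x"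
      by (rule AE_weighted_chi_square_nonneg) simp
    fix m :: nat
    have "(\<lambda>n. \<integral>U. exp (- (real m * sobolev_stat v (n + N) U)) \<partial>?Q (n + N))
        \<longlonglongrightarrow> (\<integral>x. exp (- (real m * x)) \<partial>?W)"
      using lap[of "real m"] by (intro LIMSEQ_ignore_initial_segment) auto
    then show "(\<lambda>n. \<integral>x. exp (- (real m * x)) \<partial>distr (?Q (n + N)) borel (sobolev_stat v (n + N)))
        \<longlonglongrightarrow> (\<integral>x. exp (- (real m * x)) \<partial>?W)"
      using stat_meas by (subst integral_distr) auto
  qed
qed

end

section \<open>Consistency under the faster rate\<close>

context shrinking_angular
begin

text \<open>Let T be the normalised sum of the \<open>Y (U i)\<close>. By the addition theorem T is
  a linear form in the components of degree \<open>k\<close>, so Cauchy-Schwarz bounds |T| whenever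
  the statistic is at most \<open>c\<close>. Its mean diverges while its variance stays below
  \<open>B\<^sup>2\<close>.\<close>

lemma sobolev_stat_consistent:
  assumes dim: "2 \<le> CARD('p::{finite,wellorder})" and v: "\<forall>k>K. v k = 0"
    and k: "1 \<le> k" "k \<le> K" "v k \<noteq> 0" and f_k: "(deriv ^^ k) f 0 \<noteq> 0"
    and rate: "filterlim (\<lambda>n. sqrt (real n) * \<kappa> n ^ k) at_top sequentially"
  shows "(\<lambda>n. measure (sample_law n (\<kappa> n) f)
      {U \<in> space (sample_law n (\<kappa> n) f :: (nat \<Rightarrow> real ^ 'p::_) measure). sobolev_stat v n U > c}) \<longlonglongrightarrow> 1"
proof -
  let ?P = "\<lambda>n. angular_law (\<kappa> n) f :: (real ^ 'p::_) measure"
  let ?Q = "\<lambda>n. sample_law n (\<kappa> n) f :: (nat \<Rightarrow> real ^ 'p::_) measure"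
  let ?\<nu> = "(real CARD('p) - 2) / 2" and ?d = "real (d_const CARD('p) k)"
  obtain g :: "nat \<Rightarrow> nat \<Rightarrow> real ^ 'p::_ \<Rightarrow> real" where g: "\<And>k. 1 \<le> k \<Longrightarrow> harmonic_basis k (g k)"
    using harmonic_basis_exists[OF dim] by metis
  define Y where "Y x = h_fun CARD('p) k (theta0 \<bullet> x)" for x :: "real ^ 'p::_"
  define w where "w = (v k)\<^sup>2"
  have w: "w > 0" using k(3) by (simp add: w_def)
  have d: "?d > 0" using d_const_pos[OF dim k(1)] by simp
  have nonneg: "?\<nu> \<ge> 0" using dim by simp
  obtain B where B: "\<And>t. \<bar>t\<bar> \<le> 1 \<Longrightarrow> \<bar>h_fun CARD('p) k t\<bar> \<le> B"
    using poly_bounded_Icc unfolding h_fun_eq_poly[OF dim] by metis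
  have Y: "Y \<in> borel_measurable sphere_unif"
    unfolding Y_def h_fun_eq_poly[OF dim]
    by (intro sphere_unif_measurableI borel_measurable_continuous_onI continuous_intros)
  have Y_bound: "\<bar>Y x\<bar> \<le> B" if "norm x = 1" for x
    unfolding Y_def using that by (intro B sphere_inner_bound) auto
  note Y = Y Y_bound
  define e where "e n = (\<integral>x. Y x \<partial>?P n)" for n
  define q where "q = (deriv ^^ k) f 0 / fact k * (monomial_coeff CARD('p) k k / zonal_factor ?\<nu> k * ?d)"
  have "q \<noteq> 0"
    using f_k d zonal_factor_pos[OF nonneg, of k] coeff_gegenbauer_top(1)[OF nonneg, of k]
    by (simp add: q_def monomial_coeff_top[OF dim])
  have "(\<lambda>n. e n / \<kappa> n ^ k) \<longlonglongrightarrow> q"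
    unfolding e_def q_def h_fun_axial_moment(2)[OF dim k(1) g[OF k(1)], symmetric] Y_def[symmetric]
    by (rule angular_mean_expansion[OF Y k(1,2)])
      (simp_all add: Y_def h_fun_axial_moment(1)[OF dim k(1) g[OF k(1)]])
  then have "filterlim (\<lambda>n. \<bar>e n / \<kappa> n ^ k\<bar> * (sqrt (real n) * \<kappa> n ^ k)) at_top sequentially"
    by (rule filterlim_tendsto_pos_mult_at_top[OF tendsto_rabs _ rate]) (use \<open>q \<noteq> 0\<close> in simp)
  moreover have "\<forall>\<^sub>F n in sequentially. \<bar>e n / \<kappa> n ^ k\<bar> * (sqrt (real n) * \<kappa> n ^ k) = sqrt (real n) * \<bar>e n\<bar>"
    using eventually_ge_at_top[of 1]
  proof eventually_elim
    case (elim n)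
    then have "\<kappa> n > 0" by (rule \<kappa>(1))
    then show ?case by (simp add: abs_divide)
  qed
  ultimately have drift: "filterlim (\<lambda>n. sqrt (real n) * \<bar>e n\<bar>) at_top sequentially"
    by (rule filterlim_mono_eventually[OF _ order_refl order_refl])
  \<comment> \<open>The bound on |T| from w T^2 \<le> d S, where d is the rank and S the statistic,
    when S is at most |c|.\<close>
  define C where "C = sqrt (\<bar>c\<bar> * ?d / w)"
  have C2: "C\<^sup>2 = \<bar>c\<bar> * ?d / w" "0 \<le> C"
    using w d by (auto simp: C_def)
  \<comment> \<open>The distance from the mean of T to the interval between -C and C once positive;
    a small statistic forces a deviation of at least this size.\<close>
  define \<Delta> where "\<Delta> n = sqrt (real n) * \<bar>e n\<bar> - C" for n
  have \<Delta>: "filterlim \<Delta> at_top sequentially"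
    using filterlim_tendsto_add_at_top[OF tendsto_const drift, of "- C"] by (simp add: \<Delta>_def[abs_def])
  have lower: "\<forall>\<^sub>F n in sequentially. prob_space (?Q n) \<and>
      1 - B\<^sup>2 * inverse ((\<Delta> n)\<^sup>2) \<le> measure (?Q n) {U \<in> space (?Q n). sobolev_stat v n U > c}"
    using angular_law_eventually_prob[where 'p = 'p] eventually_ge_at_top[of 1] filterlim_at_top_dense[THEN iffD1, OF \<Delta>, rule_format, of 0]
  proof eventually_elim
    case (elim n)
    have P: "prob_space (?P n)" "sets (?P n) = sets sphere_unif" "space (?P n) = sphere 0 1"
      using elim(1) by auto
    interpret Q: prob_space "?Q n"
      unfolding sample_law_def using P(1) by (intro prob_space_PiM)
    have n: "sqrt (real n) > 0" "real n > 0" using elim(2) by auto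
    have [measurable]: "sobolev_stat v n \<in> borel_measurable (?Q n)"
      unfolding sample_law_def by (rule sobolev_stat_measurable[OF dim v P(2)])
    have Y_P: "Y \<in> borel_measurable (?P n)" "\<And>x. x \<in> space (?P n) \<Longrightarrow> \<bar>Y x\<bar> \<le> B"
      using Y P by (auto simp: measurable_cong_sets[OF P(2) refl])
    have Y_i [measurable]: "(\<lambda>U. Y (U i)) \<in> borel_measurable (?Q n)" if "i \<in> {1..n}" for i
      unfolding sample_law_def by (rule measurable_compose[OF measurable_component_singleton[OF that] Y_P(1)])
    have space: "norm (U i) = 1" if "U \<in> space (?Q n)" "i \<in> {1..n}" for U i
      using that P(3) by (auto simp: sample_law_def space_PiM PiE_iff)
    let ?Z = "\<lambda>U. \<Sum>i\<in>{1..n}. Y (U i) - e n"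
    have Z_meas [measurable]: "?Z \<in> borel_measurable (?Q n)"
      by measurable
    have Z_bound: "\<bar>?Z U\<bar> \<le> real n * (B + \<bar>e n\<bar>)" if "U \<in> space (?Q n)" for U
    proof -
      have "\<bar>Y (U i) - e n\<bar> \<le> B + \<bar>e n\<bar>" if "i \<in> {1..n}" for i
        using Y(2)[OF space[OF \<open>U \<in> space (?Q n)\<close> that]] by linarith
      then have "\<bar>?Z U\<bar> \<le> (\<Sum>i\<in>{1..n}. B + \<bar>e n\<bar>)"
        by (intro order_trans[OF sum_abs] sum_mono) auto
      then show ?thesis by simp
    qed
    have Z_int: "integrable (?Q n) (\<lambda>U. (?Z U)\<^sup>2)"
      unfolding power2_eq_square by (rule Q.integrable_mult_bounded[OF Z_meas Z_meas Z_bound Z_bound])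
    have Z_2: "(\<integral>U. (?Z U)\<^sup>2 \<partial>?Q n) \<le> real n * B\<^sup>2"
      using second_moment_centred_sum[OF P(1) _ Y_P, of "{1..n}"] unfolding sample_law_def e_def by simp
    have "{U \<in> space (?Q n). \<not> sobolev_stat v n U > c} \<subseteq> {U \<in> space (?Q n). (?Z U)\<^sup>2 \<ge> real n * (\<Delta> n)\<^sup>2}"
    proof safe
      fix U assume U: "U \<in> space (?Q n)" and small: "\<not> sobolev_stat v n U > c"
      let ?X = "\<lambda>k r. (\<Sum>i=1..n. g k r (U i)) / sqrt (real n)"
      let ?T = "(\<Sum>i=1..n. Y (U i)) / sqrt (real n)"
      have "w * (\<Sum>r<d_const CARD('p) k. (?X k r)\<^sup>2) \<le> (\<Sum>k=1..K. (v k)\<^sup>2 * (\<Sum>r<d_const CARD('p) k. (?X k r)\<^sup>2))"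
        unfolding w_def using k by (intro member_le_sum) (auto intro!: mult_nonneg_nonneg sum_nonneg)
      also have "\<dots> = sobolev_stat v n U"
        by (rule sobolev_stat_harmonics[OF dim v, symmetric]) (use g space[OF U] in auto)
      finally have S: "w * (\<Sum>r<d_const CARD('p) k. (?X k r)\<^sup>2) \<le> \<bar>c\<bar>"
        using small by linarith
      have T_eq: "?T = (\<Sum>r<d_const CARD('p) k. g k r theta0 * ?X k r)"
      proof -
        have "(\<Sum>i=1..n. Y (U i)) = (\<Sum>i=1..n. \<Sum>r<d_const CARD('p) k. g k r theta0 * g k r (U i))"
          by (intro sum.cong refl) (simp add: Y_def harmonic_sum[OF dim k(1) g[OF k(1)]] space[OF U])
        also have "\<dots> = (\<Sum>r<d_const CARD('p) k. \<Sum>i=1..n. g k r theta0 * g k r (U i))"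
          by (rule sum.swap)
        finally show ?thesis
          by (simp add: sum_divide_distrib sum_distrib_left)
      qed
      have "?T\<^sup>2 \<le> (\<Sum>r<d_const CARD('p) k. (g k r theta0)\<^sup>2) * (\<Sum>r<d_const CARD('p) k. (?X k r)\<^sup>2)"
        unfolding T_eq by (rule Cauchy_Schwarz_ineq_sum)
      also have "\<dots> = ?d * (\<Sum>r<d_const CARD('p) k. (?X k r)\<^sup>2)"
        by (simp add: harmonic_sum_squares[OF dim k(1) g[OF k(1)]])
      also have "\<dots> \<le> C\<^sup>2"
        using mult_left_mono[OF S, of ?d] d w unfolding C2 by (simp add: pos_le_divide_eq mult_ac)
      finally have T: "\<bar>?T\<bar> \<le> C"
        using C2(2) by (metis abs_le_square_iff abs_of_nonneg)
      have Z: "?Z U = sqrt (real n) * (?T - sqrt (real n) * e n)"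
        using n by (simp add: sum_subtractf right_diff_distrib flip: mult.assoc)
      have "\<Delta> n \<le> \<bar>?T - sqrt (real n) * e n\<bar>"
      proof -
        have "\<bar>sqrt (real n) * e n\<bar> = sqrt (real n) * \<bar>e n\<bar>"
          by (simp add: abs_mult)
        then show ?thesis
          using T unfolding \<Delta>_def by linarith
      qed
      then have "(\<Delta> n)\<^sup>2 \<le> (?T - sqrt (real n) * e n)\<^sup>2"
        using elim(3) by (metis abs_le_square_iff abs_of_pos)
      then show "real n * (\<Delta> n)\<^sup>2 \<le> (?Z U)\<^sup>2"
        unfolding Z power_mult_distrib using n by (simp add: mult_left_mono)
    qed
    then have "Q.prob {U \<in> space (?Q n). \<not> sobolev_stat v n U > c} \<le> Q.prob {U \<in> space (?Q n). (?Z U)\<^sup>2 \<ge> real n * (\<Delta> n)\<^sup>2}"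
      by (intro Q.finite_measure_mono) measurable
    also have "\<dots> \<le> (\<integral>U. (?Z U)\<^sup>2 \<partial>?Q n) / (real n * (\<Delta> n)\<^sup>2)"
      using n elim(3) by (intro integral_Markov_inequality_measure[where A = "{}"] Z_int) auto
    also have "\<dots> \<le> real n * B\<^sup>2 / (real n * (\<Delta> n)\<^sup>2)"
      using Z_2 n by (intro divide_right_mono) auto
    also have "\<dots> = B\<^sup>2 * inverse ((\<Delta> n)\<^sup>2)"
      using n by (simp add: divide_inverse)
    finally have "Q.prob {U \<in> space (?Q n). \<not> sobolev_stat v n U > c} \<le> B\<^sup>2 * inverse ((\<Delta> n)\<^sup>2)" .
    moreover have "Q.prob {U \<in> space (?Q n). \<not> sobolev_stat v n U > c} = 1 - Q.prob {U \<in> space (?Q n). sobolev_stat v n U > c}"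
      by (intro Q.prob_neg) measurable
    ultimately show ?case
      using Q.prob_space_axioms by simp
  qed
  have "(\<lambda>n. 1 - B\<^sup>2 * inverse ((\<Delta> n)\<^sup>2)) \<longlonglongrightarrow> 1 - B\<^sup>2 * 0"
    using \<Delta> by (intro tendsto_intros tendsto_inverse_0_at_top filterlim_pow_at_top) auto
  then have low: "(\<lambda>n. 1 - B\<^sup>2 * inverse ((\<Delta> n)\<^sup>2)) \<longlonglongrightarrow> 1"
    by simp
  show ?thesis
  proof (rule tendsto_sandwich[OF _ _ low tendsto_const])
    show "\<forall>\<^sub>F n in sequentially. 1 - B\<^sup>2 * inverse ((\<Delta> n)\<^sup>2) \<le> measure (?Q n) {U \<in> space (?Q n). sobolev_stat v n U > c}"
      using lower by eventually_elim blast
    show "\<forall>\<^sub>F n in sequentially. measure (?Q n) {U \<in> space (?Q n). sobolev_stat v n U > c} \<le> 1"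
      using lower by eventually_elim (auto intro: prob_space.prob_le_1)
  qed
qed

end

text \<open>The three regimes are the limits 0, \<tau> and infinity of one rescaled concentration.
  Divergence is established for every real threshold, so the quantile is one instance.\<close>

theorem theorem2:
  fixes v \<kappa> :: "nat \<Rightarrow> real" and f :: "real \<Rightarrow> real" and \<tau> :: real and k\<^sub>v K\<^sub>v :: nat
  assumes dim: "2 \<le> CARD('p::{finite,wellorder})"
    and finite: "finite (coeff_support v)"
    and nonzero: "coeff_support v \<noteq> {}"
    and k\<^sub>v: "k\<^sub>v = Min (coeff_support v)"
    and K\<^sub>v: "K\<^sub>v = Max (coeff_support v)"
    and f: "angular_function f" "times_differentiable_at K\<^sub>v f 0"
    and \<kappa>: "\<And>n. n \<ge> 1 \<Longrightarrow> \<kappa> n > 0" "\<kappa> \<in> o(\<lambda>_. 1)"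
    and \<tau>: "\<tau> > 0"
  shows
    "(\<forall>k. 1 \<le> k \<and> k \<le> K\<^sub>v \<longrightarrow>
        xi CARD('p) f k \<tau> =
          real (d_const CARD('p) k) * ((deriv ^^ k) f 0)\<^sup>2 * \<tau> ^ (2 * k)
            / (\<Prod>l=0..k-1. (real CARD('p) + 2 * real l)\<^sup>2)) \<and>
     (\<kappa> \<in> o(\<lambda>n. real n powr (- 1 / (2 * real k\<^sub>v))) \<longrightarrow>
        weak_conv_m
          (\<lambda>n. distr (sample_law n (\<kappa> n) f :: (nat \<Rightarrow> real ^ 'p::_) measure) borel (sobolev_stat v n))
          (weighted_chi_square K\<^sub>v (\<lambda>k. (v k)\<^sup>2) (d_const CARD('p)) (\<lambda>_. 0))) \<and>
     ((\<forall>n\<ge>1. \<kappa> n = real n powr (- 1 / (2 * real k\<^sub>v)) * \<tau>) \<longrightarrow>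
        weak_conv_m
          (\<lambda>n. distr (sample_law n (\<kappa> n) f :: (nat \<Rightarrow> real ^ 'p::_) measure) borel (sobolev_stat v n))
          (weighted_chi_square K\<^sub>v (\<lambda>k. (v k)\<^sup>2) (d_const CARD('p))
            (\<lambda>k. if k = k\<^sub>v then xi CARD('p) f k\<^sub>v \<tau> else 0))) \<and>
     (filterlim (\<lambda>n. real n powr (1 / (2 * real k\<^sub>v)) * \<kappa> n) at_top at_top \<and>
        (deriv ^^ k\<^sub>v) f 0 \<noteq> 0 \<longrightarrow>
        (\<forall>c>0. (\<lambda>n. measure (sample_law n (\<kappa> n) f)
            {U \<in> space (sample_law n (\<kappa> n) f :: (nat \<Rightarrow> real ^ 'p::_) measure). sobolev_stat v n U > c})
          \<longlonglongrightarrow> 1) \<and>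
        (\<forall>\<alpha>. 0 < \<alpha> \<and> \<alpha> < 1 \<longrightarrow>
          (\<lambda>n. measure (sample_law n (\<kappa> n) f)
            {U \<in> space (sample_law n (\<kappa> n) f :: (nat \<Rightarrow> real ^ 'p::_) measure). sobolev_stat v n U >
              upper_quantile
                (weighted_chi_square K\<^sub>v (\<lambda>k. (v k)\<^sup>2) (d_const CARD('p)) (\<lambda>_. 0)) \<alpha>})
          \<longlonglongrightarrow> 1))"
proof -
  let ?Q = "\<lambda>n. sample_law n (\<kappa> n) f :: (nat \<Rightarrow> real ^ 'p::_) measure"
  let ?S = "\<lambda>n. distr (?Q n) borel (sobolev_stat v n)"
  let ?W = "weighted_chi_square K\<^sub>v (\<lambda>k. (v k)\<^sup>2) (d_const CARD('p))"
  let ?p = "CARD('p)"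
  have k_supp: "k\<^sub>v \<in> coeff_support v" and K_supp: "K\<^sub>v \<in> coeff_support v"
    unfolding k\<^sub>v K\<^sub>v using finite nonzero by (auto intro: Min_in Max_in)
  then have kv: "1 \<le> k\<^sub>v" "k\<^sub>v \<le> K\<^sub>v" "v k\<^sub>v \<noteq> 0" and "1 \<le> K\<^sub>v"
    unfolding K\<^sub>v using finite by (auto simp: coeff_support_def)
  have v: "\<forall>k>K\<^sub>v. v k = 0"
  proof (intro allI impI, rule ccontr)
    fix k assume "K\<^sub>v < k" "v k \<noteq> 0"
    then have "k \<in> coeff_support v" by (simp add: coeff_support_def)
    then show False
      using Max_ge[OF finite, of k] \<open>K\<^sub>v < k\<close> unfolding K\<^sub>v by simp
  qed
  have k_ge: "k\<^sub>v \<le> k" if "1 \<le> k" "v k \<noteq> 0" for k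
    using Min_le[OF finite, of k] that unfolding k\<^sub>v by (simp add: coeff_support_def)
  have \<kappa>0: "\<kappa> \<longlonglongrightarrow> 0"
    using smalloD_tendsto[OF \<kappa>(2)] by simp
  interpret shrinking_angular f \<kappa> K\<^sub>v
    by unfold_locales (use f \<kappa>(1) \<kappa>0 \<open>1 \<le> K\<^sub>v\<close> in auto)
  define \<rho> where "\<rho> n = real n powr (1 / (2 * real k\<^sub>v)) * \<kappa> n" for n
  have \<rho>: "sqrt (real n) * \<kappa> n ^ k\<^sub>v = \<rho> n ^ k\<^sub>v" for n
  proof (cases "n = 0")
    case False
    then have "(real n powr (1 / (2 * real k\<^sub>v))) ^ k\<^sub>v = real n powr (1 / 2)"
      using kv(1) by (simp add: powr_powr flip: powr_realpow)
    then show ?thesis by (simp add: \<rho>_def power_mult_distrib powr_half_sqrt)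
  qed (use kv(1) in \<open>simp add: \<rho>_def\<close>)
  \<comment> \<open>Active degrees above \<open>k\<^sub>v\<close> gain a positive power of \<kappa>
    and hence have limiting rate 0; the convention \<open>0 ^ 0 = 1\<close> covers
    \<open>k = k\<^sub>v\<close>.\<close>
  have rate: "(\<lambda>n. sqrt (real n) * \<kappa> n ^ k) \<longlonglongrightarrow> (if k = k\<^sub>v then r ^ k\<^sub>v else 0)"
    if "\<rho> \<longlonglongrightarrow> r" "1 \<le> k" "v k \<noteq> 0" for k r
  proof -
    have "(\<lambda>n. \<rho> n ^ k\<^sub>v * \<kappa> n ^ (k - k\<^sub>v)) \<longlonglongrightarrow> r ^ k\<^sub>v * 0 ^ (k - k\<^sub>v)"
      by (intro tendsto_intros that(1) \<kappa>0)
    moreover have "\<rho> n ^ k\<^sub>v * \<kappa> n ^ (k - k\<^sub>v) = sqrt (real n) * \<kappa> n ^ k" for n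
      using k_ge[OF that(2,3)] by (simp add: \<rho>[symmetric] mult.assoc flip: power_add)
    moreover have "r ^ k\<^sub>v * 0 ^ (k - k\<^sub>v) = (if k = k\<^sub>v then r ^ k\<^sub>v else 0)"
      using k_ge[OF that(2,3)] by simp
    ultimately show ?thesis by simp
  qed
  have \<rho>_eq: "\<rho> n = \<kappa> n / real n powr (- 1 / (2 * real k\<^sub>v))" for n
  proof -
    have "real n powr (- 1 / (2 * real k\<^sub>v)) = inverse (real n powr (1 / (2 * real k\<^sub>v)))"
      by (simp only: minus_divide_left[symmetric] powr_minus)
    then show ?thesis by (simp only: \<rho>_def divide_inverse inverse_inverse_eq mult.commute)
  qed
  show ?thesis
  proof (intro conjI allI impI)
    fix k assume "1 \<le> k \<and> k \<le> K\<^sub>v"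
    then show "xi ?p f k \<tau> = real (d_const ?p k) * ((deriv ^^ k) f 0)\<^sup>2 * \<tau> ^ (2 * k)
        / (\<Prod>l=0..k-1. (real ?p + 2 * real l)\<^sup>2)"
      by (intro xi_eq dim) auto
  next
    assume "\<kappa> \<in> o(\<lambda>n. real n powr (- 1 / (2 * real k\<^sub>v)))"
    then have "\<rho> \<longlonglongrightarrow> 0"
      unfolding \<rho>_eq by (rule smalloD_tendsto)
    then have "(\<lambda>n. sqrt (real n) * \<kappa> n ^ k) \<longlonglongrightarrow> 0" if "1 \<le> k" "v k \<noteq> 0" for k
      using rate[OF _ that, of 0] kv(1) by (simp add: power_0_left split: if_splits)
    then show "weak_conv_m
        ?S
        (?W (\<lambda>_. 0))"
      by (intro sobolev_stat_weak_conv[where s = "\<lambda>_. 0"] dim v) auto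
  next
    assume \<kappa>_eq: "\<forall>n\<ge>1. \<kappa> n = real n powr (- 1 / (2 * real k\<^sub>v)) * \<tau>"
    have "\<forall>\<^sub>F n in sequentially. \<tau> = \<rho> n"
      using eventually_ge_at_top[of 1] by eventually_elim (simp add: \<rho>_eq \<kappa>_eq)
    then have "\<rho> \<longlonglongrightarrow> \<tau>"
      by (rule Lim_transform_eventually[OF tendsto_const])
    note lim = rate[OF this]
    show "weak_conv_m
        ?S
        (?W (\<lambda>k. if k = k\<^sub>v then xi CARD('p) f k\<^sub>v \<tau> else 0))"
    proof (rule sobolev_stat_weak_conv[where s = "\<lambda>k. if k = k\<^sub>v then \<tau> ^ k\<^sub>v else 0", OF dim v lim])
      show "0 \<le> (if k = k\<^sub>v then xi ?p f k\<^sub>v \<tau> else 0)" for k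
        by (simp add: xi_def power_mult)
      show "(if k = k\<^sub>v then xi ?p f k\<^sub>v \<tau> else 0) = ((if k = k\<^sub>v then \<tau> ^ k\<^sub>v else 0) * ((deriv ^^ k) f 0 / fact k) *
          (monomial_coeff ?p k k / zonal_factor ((real ?p - 2) / 2) k))\<^sup>2 * real (d_const ?p k)" for k
        using t_const_eq[OF dim kv(1)]
        by (simp add: xi_def power_mult_distrib power_divide power_mult mult_ac)
    qed auto
  next
    assume A: "filterlim (\<lambda>n. real n powr (1 / (2 * real k\<^sub>v)) * \<kappa> n) at_top at_top \<and> (deriv ^^ k\<^sub>v) f 0 \<noteq> 0"
    then have "filterlim (\<lambda>n. sqrt (real n) * \<kappa> n ^ k\<^sub>v) at_top sequentially"
      unfolding \<rho> using kv(1) by (intro filterlim_pow_at_top) (auto simp: \<rho>_def)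
    then have lim: "(\<lambda>n. measure (?Q n) {U \<in> space (?Q n). sobolev_stat v n U > c}) \<longlonglongrightarrow> 1" for c
      using A by (intro sobolev_stat_consistent[OF dim v kv]) auto
    show "(\<lambda>n. measure (?Q n) {U \<in> space (?Q n). sobolev_stat v n U > c}) \<longlonglongrightarrow> 1" for c
      by (rule lim)
    show "(\<lambda>n. measure (?Q n) {U \<in> space (?Q n). sobolev_stat v n U > upper_quantile (?W (\<lambda>_. 0)) \<alpha>}) \<longlonglongrightarrow> 1" for \<alpha>
      by (rule lim)
  qed
qed

end
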